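(* Every eventually outward quiver $\Omega$ of type $D_\infty$ has well-founded (FLEI) indecomposables: there is no infinite sequence $W_1\to W_2\to W_3\to\cdots$ of morphisms between indecomposable FLEI representations of $\Omega$ in which every morphism is nontrivial.
   Context: A quiver is a (possibly infinite) set of vertices together with a set of ordered pairs of vertices (arrows) with source and target maps $s,t$. A quiver is of type $D_\infty$ if its underlying graph has vertices $u,u',v_1,v_2,v_3,\dots$ and edges $u-v_1$, $u'-v_1$, and $v_j-v_{j+1}$ for $j\ge 1$ (with arbitrary orientation). A journey is an undirected path (no repeated vertices or arrows) that is finite, or infinite in one direction, with a chosen starting vertex, called its source. A quiver is eventually outward if every journey contains at most finitely many arrows that point towards the source of that journey. A representation $V$ (over a fixed field) assigns to each vertex $i$ a vector space $V(i)$ and to each arrow $a$ a linear map $V(a):V(s(a))\to V(t(a))$. $V$ is FLEI if every $V(i)$ is finite-dimensional and $V(a)$ is an isomorphism for all but finitely many arrows $a$. A morphism is nontrivial if it is neither zero nor an isomorphism. *)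

theory Defs
  imports "Graph_Theory.Digraph" "HOL-Library.Extended_Nat"
begin

text \<open>
  A quiver is a well-formed directed graph \<open>Q :: ('a, 'b) pre_digraph\<close>, where \<open>tail Q\<close> and
  \<open>head Q\<close> are the source and target maps. The vertex and arrow sets may be infinite.
\<close>

text \<open>\<open>DV j\<close> stands for the vertex v with index \<open>j + 1\<close>, so \<open>DV 0\<close> is the branching vertex.\<close>

datatype d_inf_vertex = DU | DU' | DV nat

definition d_inf_edges :: "d_inf_vertex set set" where
  "d_inf_edges = {{DU, DV 0}, {DU', DV 0}} \<union> {{DV j, DV (Suc j)} | j. True}"

text \<open>
  The second conjunct says that every edge of the graph carries exactly one arrow, in one of its
  two orientations, and that there are no further arrows.
\<close>

definition type_D_inf :: "('a, 'b) pre_digraph \<Rightarrow> bool" where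
  "type_D_inf Q \<longleftrightarrow>
     (\<exists>\<phi> :: 'a \<Rightarrow> d_inf_vertex.
        bij_betw \<phi> (verts Q) UNIV \<and>
        bij_betw (\<lambda>a. {\<phi> (tail Q a), \<phi> (head Q a)}) (arcs Q) d_inf_edges)"

text \<open>
  A journey of length \<open>n\<close> (possibly \<open>\<infinity>\<close>) with source \<open>p 0\<close> visits the vertices
  \<open>p 0, p 1, \<dots>\<close> and uses the arrow \<open>e i\<close>, in either direction, to pass from \<open>p i\<close> to
  \<open>p (Suc i)\<close>. The values \<open>p i\<close> for \<open>i > n\<close> and \<open>e i\<close> for \<open>i \<ge> n\<close> are irrelevant.
\<close>

definition journey ::
  "('a, 'b) pre_digraph \<Rightarrow> enat \<Rightarrow> (nat \<Rightarrow> 'a) \<Rightarrow> (nat \<Rightarrow> 'b) \<Rightarrow> bool" where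
  "journey Q n p e \<longleftrightarrow>
     (\<forall>i. enat i \<le> n \<longrightarrow> p i \<in> verts Q) \<and>
     (\<forall>i. enat i < n \<longrightarrow>
        e i \<in> arcs Q \<and>
        (tail Q (e i) = p i \<and> head Q (e i) = p (Suc i) \<or>
         tail Q (e i) = p (Suc i) \<and> head Q (e i) = p i)) \<and>
     inj_on p {i. enat i \<le> n} \<and>
     inj_on e {i. enat i < n}"

definition inward_arrows ::
  "('a, 'b) pre_digraph \<Rightarrow> enat \<Rightarrow> (nat \<Rightarrow> 'a) \<Rightarrow> (nat \<Rightarrow> 'b) \<Rightarrow> 'b set" where
  "inward_arrows Q n p e =
     {e i | i. enat i < n \<and> tail Q (e i) = p (Suc i) \<and> head Q (e i) = p i}"

definition eventually_outward :: "('a, 'b) pre_digraph \<Rightarrow> bool" where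
  "eventually_outward Q \<longleftrightarrow> (\<forall>n p e. journey Q n p e \<longrightarrow> finite (inward_arrows Q n p e))"

text \<open>
  The vector spaces of a representation are subspaces of an ambient vector space, given by its
  scalar multiplication \<open>s :: 'k::field \<Rightarrow> 'v::ab_group_add \<Rightarrow> 'v\<close>. This loses no generality,
  since \<open>'k\<close>, \<open>'v\<close> and \<open>s\<close> are arbitrary: any family of vector spaces over one field embeds
  in its direct sum. The values of \<open>space V\<close> outside the vertices, of \<open>amap V\<close> outside the arrows,
  and of linear maps outside their domains are irrelevant and ignored throughout.
\<close>

record ('a, 'b, 'v) rep =
  space :: "'a \<Rightarrow> 'v set"
  amap :: "'b \<Rightarrow> 'v \<Rightarrow> 'v"

definition linear_map ::
  "('k::field \<Rightarrow> 'v::ab_group_add \<Rightarrow> 'v) \<Rightarrow> 'v set \<Rightarrow> 'v set \<Rightarrow> ('v \<Rightarrow> 'v) \<Rightarrow> bool" where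
  "linear_map s X Y f \<longleftrightarrow>
     f ` X \<subseteq> Y \<and>
     (\<forall>x\<in>X. \<forall>y\<in>X. f (x + y) = f x + f y) \<and>
     (\<forall>c. \<forall>x\<in>X. f (s c x) = s c (f x))"

definition representation ::
  "('a, 'b) pre_digraph \<Rightarrow> ('k::field \<Rightarrow> 'v::ab_group_add \<Rightarrow> 'v) \<Rightarrow> ('a, 'b, 'v) rep \<Rightarrow> bool" where
  "representation Q s V \<longleftrightarrow>
     (\<forall>i\<in>verts Q. module.subspace s (space V i)) \<and>
     (\<forall>a\<in>arcs Q. linear_map s (space V (tail Q a)) (space V (head Q a)) (amap V a))"

definition FLEI ::
  "('a, 'b) pre_digraph \<Rightarrow> ('k::field \<Rightarrow> 'v::ab_group_add \<Rightarrow> 'v) \<Rightarrow> ('a, 'b, 'v) rep \<Rightarrow> bool" where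
  "FLEI Q s V \<longleftrightarrow>
     representation Q s V \<and>
     (\<forall>i\<in>verts Q. \<exists>B. finite B \<and> module.span s B = space V i) \<and>
     finite {a \<in> arcs Q. \<not> bij_betw (amap V a) (space V (tail Q a)) (space V (head Q a))}"

definition zero_rep :: "('a, 'b) pre_digraph \<Rightarrow> ('a, 'b, 'v::zero) rep \<Rightarrow> bool" where
  "zero_rep Q V \<longleftrightarrow> (\<forall>i\<in>verts Q. space V i = {0})"

definition subrepresentation ::
  "('a, 'b) pre_digraph \<Rightarrow> ('k::field \<Rightarrow> 'v::ab_group_add \<Rightarrow> 'v) \<Rightarrow>
   ('a, 'b, 'v) rep \<Rightarrow> ('a, 'b, 'v) rep \<Rightarrow> bool" where
  "subrepresentation Q s A V \<longleftrightarrow>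
     representation Q s A \<and>
     (\<forall>i\<in>verts Q. space A i \<subseteq> space V i) \<and>
     (\<forall>a\<in>arcs Q. \<forall>x\<in>space A (tail Q a). amap A a x = amap V a x)"

definition direct_sum_of ::
  "('a, 'b) pre_digraph \<Rightarrow> ('k::field \<Rightarrow> 'v::ab_group_add \<Rightarrow> 'v) \<Rightarrow>
   ('a, 'b, 'v) rep \<Rightarrow> ('a, 'b, 'v) rep \<Rightarrow> ('a, 'b, 'v) rep \<Rightarrow> bool" where
  "direct_sum_of Q s V A B \<longleftrightarrow>
     subrepresentation Q s A V \<and> subrepresentation Q s B V \<and>
     (\<forall>i\<in>verts Q.
        space V i = {x + y | x y. x \<in> space A i \<and> y \<in> space B i} \<and>
        space A i \<inter> space B i = {0})"

definition indecomposable ::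
  "('a, 'b) pre_digraph \<Rightarrow> ('k::field \<Rightarrow> 'v::ab_group_add \<Rightarrow> 'v) \<Rightarrow> ('a, 'b, 'v) rep \<Rightarrow> bool" where
  "indecomposable Q s V \<longleftrightarrow>
     representation Q s V \<and> \<not> zero_rep Q V \<and>
     (\<forall>A B. direct_sum_of Q s V A B \<longrightarrow> zero_rep Q A \<or> zero_rep Q B)"

definition morphism ::
  "('a, 'b) pre_digraph \<Rightarrow> ('k::field \<Rightarrow> 'v::ab_group_add \<Rightarrow> 'v) \<Rightarrow>
   ('a, 'b, 'v) rep \<Rightarrow> ('a, 'b, 'v) rep \<Rightarrow> ('a \<Rightarrow> 'v \<Rightarrow> 'v) \<Rightarrow> bool" where
  "morphism Q s V W f \<longleftrightarrow>
     (\<forall>i\<in>verts Q. linear_map s (space V i) (space W i) (f i)) \<and>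
     (\<forall>a\<in>arcs Q. \<forall>x\<in>space V (tail Q a).
        f (head Q a) (amap V a x) = amap W a (f (tail Q a) x))"

definition zero_morphism ::
  "('a, 'b) pre_digraph \<Rightarrow> ('a, 'b, 'v::zero) rep \<Rightarrow> ('a \<Rightarrow> 'v \<Rightarrow> 'v) \<Rightarrow> bool" where
  "zero_morphism Q V f \<longleftrightarrow> (\<forall>i\<in>verts Q. \<forall>x\<in>space V i. f i x = 0)"

definition isomorphism ::
  "('a, 'b) pre_digraph \<Rightarrow> ('k::field \<Rightarrow> 'v::ab_group_add \<Rightarrow> 'v) \<Rightarrow>
   ('a, 'b, 'v) rep \<Rightarrow> ('a, 'b, 'v) rep \<Rightarrow> ('a \<Rightarrow> 'v \<Rightarrow> 'v) \<Rightarrow> bool" where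
  "isomorphism Q s V W f \<longleftrightarrow>
     morphism Q s V W f \<and> (\<forall>i\<in>verts Q. bij_betw (f i) (space V i) (space W i))"

definition nontrivial_morphism ::
  "('a, 'b) pre_digraph \<Rightarrow> ('k::field \<Rightarrow> 'v::ab_group_add \<Rightarrow> 'v) \<Rightarrow>
   ('a, 'b, 'v) rep \<Rightarrow> ('a, 'b, 'v) rep \<Rightarrow> ('a \<Rightarrow> 'v \<Rightarrow> 'v) \<Rightarrow> bool" where
  "nontrivial_morphism Q s V W f \<longleftrightarrow>
     morphism Q s V W f \<and> \<not> zero_morphism Q V f \<and> \<not> isomorphism Q s V W f"

definition well_founded_indecomposables ::
  "('a, 'b) pre_digraph \<Rightarrow> ('k::field \<Rightarrow> 'v::ab_group_add \<Rightarrow> 'v) \<Rightarrow> bool" where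
  "well_founded_indecomposables Q s \<longleftrightarrow>
     \<not> (\<exists>(W :: nat \<Rightarrow> ('a, 'b, 'v) rep) f.
          \<forall>n. FLEI Q s (W n) \<and> indecomposable Q s (W n) \<and>
              nontrivial_morphism Q s (W n) (W (Suc n)) (f n))"

end

theory Submission
  imports Defs
begin

text \<open>
  The branching vertex \<open>DV 0\<close> is taken as the root of the tree, so that a representation \<open>V\<close> consists
  of three arms starting at the root space \<open>E\<close>. Each arm induces a chain of subspaces of \<open>E\<close>, by
  transporting the full and the zero space of every position back to the root. For the two short
  arms this gives a single interesting subspace each, \<open>K\<close> and \<open>K'\<close>; for the long arm it gives a
  chain \<open>F\<close>, finite because all but finitely many maps are bijective.

  An indecomposable \<open>V\<close> has only trivial idempotent endomorphisms. Idempotents are built from strands: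
  a vector \<open>x\<close> of \<open>E\<close> and a functional \<open>\<phi>\<close> extend along an arm to an endomorphism of rank at most one
  at each position as soon as each member of the chain of the arm contains \<open>x\<close> or is killed by \<open>\<phi>\<close>
  (lemma \<open>strand_exists\<close>). So the indecomposables with \<open>E \<noteq> {0}\<close> can be read off from the
  configuration \<open>(E; K, K', F)\<close> of two subspaces and a chain (lemma \<open>line_or_plane_splits\<close>): either \<open>E\<close>
  is a line, or it is a plane in which \<open>K\<close>, \<open>K'\<close> and the only proper nonzero member of \<open>F\<close> are three
  different lines. Moreover \<open>V\<close> is then regular: maps pointing away from the root are surjective
  and the others injective, so nothing on the arms is invisible at the root. If \<open>E = {0}\<close>, the same
  holds with the first vertex \<open>DV a\<close> of the long arm at which \<open>V\<close> does not vanish in place of the root,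
  or else \<open>V\<close> is concentrated at one of the two short ends (lemma \<open>rooted_or_leaf\<close>). The latter case is
  impossible inside a chain of nontrivial morphisms, since such a representation is a simple
  injective or projective.

  Now consider a chain \<open>W 0 \<rightarrow> W 1 \<rightarrow> \<dots>\<close> of nontrivial morphisms. A nonzero morphism between regular
  representations is nonzero at the later of their two roots. Hence the root can move to a smaller
  vertex only if the edge before the old root points outwards, and to a larger vertex only if the
  edge before the new root points inwards. So the roots whose preceding edge points outwards occur
  first, in descending order, then \<open>DV 0\<close>, and then, in ascending order, those whose preceding
  edge points inwards, of which there are finitely many as the quiver is eventually outward.
  At \<open>DV 0\<close> the configuration \<open>(K, K')\<close> moves through three stages. This gives a natural number that
  never increases (lemma \<open>rank_decreases\<close>), so it is eventually constant. From there on each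
  member of \<open>F\<close>, weighted by its dimension relative to \<open>E\<close>, can only grow. The weights are
  bounded by 2 and monotone along the chain of morphisms as well as, far enough out, along the
  arm, so they all become constant simultaneously. But a morphism that changes none of them is
  an isomorphism (lemma \<open>root_weight_hom\<close>).
\<close>

section \<open>Functionals on subspaces\<close>

text \<open>
  A locale of its own, so that the notions below are not inherited by the interpretations of
  \<^locale>\<open>vector_space\<close> for real vector spaces.
\<close>

locale ambient_space = vector_space scale
  for scale :: "'k::field \<Rightarrow> 'v::ab_group_add \<Rightarrow> 'v" (infixr \<open>*s\<close> 75)
begin

definition functional :: "('v \<Rightarrow> 'k) \<Rightarrow> bool" where
  "functional \<phi> \<longleftrightarrow>
     (\<forall>x y. \<phi> (x + y) = \<phi> x + \<phi> y) \<and> (\<forall>c x. \<phi> (c *s x) = c * \<phi> x)"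

lemma functionalD:
  fixes \<phi> :: "'v \<Rightarrow> 'k" and x y :: 'v
  assumes "functional \<phi>"
  shows "\<phi> (x + y) = \<phi> x + \<phi> y" "\<phi> (c *s x) = c * \<phi> x"
    "\<phi> 0 = 0" "\<phi> (- x) = - \<phi> x" "\<phi> (x - y) = \<phi> x - \<phi> y"
proof -
  have add: "\<phi> (x + y) = \<phi> x + \<phi> y" for x y
    using assms by (simp add: functional_def)
  have scale: "\<phi> (c *s x) = c * \<phi> x" for c x
    using assms by (simp add: functional_def)
  show "\<phi> (x + y) = \<phi> x + \<phi> y" "\<phi> (c *s x) = c * \<phi> x"
    by (rule add, rule scale)
  show "\<phi> 0 = 0"
    using scale[of 0 0] by simp
  show neg: "\<phi> (- x) = - \<phi> x" for x
    using scale[of "- 1" x] by simp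
  show "\<phi> (x - y) = \<phi> x - \<phi> y"
    using add[of x "- y"] neg[of y] by simp
qed

lemma functional_0: "functional (\<lambda>v. 0)"
  by (simp add: functional_def)

lemma functional_diff:
  "functional \<phi> \<Longrightarrow> functional \<psi> \<Longrightarrow> functional (\<lambda>v. \<phi> v - \<psi> v)"
  by (simp add: functional_def algebra_simps)

lemma functional_of_linear:
  assumes "Vector_Spaces.linear scale (*) \<phi>"
  shows "functional \<phi>"
proof -
  interpret l: Vector_Spaces.linear scale "(*)" \<phi> by (rule assms)
  show ?thesis
    by (simp add: functional_def l.add l.scale)
qed

lemma vector_space_pair_field: "vector_space_pair scale ((*) :: 'k \<Rightarrow> 'k \<Rightarrow> 'k)"
  by unfold_locales (simp_all add: algebra_simps)

lemma separating_functional: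
  assumes P: "subspace P" and x: "x \<notin> P"
  obtains \<phi> where "functional \<phi>" "\<phi> x = 1" "\<And>v. v \<in> P \<Longrightarrow> \<phi> v = 0"
proof -
  interpret vp: vector_space_pair scale "(*) :: 'k \<Rightarrow> 'k \<Rightarrow> 'k"
    by (rule vector_space_pair_field)
  obtain B where B: "B \<subseteq> P" "independent B" "P \<subseteq> span B"
    using maximal_independent_subset by blast
  have span: "span B = P"
    using B P by (simp add: span_minimal subset_antisym)
  have "independent (insert x B)"
    using B x span by (simp add: independent_insertI)
  then obtain \<phi> where lin: "Vector_Spaces.linear scale (*) \<phi>"
    and eq: "\<forall>b\<in>insert x B. \<phi> b = (if b = x then 1 else 0)"
    using vp.linear_independent_extend[of "insert x B" "\<lambda>b. if b = x then 1 else 0"] by blast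
  note f = functional_of_linear[OF lin]
  have "\<phi> v = 0" if "v \<in> P" for v
  proof -
    have sub: "subspace {v. \<phi> v = 0}"
      by (rule subspaceI) (simp_all add: functionalD[OF f])
    have "B \<subseteq> {v. \<phi> v = 0}"
      using eq B(1) x by auto
    then have "span B \<subseteq> {v. \<phi> v = 0}"
      using sub by (rule span_minimal)
    then show ?thesis
      using that span by auto
  qed
  then show ?thesis
    using that f eq by simp
qed

lemma extend_functional:
  assumes P: "subspace P"
    and add: "\<And>x y. x \<in> P \<Longrightarrow> y \<in> P \<Longrightarrow> h (x + y) = h x + h y"
    and scale: "\<And>c x. x \<in> P \<Longrightarrow> h (c *s x) = c * h x"
  obtains \<phi> where "functional \<phi>" "\<And>v. v \<in> P \<Longrightarrow> \<phi> v = h v"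
proof -
  interpret vp: vector_space_pair scale "(*) :: 'k \<Rightarrow> 'k \<Rightarrow> 'k"
    by (rule vector_space_pair_field)
  obtain B where B: "B \<subseteq> P" "independent B" "P \<subseteq> span B"
    using maximal_independent_subset by blast
  then obtain \<phi> where lin: "Vector_Spaces.linear scale (*) \<phi>" and eq: "\<forall>b\<in>B. \<phi> b = h b"
    using vp.linear_independent_extend[of B h] by blast
  note f = functional_of_linear[OF lin]
  have h0: "h 0 = 0"
    using scale[of 0 0] P by (simp add: subspace_0)
  have sub: "subspace {v \<in> P. \<phi> v = h v}"
    by (rule subspaceI)
      (use P in \<open>auto simp: functionalD[OF f] h0 add scale subspace_0 subspace_add subspace_scale\<close>)
  have "B \<subseteq> {v \<in> P. \<phi> v = h v}"
    using eq B(1) by auto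
  then have "span B \<subseteq> {v \<in> P. \<phi> v = h v}"
    using sub by (rule span_minimal)
  then show ?thesis
    using that f B(3) by blast
qed

lemma linear_mapD:
  assumes "linear_map scale X Y f" "subspace X"
  shows "x \<in> X \<Longrightarrow> f x \<in> Y"
    "x \<in> X \<Longrightarrow> y \<in> X \<Longrightarrow> f (x + y) = f x + f y"
    "x \<in> X \<Longrightarrow> f (c *s x) = c *s f x"
    "f 0 = 0"
    "x \<in> X \<Longrightarrow> y \<in> X \<Longrightarrow> f (x - y) = f x - f y"
proof -
  show *: "x \<in> X \<Longrightarrow> f x \<in> Y" "x \<in> X \<Longrightarrow> y \<in> X \<Longrightarrow> f (x + y) = f x + f y"
    "x \<in> X \<Longrightarrow> f (c *s x) = c *s f x" for x y c
    using assms(1) by (auto simp: linear_map_def)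
  show "f 0 = 0"
    using *(3)[of 0 0] assms(2) by (simp add: subspace_0)
  show "f (x - y) = f x - f y" if "x \<in> X" "y \<in> X"
    using *(2)[of "x - y" y] that assms(2) by (simp add: subspace_diff)
qed

lemma subspace_preimage:
  assumes "linear_map scale X Y f" "subspace X" "subspace S"
  shows "subspace {x \<in> X. f x \<in> S}"
  using assms(2,3)
  by (intro subspaceI)
    (auto simp: linear_mapD[OF assms(1,2)] subspace_0 subspace_add subspace_scale)

lemma subspace_linear_image:
  assumes "linear_map scale X Y f" "subspace X" "subspace S" "S \<subseteq> X"
  shows "subspace (f ` S)"
proof (rule subspaceI)
  note f = linear_mapD[OF assms(1,2)]
  show "0 \<in> f ` S"
    using f(4) subspace_0[OF assms(3)] by (metis image_eqI)
  show "x + y \<in> f ` S" if "x \<in> f ` S" "y \<in> f ` S" for x y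
    using that assms(4) subspace_add[OF assms(3)] f(2) by (smt (verit) image_iff subset_iff)
  show "c *s x \<in> f ` S" if "x \<in> f ` S" for c x
    using that assms(4) subspace_scale[OF assms(3)] f(3) by (smt (verit) image_iff subset_iff)
qed

text \<open>
  The only obstruction to transporting a functional along a linear map, with prescribed zeros \<open>S\<close>
  on the target, is that the preimage of \<open>S\<close> has to be killed already. With \<open>S = {0}\<close> this is the
  usual factorisation through the image of the map.
\<close>

lemma push_functional:
  assumes f: "linear_map scale X Y f" and X: "subspace X" and S: "subspace S"
    and \<phi>: "functional \<phi>" and kills: "\<And>x. x \<in> X \<Longrightarrow> f x \<in> S \<Longrightarrow> \<phi> x = 0"
  obtains \<psi> where "functional \<psi>" "\<And>x. x \<in> X \<Longrightarrow> \<psi> (f x) = \<phi> x" "\<And>v. v \<in> S \<Longrightarrow> \<psi> v = 0"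
proof -
  note fD = linear_mapD[OF f X]
  define P where "P = {u + v |u v. u \<in> f ` X \<and> v \<in> S}"
  define h where "h p = \<phi> (SOME x. x \<in> X \<and> p - f x \<in> S)" for p
  have P: "subspace P"
    unfolding P_def using subspace_linear_image[OF f X X] S by (intro subspace_sums) auto
  have h: "h (f x + v) = \<phi> x" if "x \<in> X" "v \<in> S" for x v
  proof -
    let ?y = "SOME y. y \<in> X \<and> f x + v - f y \<in> S"
    have y: "?y \<in> X \<and> f x + v - f ?y \<in> S"
      by (rule someI[of _ x]) (use that in simp)
    then have "f x + v - f ?y - v \<in> S"
      using that S subspace_diff by blast
    moreover have "f x + v - f ?y - v = f (x - ?y)"
      using y that by (simp add: fD(5))
    ultimately have "\<phi> (x - ?y) = 0"
      using kills y that X by (simp add: subspace_diff)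
    then show ?thesis
      by (simp add: h_def functionalD[OF \<phi>])
  qed
  have add: "h (p + q) = h p + h q" if pq: "p \<in> P" "q \<in> P" for p q
  proof -
    obtain x v y w where *: "x \<in> X" "v \<in> S" "p = f x + v" "y \<in> X" "w \<in> S" "q = f y + w"
      using pq unfolding P_def by blast
    then have eq: "p + q = f (x + y) + (v + w)"
      by (simp add: fD(2))
    show ?thesis
      unfolding eq using * X S
      by (simp add: h subspace_add functionalD[OF \<phi>])
  qed
  have scale: "h (c *s p) = c * h p" if p: "p \<in> P" for c p
  proof -
    obtain x v where *: "x \<in> X" "v \<in> S" "p = f x + v"
      using p unfolding P_def by blast
    then have eq: "c *s p = f (c *s x) + c *s v"
      by (simp add: fD scale_right_distrib)
    show ?thesis
      unfolding eq using * X S by (simp add: h subspace_scale functionalD[OF \<phi>])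
  qed
  obtain \<psi> where \<psi>: "functional \<psi>" "\<And>v. v \<in> P \<Longrightarrow> \<psi> v = h v"
    using extend_functional[of P h] P add scale by blast
  show ?thesis
  proof (rule that[OF \<psi>(1)])
    show "\<psi> (f x) = \<phi> x" if "x \<in> X" for x
    proof -
      have "f x + 0 \<in> P"
        using that S unfolding P_def by (blast intro: subspace_0)
      then show ?thesis
        using \<psi>(2)[of "f x + 0"] h[OF that, of 0] S by (simp add: subspace_0)
    qed
    show "\<psi> v = 0" if "v \<in> S" for v
    proof -
      have "f 0 + v \<in> P"
        using that X unfolding P_def by (blast intro: subspace_0)
      then show ?thesis
        using \<psi>(2)[of "f 0 + v"] h[of 0 v] that X fD(4)
        by (simp add: subspace_0 functionalD[OF \<phi>])
    qed
  qed
qed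

lemma linear_map_id: "X \<subseteq> Y \<Longrightarrow> linear_map scale X Y (\<lambda>v. v)"
  by (auto simp: linear_map_def)

end

section \<open>Arms and their filtrations\<close>

text \<open>
  An arm is a representation of a one-sided infinite path \<open>0 - 1 - 2 - \<dots>\<close>. The step between
  \<open>j\<close> and \<open>j + 1\<close> carries the linear map \<open>g j\<close>, which points away from \<open>0\<close> if \<open>d j\<close> holds and
  towards \<open>0\<close> otherwise. The sets \<open>arm_filt b j\<close> are what the whole space (\<open>b = True\<close>) and the
  zero space (\<open>b = False\<close>) at position \<open>j\<close> become when they are transported back to position \<open>0\<close>
  by taking preimages under outward maps and images under inward ones.
\<close>

primrec arm_filt ::
  "bool \<Rightarrow> nat \<Rightarrow> (nat \<Rightarrow> 'v set) \<Rightarrow> (nat \<Rightarrow> bool) \<Rightarrow> (nat \<Rightarrow> 'v \<Rightarrow> 'v) \<Rightarrow> 'v::zero set" where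
  "arm_filt b 0 X d g = (if b then X 0 else {0})"
| "arm_filt b (Suc j) X d g =
     (let F = arm_filt b j (\<lambda>i. X (Suc i)) (\<lambda>i. d (Suc i)) (\<lambda>i. g (Suc i))
      in if d 0 then {x \<in> X 0. g 0 x \<in> F} else g 0 ` F)"

definition ultimately_iso ::
  "nat \<Rightarrow> (nat \<Rightarrow> 'v set) \<Rightarrow> (nat \<Rightarrow> bool) \<Rightarrow> (nat \<Rightarrow> 'v \<Rightarrow> 'v) \<Rightarrow> bool" where
  "ultimately_iso M X d g \<longleftrightarrow> (\<forall>j\<ge>M. d j \<and> bij_betw (g j) (X j) (X (Suc j)))"

lemma finite_chain_has_max:
  assumes "finite A" "A \<noteq> {}" "\<And>B C. B \<in> A \<Longrightarrow> C \<in> A \<Longrightarrow> B \<subseteq> C \<or> C \<subseteq> B"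
  shows "\<exists>M\<in>A. \<forall>B\<in>A. B \<subseteq> M"
  using finite_has_maximal[OF assms(1,2)] assms(3) by metis

lemma finite_chain_has_min:
  assumes "finite A" "A \<noteq> {}" "\<And>B C. B \<in> A \<Longrightarrow> C \<in> A \<Longrightarrow> B \<subseteq> C \<or> C \<subseteq> B"
  shows "\<exists>M\<in>A. \<forall>B\<in>A. M \<subseteq> B"
  using finite_has_minimal[OF assms(1,2)] assms(3) by metis

context ambient_space
begin

definition arm :: "(nat \<Rightarrow> 'v set) \<Rightarrow> (nat \<Rightarrow> bool) \<Rightarrow> (nat \<Rightarrow> 'v \<Rightarrow> 'v) \<Rightarrow> bool" where
  "arm X d g \<longleftrightarrow>
     (\<forall>j. subspace (X j) \<and>
        (if d j then linear_map scale (X j) (X (Suc j)) (g j)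
         else linear_map scale (X (Suc j)) (X j) (g j)))"

lemma arm_shift:
  "arm X d g \<Longrightarrow> arm (\<lambda>i. X (n + i)) (\<lambda>i. d (n + i)) (\<lambda>i. g (n + i))"
  by (simp add: arm_def)

lemma arm_Suc:
  "arm X d g \<Longrightarrow> arm (\<lambda>i. X (Suc i)) (\<lambda>i. d (Suc i)) (\<lambda>i. g (Suc i))"
  by (simp add: arm_def)

lemma arm_subspace: "arm X d g \<Longrightarrow> subspace (X j)"
  by (simp add: arm_def)

lemma arm_outward: "arm X d g \<Longrightarrow> d j \<Longrightarrow> linear_map scale (X j) (X (Suc j)) (g j)"
  by (simp add: arm_def)

lemma arm_inward: "arm X d g \<Longrightarrow> \<not> d j \<Longrightarrow> linear_map scale (X (Suc j)) (X j) (g j)"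
  by (simp add: arm_def)

lemma arm_map_0: "arm X d g \<Longrightarrow> g j 0 = 0"
  by (metis arm_inward arm_outward arm_subspace linear_mapD(4))

lemma arm_filt_subspace:
  "arm X d g \<Longrightarrow> subspace (arm_filt b j X d g) \<and> arm_filt b j X d g \<subseteq> X 0"
proof (induction j arbitrary: X d g)
  case 0
  then show ?case by (auto simp: arm_subspace subspace_0)
next
  case (Suc j)
  let ?F = "arm_filt b j (\<lambda>i. X (Suc i)) (\<lambda>i. d (Suc i)) (\<lambda>i. g (Suc i))"
  have F: "subspace ?F" "?F \<subseteq> X (Suc 0)"
    using Suc.IH[OF arm_Suc[OF Suc.prems]] by auto
  show ?case
  proof (cases "d 0")
    case True
    then show ?thesis
      using subspace_preimage[OF arm_outward[OF Suc.prems True] arm_subspace[OF Suc.prems] F(1)]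
      by (auto simp: Let_def)
  next
    case False
    note l = arm_inward[OF Suc.prems False] and X1 = arm_subspace[OF Suc.prems, of "Suc 0"]
    have "g 0 ` ?F \<subseteq> X 0"
      using F(2) linear_mapD(1)[OF l X1] by auto
    then show ?thesis
      using False subspace_linear_image[OF l X1 F] by (simp add: Let_def)
  qed
qed

lemma arm_filt_0_mem: "arm X d g \<Longrightarrow> 0 \<in> arm_filt b j X d g"
  using arm_filt_subspace subspace_0 by blast

lemma arm_filt_chain:
  "arm X d g \<Longrightarrow> arm_filt b i X d g \<subseteq> arm_filt c j X d g \<or> arm_filt c j X d g \<subseteq> arm_filt b i X d g"
proof (induction i arbitrary: j X d g)
  case 0
  then show ?case
    using arm_filt_subspace[OF 0, of c j] arm_filt_0_mem[OF 0, of c j] by auto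
next
  case (Suc i)
  show ?case
  proof (cases j)
    case 0
    then show ?thesis
      using arm_filt_subspace[OF Suc.prems, of b "Suc i"] arm_filt_0_mem[OF Suc.prems, of b "Suc i"]
      by (auto simp del: arm_filt.simps(2))
  next
    case (Suc j')
    then show ?thesis
      using Suc.IH[OF arm_Suc[OF Suc.prems], of j'] by (auto simp: Let_def)
  qed
qed

lemma arm_filt_mono: "arm X d g \<Longrightarrow> arm_filt False j X d g \<subseteq> arm_filt False (Suc j) X d g"
proof (induction j arbitrary: X d g)
  case 0
  then show ?case
    using arm_filt_0_mem[OF 0, of False "Suc 0"] by simp
next
  case (Suc j)
  show ?case
    using Suc.IH[OF arm_Suc[OF Suc.prems]]
    by (subst (1 2) arm_filt.simps(2)) (auto simp: Let_def simp del: arm_filt.simps(2))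
qed

lemma arm_filt_True_const:
  "arm X d g \<Longrightarrow> \<forall>j\<ge>M. d j \<Longrightarrow> M \<le> j \<Longrightarrow> arm_filt True j X d g = arm_filt True M X d g"
proof (induction M arbitrary: j X d g)
  case 0
  then show ?case
  proof (induction j arbitrary: X d g)
    case (Suc j)
    have "arm_filt True j (\<lambda>i. X (Suc i)) (\<lambda>i. d (Suc i)) (\<lambda>i. g (Suc i)) = X (Suc 0)"
      using Suc.IH[OF arm_Suc[OF Suc.prems(1)]] Suc.prems by simp
    then show ?case
      using linear_mapD(1)[OF arm_outward[OF Suc.prems(1), of 0] arm_subspace[OF Suc.prems(1)]]
        Suc.prems by auto
  qed simp
next
  case (Suc M)
  then obtain j' where j: "j = Suc j'" "M \<le> j'"
    by (cases j) auto
  have "arm_filt True j' (\<lambda>i. X (Suc i)) (\<lambda>i. d (Suc i)) (\<lambda>i. g (Suc i)) =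
        arm_filt True M (\<lambda>i. X (Suc i)) (\<lambda>i. d (Suc i)) (\<lambda>i. g (Suc i))"
    using Suc.prems j by (intro Suc.IH arm_Suc) auto
  then show ?case
    by (simp add: j)
qed

text \<open>
  Unlike for the full spaces, outward maps are not enough here: each kernel that is
  met on the way enlarges the subspace.
\<close>

lemma arm_filt_False_const:
  "arm X d g \<Longrightarrow> ultimately_iso M X d g \<Longrightarrow> M \<le> j \<Longrightarrow>
     arm_filt False j X d g = arm_filt False M X d g"
proof (induction M arbitrary: j X d g)
  case 0
  then show ?case
  proof (induction j arbitrary: X d g)
    case (Suc j)
    have "ultimately_iso 0 (\<lambda>i. X (Suc i)) (\<lambda>i. d (Suc i)) (\<lambda>i. g (Suc i))"
      using Suc.prems by (simp add: ultimately_iso_def)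
    then have F: "arm_filt False j (\<lambda>i. X (Suc i)) (\<lambda>i. d (Suc i)) (\<lambda>i. g (Suc i)) = {0}"
      using Suc.IH[OF arm_Suc[OF Suc.prems(1)]] by simp
    have inj: "inj_on (g 0) (X 0)" and d: "d 0"
      using Suc.prems by (auto simp: ultimately_iso_def bij_betw_def)
    have "x = 0" if "x \<in> X 0" "g 0 x = 0" for x
      using inj_onD[OF inj, of x 0] that arm_map_0[OF Suc.prems(1)] arm_subspace[OF Suc.prems(1)]
      by (simp add: subspace_0)
    then show ?case
      using F d arm_map_0[OF Suc.prems(1)] arm_subspace[OF Suc.prems(1)] by (auto simp: subspace_0)
  qed simp
next
  case (Suc M)
  then obtain j' where j: "j = Suc j'" "M \<le> j'"
    by (cases j) auto
  have "arm_filt False j' (\<lambda>i. X (Suc i)) (\<lambda>i. d (Suc i)) (\<lambda>i. g (Suc i)) =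
        arm_filt False M (\<lambda>i. X (Suc i)) (\<lambda>i. d (Suc i)) (\<lambda>i. g (Suc i))"
    using Suc.prems j by (intro Suc.IH arm_Suc) (auto simp: ultimately_iso_def)
  then show ?case
    by (simp add: j)
qed

lemma finite_arm_filt:
  assumes "arm X d g" "ultimately_iso M X d g"
  shows "finite {arm_filt b j X d g |b j. True}"
proof -
  have early: "\<exists>c i. i \<le> M \<and> arm_filt b j X d g = arm_filt c i X d g" for b j
  proof (cases "j \<le> M")
    case False
    then have "arm_filt b j X d g = arm_filt b M X d g"
      using arm_filt_True_const[OF assms(1), of M j] arm_filt_False_const[OF assms, of j] assms(2)
      by (cases b) (auto simp: ultimately_iso_def)
    then show ?thesis by blast
  qed blast
  have "{arm_filt b j X d g |b j. True} \<subseteq> (\<lambda>(b, j). arm_filt b j X d g) ` (UNIV \<times> {..M})"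
  proof
    fix S
    assume "S \<in> {arm_filt b j X d g |b j. True}"
    then obtain c i where "i \<le> M" "S = arm_filt c i X d g"
      using early by blast
    then show "S \<in> (\<lambda>(b, j). arm_filt b j X d g) ` (UNIV \<times> {..M})"
      by (intro image_eqI[of _ _ "(c, i)"]) auto
  qed
  then show ?thesis
    by (rule finite_subset) simp
qed

section \<open>Strands\<close>

text \<open>
  A strand is a sequence of vectors \<open>x j\<close> and functionals \<open>\<phi> j\<close> for which the maps
  \<open>v \<mapsto> \<phi> j v *s x j\<close> form an endomorphism of the arm. If \<open>\<phi> 0 (x 0) = 1\<close>, it follows a basis vector
  of an interval summand starting at \<open>0\<close>, together with the projection onto it, until the summand
  ends. The last condition on a step prevents a strand from starting again after its end.
\<close>

definition strand_step ::
  "bool \<Rightarrow> 'v set \<Rightarrow> 'v set \<Rightarrow> ('v \<Rightarrow> 'v) \<Rightarrow> 'v \<Rightarrow> ('v \<Rightarrow> 'k) \<Rightarrow> 'v \<Rightarrow> ('v \<Rightarrow> 'k) \<Rightarrow> bool" where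
  "strand_step out X Y g x \<phi> y \<psi> \<longleftrightarrow>
     (if out then y = g x \<and> ((\<forall>v\<in>X. \<psi> (g v) = \<phi> v) \<or> y = 0 \<and> (\<forall>v\<in>Y. \<psi> v = 0))
      else (\<forall>v\<in>Y. \<psi> v = \<phi> (g v)) \<and> (g y = x \<or> y = 0 \<and> (\<forall>v\<in>Y. \<psi> v = 0))) \<and>
     (x = 0 \<and> (\<forall>v\<in>X. \<phi> v = 0) \<longrightarrow> y = 0 \<and> (\<forall>v\<in>Y. \<psi> v = 0))"

definition strand ::
  "(nat \<Rightarrow> 'v set) \<Rightarrow> (nat \<Rightarrow> bool) \<Rightarrow> (nat \<Rightarrow> 'v \<Rightarrow> 'v) \<Rightarrow> (nat \<Rightarrow> 'v) \<Rightarrow> (nat \<Rightarrow> 'v \<Rightarrow> 'k) \<Rightarrow> bool" where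
  "strand X d g x \<phi> \<longleftrightarrow>
     (\<forall>j. x j \<in> X j \<and> functional (\<phi> j) \<and>
        strand_step (d j) (X j) (X (Suc j)) (g j) (x j) (\<phi> j) (x (Suc j)) (\<phi> (Suc j)))"

definition compatible ::
  "(nat \<Rightarrow> 'v set) \<Rightarrow> (nat \<Rightarrow> bool) \<Rightarrow> (nat \<Rightarrow> 'v \<Rightarrow> 'v) \<Rightarrow> 'v \<Rightarrow> ('v \<Rightarrow> 'k) \<Rightarrow> bool" where
  "compatible X d g x \<phi> \<longleftrightarrow>
     x \<in> X 0 \<and> functional \<phi> \<and>
     (\<forall>b j. x \<in> arm_filt b j X d g \<or> (\<forall>v\<in>arm_filt b j X d g. \<phi> v = 0))"

lemma compatible_0: "arm X d g \<Longrightarrow> compatible X d g 0 (\<lambda>v. 0)"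
  by (simp add: compatible_def arm_subspace subspace_0 functional_0)

text \<open>
  For an outward map, the new functional has to vanish on the members of the next filtration that
  avoid the new vector. These form a finite chain, so one largest member decides. For an inward
  map it is the vector that has to be lifted, into the members on which the functional does not
  vanish, and the smallest of these decides.
\<close>

lemma compatible_step:
  assumes arm: "arm X d g" and iso: "ultimately_iso M X d g" and c: "compatible X d g x \<phi>"
  shows "\<exists>y \<psi>. compatible (\<lambda>i. X (Suc i)) (\<lambda>i. d (Suc i)) (\<lambda>i. g (Suc i)) y \<psi> \<and>
    strand_step (d 0) (X 0) (X (Suc 0)) (g 0) x \<phi> y \<psi>"
proof -
  define F where "F b j = arm_filt b j (\<lambda>i. X (Suc i)) (\<lambda>i. d (Suc i)) (\<lambda>i. g (Suc i))" for b j
  note arm' = arm_Suc[OF arm]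
  have "ultimately_iso M (\<lambda>i. X (Suc i)) (\<lambda>i. d (Suc i)) (\<lambda>i. g (Suc i))"
    using iso by (simp add: ultimately_iso_def)
  then have fin: "finite {F b j |b j. True}"
    unfolding F_def by (rule finite_arm_filt[OF arm'])
  have chain: "F b i \<subseteq> F b' j \<or> F b' j \<subseteq> F b i" for b i b' j
    unfolding F_def by (rule arm_filt_chain[OF arm'])
  have sub: "subspace (F b j)" "F b j \<subseteq> X (Suc 0)" for b j
    unfolding F_def using arm_filt_subspace[OF arm'] by auto
  have x: "x \<in> X 0" and \<phi>: "functional \<phi>"
    and kills: "x \<notin> arm_filt b j X d g \<Longrightarrow> v \<in> arm_filt b j X d g \<Longrightarrow> \<phi> v = 0" for b j v
    using c by (auto simp: compatible_def)
  have compI: "compatible (\<lambda>i. X (Suc i)) (\<lambda>i. d (Suc i)) (\<lambda>i. g (Suc i)) y \<psi>"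
    if "y \<in> X (Suc 0)" "functional \<psi>" "\<And>b j v. y \<notin> F b j \<Longrightarrow> v \<in> F b j \<Longrightarrow> \<psi> v = 0" for y \<psi>
    using that unfolding compatible_def F_def by blast
  note stop = compatible_0[OF arm']
  show ?thesis
  proof (cases "x = 0 \<and> (\<forall>v\<in>X 0. \<phi> v = 0)")
    case True
    moreover have "g 0 v \<in> X 0" if "\<not> d 0" "v \<in> X (Suc 0)" for v
      using linear_mapD(1)[OF arm_inward[OF arm that(1)] arm_subspace[OF arm] that(2)] .
    ultimately show ?thesis
      using stop arm_map_0[OF arm]
      by (intro exI[of _ 0] exI[of _ "\<lambda>v. 0"]) (simp add: strand_step_def)
  next
    case alive: False
    show ?thesis
    proof (cases "d 0")
      case d: True
      note g = linear_mapD[OF arm_outward[OF arm d] arm_subspace[OF arm]]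
      show ?thesis
      proof (cases "g 0 x = 0")
        case True
        then show ?thesis
          using d stop by (intro exI[of _ 0] exI[of _ "\<lambda>v. 0"]) (simp add: strand_step_def)
      next
        case False
        let ?A = "{F b j |b j. g 0 x \<notin> F b j}"
        have "finite ?A"
          by (rule finite_subset[OF _ fin]) blast
        moreover have "g 0 x \<notin> F False 0"
          using False by (simp add: F_def)
        then have "?A \<noteq> {}"
          by blast
        moreover have "B \<subseteq> C \<or> C \<subseteq> B" if BC: "B \<in> ?A" "C \<in> ?A" for B C
        proof -
          obtain b i c j where "B = F b i" "C = F c j"
            using BC by blast
          then show ?thesis
            using chain by simp
        qed
        ultimately have "\<exists>S\<in>?A. \<forall>B\<in>?A. B \<subseteq> S"
          by (rule finite_chain_has_max)
        then obtain S where S: "S \<in> ?A" and S_max: "\<forall>B\<in>?A. B \<subseteq> S"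
          by (rule bexE)
        obtain b j where "S = F b j"
          using S by blast
        then have max: "g 0 x \<notin> F b j" and le: "\<And>b' i. g 0 x \<notin> F b' i \<Longrightarrow> F b' i \<subseteq> F b j"
          using S S_max by blast+
        have "\<phi> v = 0" if "v \<in> X 0" "g 0 v \<in> F b j" for v
          using kills[of b "Suc j" v] that max d by (simp add: Let_def F_def)
        then obtain \<psi> where \<psi>: "functional \<psi>" "\<And>v. v \<in> X 0 \<Longrightarrow> \<psi> (g 0 v) = \<phi> v"
          "\<And>v. v \<in> F b j \<Longrightarrow> \<psi> v = 0"
          using push_functional[OF arm_outward[OF arm d] arm_subspace[OF arm] sub(1) \<phi>, of b j]
          by blast
        have "compatible (\<lambda>i. X (Suc i)) (\<lambda>i. d (Suc i)) (\<lambda>i. g (Suc i)) (g 0 x) \<psi>"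
          using g(1)[OF x] \<psi>(1,3) le by (intro compI) auto
        then show ?thesis
          using d \<psi>(2) alive by (auto simp: strand_step_def)
      qed
    next
      case d: False
      note l = arm_inward[OF arm d]
      note g = linear_mapD[OF l arm_subspace[OF arm]]
      show ?thesis
      proof (cases "x \<in> g 0 ` X (Suc 0)")
        case False
        then have "\<phi> (g 0 v) = 0" if "v \<in> X (Suc 0)" for v
          using kills[of True "Suc 0"] that d by simp
        then show ?thesis
          using d stop by (intro exI[of _ 0] exI[of _ "\<lambda>v. 0"]) (simp add: strand_step_def)
      next
        case True
        let ?A = "insert (F True 0) {F b j |b j. \<exists>v\<in>F b j. \<phi> (g 0 v) \<noteq> 0}"
        have "finite ?A"
          by (rule finite.insertI, rule finite_subset[OF _ fin]) blast
        moreover have "?A \<noteq> {}"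
          by simp
        moreover have "B \<subseteq> C \<or> C \<subseteq> B" if BC: "B \<in> ?A" "C \<in> ?A" for B C
        proof -
          obtain b i c j where "B = F b i" "C = F c j"
            using BC by blast
          then show ?thesis
            using chain by simp
        qed
        ultimately have "\<exists>m\<in>?A. \<forall>B\<in>?A. m \<subseteq> B"
          by (rule finite_chain_has_min)
        then obtain m where m: "m \<in> ?A" and min: "\<forall>B\<in>?A. m \<subseteq> B"
          by (rule bexE)
        have "x \<in> g 0 ` m"
          using m
        proof
          assume "m = F True 0"
          then show ?thesis using True by (simp add: F_def)
        next
          assume "m \<in> {F b j |b j. \<exists>v\<in>F b j. \<phi> (g 0 v) \<noteq> 0}"
          then obtain b j v where "m = F b j" "v \<in> F b j" "\<phi> (g 0 v) \<noteq> 0"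
            by blast
          then show ?thesis
            using kills[of b "Suc j" "g 0 v"] d by (auto simp: Let_def F_def)
        qed
        then obtain y where y: "y \<in> m" "g 0 y = x"
          by blast
        obtain \<psi> where \<psi>: "functional \<psi>" "\<And>v. v \<in> X (Suc 0) \<Longrightarrow> \<psi> v = \<phi> (g 0 v)"
          using extend_functional[OF arm_subspace[OF arm, of "Suc 0"], of "\<lambda>v. \<phi> (g 0 v)"] g
          by (auto simp: functionalD[OF \<phi>])
        have "m \<subseteq> F True 0"
          using min by blast
        then have "y \<in> X (Suc 0)"
          using y(1) sub(2)[of True 0] by blast
        moreover have "\<psi> v = 0" if "y \<notin> F b j" "v \<in> F b j" for b j v
        proof (rule ccontr)
          assume "\<psi> v \<noteq> 0"
          then have "\<phi> (g 0 v) \<noteq> 0"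
            using \<psi>(2)[of v] sub(2)[of b j] that(2) by auto
          then have "m \<subseteq> F b j"
            using min that(2) by blast
          then show False
            using y(1) that(1) by blast
        qed
        ultimately have "compatible (\<lambda>i. X (Suc i)) (\<lambda>i. d (Suc i)) (\<lambda>i. g (Suc i)) y \<psi>"
          using \<psi>(1) by (intro compI) auto
        then show ?thesis
          using d \<psi>(2) y(2) alive by (auto simp: strand_step_def)
      qed
    qed
  qed
qed

text \<open>
  Compatibility is exactly what a step preserves, so the strand can be continued forever by
  dependent choice.
\<close>

lemma strand_exists:
  assumes arm: "arm X d g" and iso: "ultimately_iso M X d g" and c: "compatible X d g x0 \<phi>0"
  obtains x \<phi> where "strand X d g x \<phi>" "x 0 = x0" "\<phi> 0 = \<phi>0"
proof -
  define P where "P n p \<longleftrightarrow>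
      compatible (\<lambda>i. X (n + i)) (\<lambda>i. d (n + i)) (\<lambda>i. g (n + i)) (fst p) (snd p) \<and>
      (n = 0 \<longrightarrow> p = (x0, \<phi>0))" for n p
  define Q where "Q n p q \<longleftrightarrow>
      strand_step (d n) (X n) (X (Suc n)) (g n) (fst p) (snd p) (fst q) (snd q)" for n p q
  have "\<exists>f. \<forall>n. P n (f n) \<and> Q n (f n) (f (Suc n))"
  proof (rule dependent_nat_choice)
    show "\<exists>p. P 0 p"
      using c by (auto simp: P_def)
    show "\<exists>q. P (Suc n) q \<and> Q n p q" if "P n p" for p n
    proof -
      have "ultimately_iso M (\<lambda>i. X (n + i)) (\<lambda>i. d (n + i)) (\<lambda>i. g (n + i))"
        using iso by (simp add: ultimately_iso_def)
      from compatible_step[OF arm_shift[OF arm] this] that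
      show ?thesis by (fastforce simp: P_def Q_def)
    qed
  qed
  then obtain f where f: "\<And>n. P n (f n)" "\<And>n. Q n (f n) (f (Suc n))"
    by blast
  have "strand X d g (\<lambda>n. fst (f n)) (\<lambda>n. snd (f n))"
    unfolding strand_def
  proof (intro allI conjI)
    fix j
    show "fst (f j) \<in> X j" "functional (snd (f j))"
      using f(1)[of j] by (simp_all add: P_def compatible_def)
    show "strand_step (d j) (X j) (X (Suc j)) (g j) (fst (f j)) (snd (f j))
        (fst (f (Suc j))) (snd (f (Suc j)))"
      using f(2)[of j] by (simp add: Q_def)
  qed
  then show ?thesis
    using that f(1)[of 0] by (simp add: P_def)
qed

end

context ambient_space
begin

definition strand_op ::
  "(nat \<Rightarrow> 'v) \<Rightarrow> (nat \<Rightarrow> 'v \<Rightarrow> 'k) \<Rightarrow> (nat \<Rightarrow> 'v) \<Rightarrow> (nat \<Rightarrow> 'v \<Rightarrow> 'k) \<Rightarrow> nat \<Rightarrow> 'v \<Rightarrow> 'v" where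
  "strand_op x \<phi> y \<psi> j v = \<phi> j v *s x j + \<psi> j v *s y j"

lemma strand_functional: "strand X d g x \<phi> \<Longrightarrow> functional (\<phi> j)"
  by (simp add: strand_def)

lemma strand_mem: "strand X d g x \<phi> \<Longrightarrow> x j \<in> X j"
  by (simp add: strand_def)

lemma strandD:
  "strand X d g x \<phi> \<Longrightarrow>
    strand_step (d j) (X j) (X (Suc j)) (g j) (x j) (\<phi> j) (x (Suc j)) (\<phi> (Suc j))"
  by (simp add: strand_def)

lemma strand_outward:
  assumes "strand X d g x \<phi>" "d j"
  shows "x (Suc j) = g j (x j)"
    "(\<forall>v\<in>X j. \<phi> (Suc j) (g j v) = \<phi> j v) \<or> x (Suc j) = 0 \<and> (\<forall>v\<in>X (Suc j). \<phi> (Suc j) v = 0)"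
proof -
  have step: "strand_step True (X j) (X (Suc j)) (g j) (x j) (\<phi> j) (x (Suc j)) (\<phi> (Suc j))"
    using strandD[OF assms(1), of j] assms(2) by simp
  show "x (Suc j) = g j (x j)"
    "(\<forall>v\<in>X j. \<phi> (Suc j) (g j v) = \<phi> j v) \<or> x (Suc j) = 0 \<and> (\<forall>v\<in>X (Suc j). \<phi> (Suc j) v = 0)"
    using step[unfolded strand_step_def if_True] by blast+
qed

lemma strand_inward:
  assumes "strand X d g x \<phi>" "\<not> d j"
  shows "v \<in> X (Suc j) \<Longrightarrow> \<phi> (Suc j) v = \<phi> j (g j v)"
    "g j (x (Suc j)) = x j \<or> x (Suc j) = 0 \<and> (\<forall>v\<in>X (Suc j). \<phi> (Suc j) v = 0)"
proof -
  have step: "strand_step False (X j) (X (Suc j)) (g j) (x j) (\<phi> j) (x (Suc j)) (\<phi> (Suc j))"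
    using strandD[OF assms(1), of j] assms(2) by simp
  show "v \<in> X (Suc j) \<Longrightarrow> \<phi> (Suc j) v = \<phi> j (g j v)"
    "g j (x (Suc j)) = x j \<or> x (Suc j) = 0 \<and> (\<forall>v\<in>X (Suc j). \<phi> (Suc j) v = 0)"
    using step[unfolded strand_step_def if_False] by blast+
qed

lemma strand_end:
  assumes "strand X d g x \<phi>" "x j = 0" "\<forall>v\<in>X j. \<phi> j v = 0"
  shows "x (Suc j) = 0 \<and> (\<forall>v\<in>X (Suc j). \<phi> (Suc j) v = 0)"
  using strandD[OF assms(1), of j] assms(2,3) unfolding strand_step_def by blast

lemma strand_zero:
  assumes "arm X d g"
  shows "strand X d g (\<lambda>j. 0) (\<lambda>j v. 0)"
  using arm_map_0[OF assms] subspace_0[OF arm_subspace[OF assms]]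
  by (simp add: strand_def strand_step_def functional_0)

lemma strand_op_linear:
  assumes "arm X d g" "strand X d g x \<phi>" "strand X d g y \<psi>"
  shows "linear_map scale (X j) (X j) (strand_op x \<phi> y \<psi> j)"
  using arm_subspace[OF assms(1), of j] strand_mem[OF assms(2), of j] strand_mem[OF assms(3), of j]
  by (auto simp: linear_map_def strand_op_def subspace_add subspace_scale algebra_simps
      functionalD[OF strand_functional[OF assms(2)]] functionalD[OF strand_functional[OF assms(3)]])

lemma strand_commutes:
  assumes arm: "arm X d g" and str: "strand X d g x \<phi>"
  shows "d j \<Longrightarrow> v \<in> X j \<Longrightarrow> g j (\<phi> j v *s x j) = \<phi> (Suc j) (g j v) *s x (Suc j)"
    and "\<not> d j \<Longrightarrow> v \<in> X (Suc j) \<Longrightarrow> g j (\<phi> (Suc j) v *s x (Suc j)) = \<phi> j (g j v) *s x j"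
proof -
  assume d: "d j" and v: "v \<in> X j"
  show "g j (\<phi> j v *s x j) = \<phi> (Suc j) (g j v) *s x (Suc j)"
    using linear_mapD(3)[OF arm_outward[OF arm d] arm_subspace[OF arm] strand_mem[OF str]]
      strand_outward[OF str d] v by auto
next
  assume d: "\<not> d j" and v: "v \<in> X (Suc j)"
  have "g j (\<phi> (Suc j) v *s x (Suc j)) = \<phi> (Suc j) v *s g j (x (Suc j))"
    using linear_mapD(3)[OF arm_inward[OF arm d] arm_subspace[OF arm] strand_mem[OF str]] .
  then show "g j (\<phi> (Suc j) v *s x (Suc j)) = \<phi> j (g j v) *s x j"
    using strand_inward(1)[OF str d v] strand_inward(2)[OF str d] v by auto
qed

lemma strand_op_commutes:
  assumes arm: "arm X d g" and x: "strand X d g x \<phi>" and y: "strand X d g y \<psi>"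
  shows "d j \<Longrightarrow> v \<in> X j \<Longrightarrow> g j (strand_op x \<phi> y \<psi> j v) = strand_op x \<phi> y \<psi> (Suc j) (g j v)"
    and "\<not> d j \<Longrightarrow> v \<in> X (Suc j) \<Longrightarrow>
      g j (strand_op x \<phi> y \<psi> (Suc j) v) = strand_op x \<phi> y \<psi> j (g j v)"
  using linear_mapD(2)[OF arm_outward[OF arm] arm_subspace[OF arm]]
    linear_mapD(2)[OF arm_inward[OF arm] arm_subspace[OF arm]]
  by (simp_all add: strand_op_def strand_commutes[OF arm x] strand_commutes[OF arm y]
      subspace_scale[OF arm_subspace[OF arm]] strand_mem[OF x] strand_mem[OF y])

lemma strands_orthogonal:
  assumes arm: "arm X d g" and x: "strand X d g x \<phi>" and y: "strand X d g y \<psi>"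
    and orth: "\<phi> 0 (y 0) = 0"
  shows "\<phi> j (y j) = 0"
proof (induction j)
  case (Suc j)
  note mem = strand_mem[OF y, of j] strand_mem[OF y, of "Suc j"]
  show ?case
  proof (cases "d j")
    case True
    then show ?thesis
      using strand_outward[OF x True] strand_outward(1)[OF y True] Suc.IH mem by auto
  next
    case False
    then show ?thesis
      using strand_inward(1)[OF x False mem(2)] strand_inward(2)[OF y False] Suc.IH
        arm_map_0[OF arm] functionalD(3)[OF strand_functional[OF x]] by auto
  qed
qed (rule orth)

lemma strand_normalized:
  assumes x: "strand X d g x \<phi>"
    and norm: "\<phi> 0 (x 0) = 1 \<or> x 0 = 0 \<and> (\<forall>v\<in>X 0. \<phi> 0 v = 0)"
  shows "\<phi> j (x j) = 1 \<or> x j = 0 \<and> (\<forall>v\<in>X j. \<phi> j v = 0)"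
proof (induction j)
  case (Suc j)
  note mem = strand_mem[OF x, of j] strand_mem[OF x, of "Suc j"]
  from Suc.IH show ?case
  proof
    assume 1: "\<phi> j (x j) = 1"
    show ?case
    proof (cases "d j")
      case True
      then show ?thesis
        using strand_outward[OF x True] 1 mem by auto
    next
      case False
      then show ?thesis
        using strand_inward[OF x False] 1 mem by auto
    qed
  qed (use strand_end[OF x] in blast)
qed (rule norm)

text \<open>
  Both orthogonality and normalisation propagate from position \<open>0\<close>, as the vector of a strand is
  carried along by outward maps and its functional by inward ones. The zero strand is admitted as
  the second one, so that idempotents of rank one are covered too.
\<close>

lemma strand_op_idempotent:
  assumes arm: "arm X d g" and x: "strand X d g x \<phi>" and y: "strand X d g y \<psi>"
    and orth: "\<phi> 0 (y 0) = 0" "\<psi> 0 (x 0) = 0"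
    and norm: "\<phi> 0 (x 0) = 1" "\<psi> 0 (y 0) = 1 \<or> y 0 = 0 \<and> (\<forall>v\<in>X 0. \<psi> 0 v = 0)"
    and v: "v \<in> X j"
  shows "strand_op x \<phi> y \<psi> j (strand_op x \<phi> y \<psi> j v) = strand_op x \<phi> y \<psi> j v"
  using strands_orthogonal[OF arm x y orth(1), of j] strands_orthogonal[OF arm y x orth(2), of j]
    strand_normalized[OF x, of j] strand_normalized[OF y, of j] norm v
  by (auto simp: strand_op_def functionalD[OF strand_functional[OF x]]
      functionalD[OF strand_functional[OF y]])

section \<open>Regular arms\<close>

text \<open>
  On a regular arm everything is controlled by position \<open>0\<close>: the space at position \<open>j\<close> is the
  quotient of \<open>arm_filt True j\<close> by \<open>arm_filt False j\<close>. Hence morphisms between regular arms are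
  determined at position \<open>0\<close>, and they are bijective if they match the filtrations there.
\<close>

definition regular_arm :: "(nat \<Rightarrow> 'v set) \<Rightarrow> (nat \<Rightarrow> bool) \<Rightarrow> (nat \<Rightarrow> 'v \<Rightarrow> 'v) \<Rightarrow> bool" where
  "regular_arm X d g \<longleftrightarrow>
     (\<forall>j. if d j then g j ` X j = X (Suc j) else \<forall>v\<in>X (Suc j). g j v = 0 \<longrightarrow> v = 0)"

lemma regular_armD:
  assumes "regular_arm X d g"
  shows "d j \<Longrightarrow> v \<in> X (Suc j) \<Longrightarrow> \<exists>u\<in>X j. v = g j u"
    "\<not> d j \<Longrightarrow> v \<in> X (Suc j) \<Longrightarrow> g j v = 0 \<Longrightarrow> v = 0"
proof -
  have *: "if d j then g j ` X j = X (Suc j) else \<forall>v\<in>X (Suc j). g j v = 0 \<longrightarrow> v = 0"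
    using assms by (simp add: regular_arm_def)
  show "\<exists>u\<in>X j. v = g j u" if "d j" "v \<in> X (Suc j)"
    using * that by auto
  show "v = 0" if "\<not> d j" "v \<in> X (Suc j)" "g j v = 0"
    using * that by auto
qed

text \<open>
  In each position the vectors of the strands span the space and their functionals separate its
  points. Vectors are transported by outward maps, which are therefore surjective, and functionals
  are pulled back along inward maps, which are therefore injective.
\<close>

lemma regular_arm_if_strand_op_id:
  assumes arm: "arm X d g" and x: "strand X d g x \<phi>" and y: "strand X d g y \<psi>"
    and id: "\<And>j v. v \<in> X j \<Longrightarrow> strand_op x \<phi> y \<psi> j v = v"
  shows "regular_arm X d g"
  unfolding regular_arm_def
proof
  fix j
  show "if d j then g j ` X j = X (Suc j) else \<forall>v\<in>X (Suc j). g j v = 0 \<longrightarrow> v = 0"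
  proof (cases "d j")
    case True
    note g = linear_mapD[OF arm_outward[OF arm True] arm_subspace[OF arm]]
    note sub = arm_subspace[OF arm, of j]
    have "v \<in> g j ` X j" if "v \<in> X (Suc j)" for v
    proof
      let ?u = "\<phi> (Suc j) v *s x j + \<psi> (Suc j) v *s y j"
      show "?u \<in> X j"
        using sub strand_mem[OF x] strand_mem[OF y] by (simp add: subspace_add subspace_scale)
      have "g j ?u = strand_op x \<phi> y \<psi> (Suc j) v"
        using sub strand_mem[OF x] strand_mem[OF y] g
          strand_outward(1)[OF x True] strand_outward(1)[OF y True]
        by (simp add: strand_op_def subspace_scale)
      then show "v = g j ?u"
        using id that by simp
    qed
    then show ?thesis
      using True g(1) by auto
  next
    case False
    have "v = 0" if "v \<in> X (Suc j)" "g j v = 0" for v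
      using id[OF that(1)] strand_inward(1)[OF x False that(1)] strand_inward(1)[OF y False that(1)]
        that(2) functionalD(3)[OF strand_functional[OF x]] functionalD(3)[OF strand_functional[OF y]]
      by (simp add: strand_op_def)
    then show ?thesis
      using False by simp
  qed
qed

definition arm_hom ::
  "(nat \<Rightarrow> 'v set) \<Rightarrow> (nat \<Rightarrow> 'v set) \<Rightarrow> (nat \<Rightarrow> bool) \<Rightarrow> (nat \<Rightarrow> 'v \<Rightarrow> 'v) \<Rightarrow> (nat \<Rightarrow> 'v \<Rightarrow> 'v) \<Rightarrow>
   (nat \<Rightarrow> 'v \<Rightarrow> 'v) \<Rightarrow> bool" where
  "arm_hom X Y d g h f \<longleftrightarrow>
     (\<forall>j. linear_map scale (X j) (Y j) (f j) \<and>
        (if d j then \<forall>v\<in>X j. f (Suc j) (g j v) = h j (f j v)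
         else \<forall>v\<in>X (Suc j). f j (g j v) = h j (f (Suc j) v)))"

lemma arm_homD:
  assumes "arm_hom X Y d g h f"
  shows "linear_map scale (X j) (Y j) (f j)"
    "d j \<Longrightarrow> v \<in> X j \<Longrightarrow> f (Suc j) (g j v) = h j (f j v)"
    "\<not> d j \<Longrightarrow> v \<in> X (Suc j) \<Longrightarrow> f j (g j v) = h j (f (Suc j) v)"
proof -
  have *: "linear_map scale (X j) (Y j) (f j) \<and>
        (if d j then \<forall>v\<in>X j. f (Suc j) (g j v) = h j (f j v)
         else \<forall>v\<in>X (Suc j). f j (g j v) = h j (f (Suc j) v))"
    using assms by (simp add: arm_hom_def)
  show "linear_map scale (X j) (Y j) (f j)"
    "d j \<Longrightarrow> v \<in> X j \<Longrightarrow> f (Suc j) (g j v) = h j (f j v)"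
    "\<not> d j \<Longrightarrow> v \<in> X (Suc j) \<Longrightarrow> f j (g j v) = h j (f (Suc j) v)"
    using * by simp_all
qed

lemma arm_hom_Suc:
  "arm_hom X Y d g h f \<Longrightarrow>
    arm_hom (\<lambda>i. X (Suc i)) (\<lambda>i. Y (Suc i)) (\<lambda>i. d (Suc i)) (\<lambda>i. g (Suc i)) (\<lambda>i. h (Suc i))
      (\<lambda>i. f (Suc i))"
  by (simp add: arm_hom_def)

lemma arm_hom_shift:
  "arm_hom X Y d g h f \<Longrightarrow>
    arm_hom (\<lambda>i. X (n + i)) (\<lambda>i. Y (n + i)) (\<lambda>i. d (n + i)) (\<lambda>i. g (n + i)) (\<lambda>i. h (n + i))
      (\<lambda>i. f (n + i))"
  by (simp add: arm_hom_def)

lemma arm_hom_filt: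
  "arm X d g \<Longrightarrow> arm Y d h \<Longrightarrow> arm_hom X Y d g h f \<Longrightarrow>
    f 0 ` arm_filt b j X d g \<subseteq> arm_filt b j Y d h"
proof (induction j arbitrary: X Y d g h f)
  case 0
  then show ?case
    using linear_mapD(1,4)[OF arm_homD(1)[OF 0(3)] arm_subspace[OF 0(1)]] by auto
next
  case (Suc j)
  let ?F = "arm_filt b j (\<lambda>i. X (Suc i)) (\<lambda>i. d (Suc i)) (\<lambda>i. g (Suc i))"
  let ?G = "arm_filt b j (\<lambda>i. Y (Suc i)) (\<lambda>i. d (Suc i)) (\<lambda>i. h (Suc i))"
  have IH: "f (Suc 0) ` ?F \<subseteq> ?G"
    using Suc.IH[OF arm_Suc[OF Suc.prems(1)] arm_Suc[OF Suc.prems(2)] arm_hom_Suc[OF Suc.prems(3)]] .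
  have F: "?F \<subseteq> X (Suc 0)"
    using arm_filt_subspace[OF arm_Suc[OF Suc.prems(1)]] by blast
  note f = arm_homD[OF Suc.prems(3)]
  show ?case
  proof (cases "d 0")
    case True
    then show ?thesis
      using IH f(2)[of 0] linear_mapD(1)[OF f(1) arm_subspace[OF Suc.prems(1)], of _ 0]
      by (fastforce simp: Let_def)
  next
    case False
    then show ?thesis
      using IH f(3)[of 0] F by (fastforce simp: Let_def)
  qed
qed

lemma regular_arm_hom_vanishes:
  assumes X: "arm X d g" and Y: "arm Y d h" and hom: "arm_hom X Y d g h f"
    and regX: "regular_arm X d g" and regY: "regular_arm Y d h"
    and zero: "\<And>v. v \<in> X 0 \<Longrightarrow> f 0 v = 0" and v: "v \<in> X j"
  shows "f j v = 0"
  using v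
proof (induction j arbitrary: v)
  case 0
  then show ?case by (rule zero)
next
  case (Suc j)
  note f = arm_homD[OF hom]
  show ?case
  proof (cases "d j")
    case True
    then obtain u where "u \<in> X j" "v = g j u"
      using regular_armD(1)[OF regX] Suc.prems by blast
    then show ?thesis
      using f(2)[OF True] Suc.IH arm_map_0[OF Y] by simp
  next
    case False
    have "g j v \<in> X j"
      using linear_mapD(1)[OF arm_inward[OF X False] arm_subspace[OF X] Suc.prems] .
    then have "h j (f (Suc j) v) = 0"
      using Suc.IH f(3)[OF False Suc.prems] by simp
    moreover have "f (Suc j) v \<in> Y (Suc j)"
      using linear_mapD(1)[OF f(1) arm_subspace[OF X] Suc.prems] .
    ultimately show ?thesis
      using regular_armD(2)[OF regY False] by blast
  qed
qed

lemma inj_on_linear_map: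
  assumes "linear_map scale X Y f" "subspace X" "\<And>v. v \<in> X \<Longrightarrow> f v = 0 \<Longrightarrow> v = 0"
  shows "inj_on f X"
proof (rule inj_onI)
  fix x y
  assume *: "x \<in> X" "y \<in> X" "f x = f y"
  then have "f (x - y) = 0"
    by (simp add: linear_mapD(5)[OF assms(1,2)])
  then show "x = y"
    using assms(3)[of "x - y"] * assms(2) by (simp add: subspace_diff)
qed

text \<open>
  The induction moves the matching of the filtrations one position outwards; there the first two
  members, the image or the kernel of the first map, decide about bijectivity.
\<close>

lemma regular_arm_hom_bij:
  "arm X d g \<Longrightarrow> arm Y d h \<Longrightarrow> arm_hom X Y d g h f \<Longrightarrow>
    regular_arm X d g \<Longrightarrow> regular_arm Y d h \<Longrightarrow> bij_betw (f 0) (X 0) (Y 0) \<Longrightarrow>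
    (\<And>b i. f 0 ` arm_filt b i X d g = arm_filt b i Y d h) \<Longrightarrow>
    bij_betw (f j) (X j) (Y j)"
proof (induction j arbitrary: X Y d g h f)
  case 0
  then show ?case by simp
next
  case (Suc j)
  let ?F = "\<lambda>b i. arm_filt b i (\<lambda>i. X (Suc i)) (\<lambda>i. d (Suc i)) (\<lambda>i. g (Suc i))"
  let ?G = "\<lambda>b i. arm_filt b i (\<lambda>i. Y (Suc i)) (\<lambda>i. d (Suc i)) (\<lambda>i. h (Suc i))"
  note X = Suc.prems(1) and Y = Suc.prems(2) and regX = Suc.prems(4) and regY = Suc.prems(5)
    and filt = Suc.prems(7)
  note f = arm_homD[OF Suc.prems(3)]
  have F: "?F b i \<subseteq> X (Suc 0)" and G: "?G b i \<subseteq> Y (Suc 0)" for b i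
    using arm_filt_subspace[OF arm_Suc[OF X]] arm_filt_subspace[OF arm_Suc[OF Y]] by auto
  have fX: "v \<in> X i \<Longrightarrow> f i v \<in> Y i" for i v
    using linear_mapD(1)[OF f(1) arm_subspace[OF X]] .
  have inj0: "inj_on (f 0) (X 0)" and surj0: "f 0 ` X 0 = Y 0"
    using Suc.prems(6) by (auto simp: bij_betw_def)
  have step: "bij_betw (f (Suc 0)) (X (Suc 0)) (Y (Suc 0)) \<and> (\<forall>b i. f (Suc 0) ` ?F b i = ?G b i)"
  proof (cases "d 0")
    case d: True
    have gX: "v \<in> X 0 \<Longrightarrow> g 0 v \<in> X (Suc 0)" for v
      using linear_mapD(1)[OF arm_outward[OF X d] arm_subspace[OF X]] .
    have hY: "v \<in> Y 0 \<Longrightarrow> h 0 v \<in> Y (Suc 0)" for v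
      using linear_mapD(1)[OF arm_outward[OF Y d] arm_subspace[OF Y]] .
    have "inj_on (f (Suc 0)) (X (Suc 0))"
    proof (rule inj_on_linear_map[OF f(1) arm_subspace[OF X]])
      fix v
      assume v: "v \<in> X (Suc 0)" "f (Suc 0) v = 0"
      then obtain u where u: "u \<in> X 0" "v = g 0 u"
        using regular_armD(1)[OF regX d] by blast
      then have "f 0 u \<in> arm_filt False (Suc 0) Y d h"
        using v f(2)[OF d u(1)] fX d by simp
      then obtain w where w: "w \<in> X 0" "g 0 w = 0" "f 0 u = f 0 w"
        using filt[of False "Suc 0"] d by auto
      then have "u = w"
        using inj_onD[OF inj0] u by blast
      then show "v = 0"
        using u w by simp
    qed
    moreover have "f (Suc 0) ` X (Suc 0) = Y (Suc 0)"
    proof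
      show "f (Suc 0) ` X (Suc 0) \<subseteq> Y (Suc 0)"
        using fX by blast
      show "Y (Suc 0) \<subseteq> f (Suc 0) ` X (Suc 0)"
      proof
        fix w
        assume "w \<in> Y (Suc 0)"
        then obtain y where y: "y \<in> Y 0" "w = h 0 y"
          using regular_armD(1)[OF regY d] by blast
        then have "y \<in> f 0 ` X 0"
          using surj0 by simp
        then obtain u where u: "u \<in> X 0" "y = f 0 u"
          by blast
        then have "w = f (Suc 0) (g 0 u)"
          using y f(2)[OF d] by simp
        then show "w \<in> f (Suc 0) ` X (Suc 0)"
          using gX[OF u(1)] by blast
      qed
    qed
    moreover have "f (Suc 0) ` ?F b i = ?G b i" for b i
    proof
      show "f (Suc 0) ` ?F b i \<subseteq> ?G b i"
        using arm_hom_filt[OF arm_Suc[OF X] arm_Suc[OF Y] arm_hom_Suc[OF Suc.prems(3)]] .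
      show "?G b i \<subseteq> f (Suc 0) ` ?F b i"
      proof
        fix w
        assume w: "w \<in> ?G b i"
        then obtain y where y: "y \<in> Y 0" "w = h 0 y"
          using G regular_armD(1)[OF regY d] by blast
        then have "y \<in> f 0 ` arm_filt b (Suc i) X d g"
          unfolding filt using w d by (simp add: Let_def)
        then obtain u where "u \<in> X 0" "g 0 u \<in> ?F b i" "y = f 0 u"
          using d by (auto simp: Let_def)
        moreover from this have "w = f (Suc 0) (g 0 u)"
          using y f(2)[OF d] by simp
        ultimately show "w \<in> f (Suc 0) ` ?F b i"
          by blast
      qed
    qed
    ultimately show ?thesis
      by (simp add: bij_betw_def)
  next
    case d: False
    have gX: "v \<in> X (Suc 0) \<Longrightarrow> g 0 v \<in> X 0" for v
      using linear_mapD(1)[OF arm_inward[OF X d] arm_subspace[OF X]] .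
    have injh: "inj_on (h 0) (Y (Suc 0))"
      by (rule inj_on_linear_map[OF arm_inward[OF Y d] arm_subspace[OF Y]])
        (rule regular_armD(2)[OF regY d])
    have "inj_on (f (Suc 0)) (X (Suc 0))"
    proof (rule inj_on_linear_map[OF f(1) arm_subspace[OF X]])
      fix v
      assume v: "v \<in> X (Suc 0)" "f (Suc 0) v = 0"
      then have "f 0 (g 0 v) = f 0 0"
        using f(3)[OF d v(1)] arm_map_0[OF Y] linear_mapD(4)[OF f(1) arm_subspace[OF X], of 0]
        by simp
      then have "g 0 v = 0"
        using inj_onD[OF inj0] gX[OF v(1)] subspace_0[OF arm_subspace[OF X]] by blast
      then show "v = 0"
        using regular_armD(2)[OF regX d v(1)] by blast
    qed
    moreover have "f (Suc 0) ` ?F b i = ?G b i" for b i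
    proof
      show "f (Suc 0) ` ?F b i \<subseteq> ?G b i"
        using arm_hom_filt[OF arm_Suc[OF X] arm_Suc[OF Y] arm_hom_Suc[OF Suc.prems(3)]] .
      show "?G b i \<subseteq> f (Suc 0) ` ?F b i"
      proof
        fix w
        assume w: "w \<in> ?G b i"
        then have "h 0 w \<in> arm_filt b (Suc i) Y d h"
          using d by (simp add: Let_def)
        then obtain u where u: "u \<in> ?F b i" "h 0 w = f 0 (g 0 u)"
          unfolding filt[symmetric] using d by (auto simp: Let_def)
        then have uX: "u \<in> X (Suc 0)"
          using F by blast
        then have "h 0 w = h 0 (f (Suc 0) u)"
          using u(2) f(3)[OF d] by simp
        then have "w = f (Suc 0) u"
          using inj_onD[OF injh] w G fX[OF uX] by blast
        then show "w \<in> f (Suc 0) ` ?F b i"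
          using u(1) by blast
      qed
    qed
    moreover from this[of True 0] have "f (Suc 0) ` X (Suc 0) = Y (Suc 0)"
      by simp
    ultimately show ?thesis
      by (simp add: bij_betw_def)
  qed
  have "regular_arm (\<lambda>i. X (Suc i)) (\<lambda>i. d (Suc i)) (\<lambda>i. g (Suc i))"
    "regular_arm (\<lambda>i. Y (Suc i)) (\<lambda>i. d (Suc i)) (\<lambda>i. h (Suc i))"
    using regX regY by (simp_all add: regular_arm_def)
  then show ?case
    using step Suc.IH[OF arm_Suc[OF X] arm_Suc[OF Y] arm_hom_Suc[OF Suc.prems(3)]] by blast
qed

end

section \<open>Two subspaces and a chain\<close>

context ambient_space
begin

text \<open>
  A pair \<open>(x, \<phi>)\<close> as in the first alternative splits off a line that is compatible with all
  the given subspaces. If \<open>K \<inter> K'\<close> is nonzero, such a pair exists because the members of the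
  chain that avoid a given vector have a largest one; if \<open>K + K'\<close> is not everything, because the
  members that it does not contain have a smallest one. In the remaining case, a nonzero vector \<open>a + b\<close> in the smallest nonzero member of the chain either yields such
  a pair or, together with \<open>a\<close> and \<open>b\<close>, a plane that splits off and in which \<open>K\<close>, \<open>K'\<close> and the
  chain induce three different lines.
\<close>

lemma line_or_plane_splits:
  assumes E: "subspace E" "E \<noteq> {0}"
    and K: "subspace K" "K \<subseteq> E" and K': "subspace K'" "K' \<subseteq> E"
    and fin: "finite \<C>" and chain: "\<And>B C. B \<in> \<C> \<Longrightarrow> C \<in> \<C> \<Longrightarrow> B \<subseteq> C \<or> C \<subseteq> B"
    and sub: "\<And>C. C \<in> \<C> \<Longrightarrow> subspace C \<and> C \<subseteq> E" and zero: "{0} \<in> \<C>" and full: "E \<in> \<C>"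
  shows "(\<exists>x \<phi>. x \<in> E \<and> functional \<phi> \<and> \<phi> x = 1 \<and>
        (\<forall>C\<in>insert K (insert K' \<C>). x \<in> C \<or> (\<forall>v\<in>C. \<phi> v = 0))) \<or>
    (\<exists>a b \<alpha> \<beta>. a \<in> K \<and> b \<in> K' \<and> functional \<alpha> \<and> functional \<beta> \<and> \<alpha> a = 1 \<and> \<beta> b = 1 \<and>
        (\<forall>v\<in>K'. \<alpha> v = 0) \<and> (\<forall>v\<in>K. \<beta> v = 0) \<and> (\<forall>C\<in>\<C>. C \<noteq> {0} \<longrightarrow> a + b \<in> C) \<and>
        (\<forall>C\<in>\<C>. a \<in> C \<or> (\<forall>v\<in>C. \<alpha> v = \<beta> v)) \<and> (\<exists>C\<in>\<C>. a \<notin> C \<and> a + b \<in> C))"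
    (is "?line \<or> ?plane")
proof -
  have lineI: ?line if "x \<in> E" "functional \<phi>" "\<phi> x = 1"
    "\<And>C v. C \<in> insert K (insert K' \<C>) \<Longrightarrow> x \<notin> C \<Longrightarrow> v \<in> C \<Longrightarrow> \<phi> v = 0" for x \<phi>
    using that by blast
  have largest: "\<exists>S\<in>\<C>. x \<notin> S \<and> (\<forall>C\<in>\<C>. x \<notin> C \<longrightarrow> C \<subseteq> S)" if "x \<noteq> 0" for x
  proof -
    have "finite {C \<in> \<C>. x \<notin> C}" "{C \<in> \<C>. x \<notin> C} \<noteq> {}"
      using fin zero that by auto
    then have "\<exists>S\<in>{C \<in> \<C>. x \<notin> C}. \<forall>C\<in>{C \<in> \<C>. x \<notin> C}. C \<subseteq> S"
      by (rule finite_chain_has_max) (use chain in blast)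
    then show ?thesis by blast
  qed
  define S where "S = {u + v |u v. u \<in> K \<and> v \<in> K'}"
  have S: "subspace S"
    unfolding S_def by (rule subspace_sums[OF K(1) K'(1)])
  have KS: "K \<subseteq> S" "K' \<subseteq> S"
    using subspace_0[OF K(1)] subspace_0[OF K'(1)] unfolding S_def by force+
  consider (meet) x where "x \<in> K" "x \<in> K'" "x \<noteq> 0" | (join) "\<not> E \<subseteq> S"
    | (sum) "K \<inter> K' \<subseteq> {0}" "E \<subseteq> S"
    by blast
  then show ?thesis
  proof cases
    case meet
    obtain B where B: "B \<in> \<C>" "x \<notin> B" "\<forall>C\<in>\<C>. x \<notin> C \<longrightarrow> C \<subseteq> B"
      using largest[OF meet(3)] by blast
    obtain \<phi> where "functional \<phi>" "\<phi> x = 1" "\<And>v. v \<in> B \<Longrightarrow> \<phi> v = 0"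
      using separating_functional[of B x] sub[OF B(1)] B(2) by blast
    then have ?line
      using meet B(3) K(2) by (intro lineI[of x \<phi>]) auto
    then show ?thesis ..
  next
    case join
    have "finite {C \<in> \<C>. \<not> C \<subseteq> S}" "{C \<in> \<C>. \<not> C \<subseteq> S} \<noteq> {}"
      using fin full join by auto
    then have "\<exists>B\<in>{C \<in> \<C>. \<not> C \<subseteq> S}. \<forall>C\<in>{C \<in> \<C>. \<not> C \<subseteq> S}. B \<subseteq> C"
      by (rule finite_chain_has_min) (use chain in blast)
    then obtain B where B: "B \<in> \<C>" "\<not> B \<subseteq> S" "\<forall>C\<in>\<C>. \<not> C \<subseteq> S \<longrightarrow> B \<subseteq> C"
      by blast
    then obtain x where x: "x \<in> B" "x \<notin> S"
      by blast
    \<comment> \<open>Members of the chain that avoid \<open>x\<close> do not contain \<open>B\<close>, so they lie in \<open>S\<close>.\<close>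
    obtain \<phi> where \<phi>: "functional \<phi>" "\<phi> x = 1" "\<And>v. v \<in> S \<Longrightarrow> \<phi> v = 0"
      using separating_functional[OF S x(2)] by blast
    have "\<phi> v = 0" if C: "C \<in> insert K (insert K' \<C>)" "x \<notin> C" "v \<in> C" for C v
    proof -
      have "C \<subseteq> S"
        using C(1,2) B(3) x(1) KS by blast
      then show ?thesis
        using \<phi>(3) C(3) by blast
    qed
    then have ?line
      using x(1) sub[OF B(1)] \<phi> by (intro lineI[of x \<phi>]) auto
    then show ?thesis ..
  next
    case sum
    have "finite {C \<in> \<C>. C \<noteq> {0}}" "{C \<in> \<C>. C \<noteq> {0}} \<noteq> {}"
      using fin full E(2) by auto
    then have "\<exists>B\<in>{C \<in> \<C>. C \<noteq> {0}}. \<forall>C\<in>{C \<in> \<C>. C \<noteq> {0}}. B \<subseteq> C"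
      by (rule finite_chain_has_min) (use chain in blast)
    then obtain B where B: "B \<in> \<C>" "B \<noteq> {0}" "\<forall>C\<in>\<C>. C \<noteq> {0} \<longrightarrow> B \<subseteq> C"
      by blast
    then obtain y where y: "y \<in> B" "y \<noteq> 0"
      using sub[OF B(1)] subspace_0 by blast
    have y_mem: "y \<in> C" if "C \<in> \<C>" "C \<noteq> {0}" for C
      using that B(3) y(1) by blast
    obtain a b where ab: "a \<in> K" "b \<in> K'" "y = a + b"
      using sum(2) y_mem[OF full E(2)] unfolding S_def by blast
    have one_part: ?line
      if x: "x \<noteq> 0" "\<And>C. C \<in> \<C> \<Longrightarrow> C \<noteq> {0} \<Longrightarrow> x \<in> C"
        and L: "subspace L" "x \<notin> L" "x \<in> K \<and> L = K' \<or> x \<in> K' \<and> L = K" for x L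
    proof -
      obtain \<phi> where \<phi>: "functional \<phi>" "\<phi> x = 1" "\<And>v. v \<in> L \<Longrightarrow> \<phi> v = 0"
        using separating_functional[OF L(1,2)] by blast
      have "x \<in> E"
        using L(3) K(2) K'(2) by blast
      moreover have "\<phi> v = 0" if C: "C \<in> insert K (insert K' \<C>)" "x \<notin> C" "v \<in> C" for C v
      proof (cases "C \<in> \<C>")
        case True
        then have "v = 0"
          using x(2) C by blast
        then show ?thesis
          using functionalD(3)[OF \<phi>(1)] by simp
      next
        case False
        then have "C = L"
          using C L(3) by blast
        then show ?thesis
          using \<phi>(3) C(3) by blast
      qed
      ultimately show ?line
        using \<phi> by (intro lineI[of x \<phi>]) auto
    qed
    show ?thesis
    proof (cases "a = 0 \<or> b = 0")
      case True
      then have "(y \<in> K \<and> y \<notin> K') \<or> (y \<in> K' \<and> y \<notin> K)"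
        using ab y(2) sum(1) by auto
      then have ?line
        using one_part[OF y(2) y_mem K'(1)] one_part[OF y(2) y_mem K(1)] by blast
      then show ?thesis ..
    next
      case False
      then obtain B0 where B0: "B0 \<in> \<C>" "a \<notin> B0" "\<forall>C\<in>\<C>. a \<notin> C \<longrightarrow> C \<subseteq> B0"
        using largest[of a] by blast
      show ?thesis
      proof (cases "y \<in> B0")
        case False
        then have "B0 = {0}"
          using y_mem[OF B0(1)] by blast
        then have "a \<in> C" if "C \<in> \<C>" "C \<noteq> {0}" for C
          using B0(3) that subspace_0 sub[OF that(1)] by blast
        moreover have "a \<notin> K'"
          using sum(1) ab(1) \<open>\<not> (a = 0 \<or> b = 0)\<close> by blast
        ultimately have ?line
          using one_part[of a K'] ab(1) K'(1) \<open>\<not> (a = 0 \<or> b = 0)\<close> by blast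
        then show ?thesis ..
      next
        case True
        obtain \<psi> where \<psi>: "functional \<psi>" "\<psi> a = 1" "\<And>v. v \<in> B0 \<Longrightarrow> \<psi> v = 0"
          using separating_functional[of B0 a] sub[OF B0(1)] B0(2) by blast
        \<comment> \<open>\<open>\<alpha>\<close> and \<open>\<beta>\<close> are \<open>\<psi>\<close> and \<open>- \<psi>\<close> after the projections of \<open>E\<close> onto \<open>K\<close> and \<open>K'\<close>, so that
          \<open>\<alpha> - \<beta>\<close> is \<open>\<psi>\<close> and vanishes on \<open>B0\<close>.\<close>
        have "\<exists>\<alpha>. functional \<alpha> \<and> (\<forall>v\<in>K. \<alpha> v = \<psi> v) \<and> (\<forall>v\<in>K'. \<alpha> v = 0)"
        proof -
          have meet: "\<psi> x = 0" if "x \<in> K" "x \<in> K'" for x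
            using that sum(1) functionalD(3)[OF \<psi>(1)] by blast
          show ?thesis
            by (rule push_functional[OF linear_map_id[of K UNIV] K(1) K'(1) \<psi>(1)])
              (use meet in auto)
        qed
        then obtain \<alpha> where \<alpha>: "functional \<alpha>" "\<And>v. v \<in> K \<Longrightarrow> \<alpha> v = \<psi> v" "\<And>v. v \<in> K' \<Longrightarrow> \<alpha> v = 0"
          by blast
        define \<beta> where "\<beta> v = \<alpha> v - \<psi> v" for v
        have \<beta>: "functional \<beta>"
          unfolding \<beta>_def[abs_def] by (rule functional_diff[OF \<alpha>(1) \<psi>(1)])
        have "\<psi> a + \<psi> b = 0"
          using \<psi>(3)[OF True] ab(3) by (simp add: functionalD[OF \<psi>(1)])
        then have "\<beta> b = 1"
          using \<alpha>(3)[OF ab(2)] \<psi>(2) by (simp add: \<beta>_def neg_eq_iff_add_eq_0 add.commute)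
        moreover have "a \<in> C \<or> (\<forall>v\<in>C. \<alpha> v = \<beta> v)" if "C \<in> \<C>" for C
          using B0(3) that \<psi>(3) by (fastforce simp: \<beta>_def)
        moreover have "\<forall>v\<in>K. \<beta> v = 0" "\<alpha> a = 1"
          using \<alpha>(2) \<psi>(2) ab(1) by (simp_all add: \<beta>_def)
        moreover have "\<exists>C\<in>\<C>. a \<notin> C \<and> a + b \<in> C"
          using B0(1,2) True ab(3) by blast
        ultimately have ?plane
          using ab \<alpha>(1,3) \<beta> y_mem by blast
        then show ?thesis ..
      qed
    qed
  qed
qed

definition is_line :: "'v set \<Rightarrow> bool" where
  "is_line E \<longleftrightarrow> (\<exists>x. x \<noteq> 0 \<and> E = span {x})"

text \<open>
  The indecomposable configuration of three lines in a plane, the third of them coming from the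
  filtration, with bases of the first two normalised so that their sum spans the third.
\<close>

definition triad :: "'v set \<Rightarrow> 'v set \<Rightarrow> 'v set \<Rightarrow> ('i \<Rightarrow> 'v set) \<Rightarrow> 'v \<Rightarrow> 'v \<Rightarrow> bool" where
  "triad E K K' F a b \<longleftrightarrow>
     a \<noteq> 0 \<and> b \<noteq> 0 \<and> K = span {a} \<and> K' = span {b} \<and> K \<inter> K' = {0} \<and>
     (\<forall>v\<in>E. \<exists>c e. v = c *s a + e *s b) \<and>
     (\<forall>i. F i = {0} \<or> F i = E \<or> F i = span {a + b}) \<and> (\<exists>i. F i = span {a + b})"

definition shape :: "'v set \<Rightarrow> 'v set \<Rightarrow> 'v set \<Rightarrow> ('i \<Rightarrow> 'v set) \<Rightarrow> bool" where
  "shape E K K' F \<longleftrightarrow>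
     subspace E \<and> subspace K \<and> K \<subseteq> E \<and> subspace K' \<and> K' \<subseteq> E \<and>
     (\<forall>i. subspace (F i) \<and> F i \<subseteq> E) \<and> (is_line E \<or> (\<exists>a b. triad E K K' F a b))"

text \<open>
  Nonzero maps never lower the stage. The planes belong to the middle stage, together with the lines
  that equal exactly one of \<open>K\<close> and \<open>K'\<close>; they share a stage because a chain of morphisms may
  alternate between them.
\<close>

definition stage :: "'v set \<Rightarrow> 'v set \<Rightarrow> 'v set \<Rightarrow> nat" where
  "stage E K K' = (if K = {0} \<and> K' = {0} then 0 else if K = E \<and> K' = E then 2 else 1)"

text \<open>
  On a plane this is the dimension of \<open>C\<close>, on a line twice the dimension. With this normalisation
  it can be compared across a map between a line and a plane.
\<close>

definition weight :: "'v set \<Rightarrow> 'v set \<Rightarrow> nat" where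
  "weight E C = (if C = {0} then 0 else if C = E then 2 else 1)"

lemma weight_le_2: "weight E C \<le> 2"
  by (simp add: weight_def)

lemma weight_mono:
  "subspace C \<Longrightarrow> C \<subseteq> C' \<Longrightarrow> C' \<subseteq> E \<Longrightarrow> weight E C \<le> weight E C'"
  using subspace_0 by (auto simp: weight_def)

lemma stage_le_2: "stage E K K' \<le> 2"
  by (simp add: stage_def)

lemma stage_eq_0_iff: "stage E K K' = 0 \<longleftrightarrow> K = {0} \<and> K' = {0}"
  by (simp add: stage_def)

lemma stage_eq_2D: "stage E K K' = 2 \<Longrightarrow> K = E \<and> K' = E"
  by (simp add: stage_def split: if_splits)

lemma is_line_span: "x \<noteq> 0 \<Longrightarrow> is_line (span {x})"
  by (auto simp: is_line_def)

lemma is_lineI: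
  assumes "subspace E" "x \<in> E" "x \<noteq> 0" "\<And>v. v \<in> E \<Longrightarrow> v = \<phi> v *s x"
  shows "is_line E"
proof -
  have "E \<subseteq> span {x}"
    using assms(4) by (auto simp: span_singleton)
  moreover have "span {x} \<subseteq> E"
    using assms(1,2) by (simp add: span_minimal)
  ultimately show ?thesis
    using assms(3) by (auto simp: is_line_def)
qed

lemma line_subspace:
  assumes "is_line E" "subspace C" "C \<subseteq> E"
  shows "C = {0} \<or> C = E"
proof (cases "C = {0}")
  assume "C \<noteq> {0}"
  then obtain v where v: "v \<in> C" "v \<noteq> 0"
    using subspace_0[OF assms(2)] by blast
  obtain x where x: "E = span {x}"
    using assms(1) by (auto simp: is_line_def)
  then obtain c where c: "v = c *s x"
    using v assms(3) by (auto simp: span_singleton)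
  then have "c \<noteq> 0"
    using v(2) by auto
  then have "x = inverse c *s v"
    using c by simp
  then have "x \<in> C"
    using v(1) assms(2) subspace_scale by blast
  then show "C = {0} \<or> C = E"
    using span_minimal[of "{x}" C] assms(2,3) x by auto
qed simp

context
  fixes E K K' :: "'v set" and F :: "'i \<Rightarrow> 'v set" and a b :: 'v
  assumes triad: "triad E K K' F a b" and shape: "shape E K K' F"
begin

lemma triadD:
  "a \<noteq> 0" "b \<noteq> 0" "K = span {a}" "K' = span {b}" "K \<inter> K' = {0}"
  "v \<in> E \<Longrightarrow> \<exists>c e. v = c *s a + e *s b" "F i = {0} \<or> F i = E \<or> F i = span {a + b}"
  "\<exists>i. F i = span {a + b}"
  using triad by (auto simp: triad_def)

lemma triad_mem: "a \<in> E" "b \<in> E" "a \<in> K" "b \<in> K'" "a \<notin> K'" "b \<notin> K"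
proof -
  show "a \<in> K" "b \<in> K'"
    using triadD(3,4) by (simp_all add: span_base)
  then show "a \<in> E" "b \<in> E"
    using shape by (auto simp: shape_def)
  show "a \<notin> K'" "b \<notin> K"
    using \<open>a \<in> K\<close> \<open>b \<in> K'\<close> triadD(1,2,5) by auto
qed

lemma triad_independent:
  assumes "c *s a + e *s b = 0"
  shows "c = 0 \<and> e = 0"
proof -
  have eq: "c *s a = - (e *s b)"
    using assms by (simp add: eq_neg_iff_add_eq_0)
  have "c *s a \<in> K" "- (e *s b) \<in> K'"
    unfolding triadD(3,4) by (simp_all add: span_base span_neg span_scale)
  then have "c *s a \<in> K \<inter> K'"
    unfolding eq by simp
  then have "c *s a = 0"
    unfolding triadD(5) by simp
  moreover from this have "e *s b = 0"
    using eq by simp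
  ultimately show ?thesis
    using triadD(1,2) by simp
qed

lemma triad_diagonal: "a \<notin> span {a + b}" "b \<notin> span {a + b}" "a + b \<noteq> 0"
proof -
  have False if "a = c *s (a + b)" for c
  proof -
    have "(c - 1) *s a + c *s b = c *s (a + b) - a"
      by (simp add: scale_left_diff_distrib scale_right_distrib)
    also have "\<dots> = 0"
      by (subst eq_iff_diff_eq_0[symmetric]) (rule that[symmetric])
    finally show ?thesis
      using triad_independent[of "c - 1" c] by auto
  qed
  then show "a \<notin> span {a + b}"
    by (auto simp: span_singleton)
  have False if "b = c *s (a + b)" for c
  proof -
    have "c *s a + (c - 1) *s b = c *s (a + b) - b"
      by (simp add: scale_left_diff_distrib scale_right_distrib)
    also have "\<dots> = 0"
      by (subst eq_iff_diff_eq_0[symmetric]) (rule that[symmetric])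
    finally show ?thesis
      using triad_independent[of c "c - 1"] by auto
  qed
  then show "b \<notin> span {a + b}"
    by (auto simp: span_singleton)
  show "a + b \<noteq> 0"
    using triad_independent[of 1 1] by auto
qed

lemma triad_filt_full:
  assumes "p \<in> F i" "p \<noteq> 0" "p \<in> K \<or> p \<in> K'"
  shows "F i = E"
proof -
  have "\<exists>c. p = c *s a \<or> p = c *s b"
    using assms(3) triadD(3,4) by (auto simp: span_singleton)
  then obtain c where c: "p = c *s a \<or> p = c *s b"
    by blast
  then have "c \<noteq> 0"
    using assms(2) by auto
  then have "inverse c *s p = a \<or> inverse c *s p = b"
    using c by auto
  then have "a \<in> F i \<or> b \<in> F i"
    using shape assms(1) subspace_scale[of "F i" p "inverse c"] by (auto simp: shape_def)
  then show ?thesis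
    using triadD(1,2,7) triad_diagonal by blast
qed

lemma triad_stage: "stage E K K' = 1"
  using triad_mem triadD(1) by (auto simp: stage_def)

lemma triad_diagonal_mem: "F i \<noteq> {0} \<Longrightarrow> a + b \<in> F i"
  using triadD(7)[of i] triad_mem shape by (auto simp: shape_def span_base subspace_add)

lemma triad_weight_1: "F i = span {a + b} \<Longrightarrow> weight E (F i) = 1"
  using triad_diagonal triad_mem(1) span_base[of "a + b" "{a + b}"] by (auto simp: weight_def)

end

end

section \<open>Maps between configurations\<close>

context ambient_space
begin

lemma shapeD:
  assumes "shape E K K' F"
  shows "subspace E" "subspace K" "K \<subseteq> E" "subspace K'" "K' \<subseteq> E" "subspace (F i)" "F i \<subseteq> E"
    "is_line E \<or> (\<exists>a b. triad E K K' F a b)"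
  using assms by (simp_all add: shape_def)

lemma line_hom_bij:
  assumes E: "subspace E" "is_line E" and E1: "is_line E1"
    and f: "linear_map scale E E1 f" and x: "x \<in> E" "f x \<noteq> 0"
  shows "bij_betw f E E1"
proof -
  have "subspace {v \<in> E. f v \<in> {0}}"
    by (rule subspace_preimage[OF f E(1) subspace_single_0])
  then have "{v \<in> E. f v \<in> {0}} = {0}"
    using line_subspace[OF E(2), of "{v \<in> E. f v \<in> {0}}"] x by auto
  then have "inj_on f E"
    by (intro inj_on_linear_map[OF f E(1)]) auto
  moreover have "f ` E \<subseteq> E1"
    using linear_mapD(1)[OF f E(1)] by blast
  then have "f ` E = E1"
    using line_subspace[OF E1 subspace_linear_image[OF f E(1) E(1)]] x by auto
  ultimately show ?thesis
    by (simp add: bij_betw_def)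
qed

lemma shape_weight_1:
  assumes "shape E K K' F" "weight E (F i) = 1"
  shows "is_line (F i)"
  using shapeD(8)[OF assms(1)]
proof
  assume "is_line E"
  then show ?thesis
    using line_subspace[OF _ shapeD(6,7)[OF assms(1)]] assms(2)
    by (force simp: weight_def split: if_splits)
next
  assume "\<exists>a b. triad E K K' F a b"
  then obtain a b where "triad E K K' F a b"
    by blast
  then show ?thesis
    using triadD(7)[OF _ assms(1), of a b i] triad_diagonal(3)[OF _ assms(1), of a b] assms(2)
    by (auto simp: weight_def is_line_span split: if_splits)
qed

lemma shape_filt_full:
  assumes "shape E K K' F" "p \<in> F i" "p \<noteq> 0" "p \<in> K \<or> p \<in> K'"
  shows "F i = E"
  using shapeD(8)[OF assms(1)]
proof
  assume "is_line E"
  then show ?thesis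
    using line_subspace[OF _ shapeD(6,7)[OF assms(1)], of i] assms(2,3) by auto
next
  assume "\<exists>a b. triad E K K' F a b"
  then show ?thesis
    using triad_filt_full[OF _ assms] by blast
qed

context
  fixes E K K' E1 K1 K1' :: "'v set" and F F1 :: "'i \<Rightarrow> 'v set" and f :: "'v \<Rightarrow> 'v" and x :: 'v
  assumes V: "shape E K K' F" and W: "shape E1 K1 K1' F1"
    and f: "linear_map scale E E1 f"
    and fK: "f ` K \<subseteq> K1" and fK': "f ` K' \<subseteq> K1'" and fF: "\<And>i. f ` F i \<subseteq> F1 i"
    and x: "x \<in> E" "f x \<noteq> 0"
begin

lemma shape_hom_image:
  "subspace C \<Longrightarrow> C \<subseteq> E \<Longrightarrow> subspace (f ` C)"
  using subspace_linear_image[OF f shapeD(1)[OF V]] .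

lemma shape_hom_nonzero_on_triad:
  assumes "triad E K K' F a b"
  shows "f a \<noteq> 0 \<or> f b \<noteq> 0"
proof (rule ccontr)
  assume "\<not> ?thesis"
  moreover obtain c e where "x = c *s a + e *s b"
    using triadD(6)[OF assms V x(1)] by blast
  moreover have "f (c *s a + e *s b) = c *s f a + e *s f b"
    using triad_mem(1,2)[OF assms V] linear_mapD(2,3)[OF f shapeD(1)[OF V]]
    by (simp add: subspace_scale[OF shapeD(1)[OF V]])
  ultimately show False
    using x(2) by simp
qed

lemma shape_hom_stage: "stage E K K' \<le> stage E1 K1 K1'"
  using shapeD(8)[OF V]
proof
  assume line: "is_line E"
  note KE = line_subspace[OF line shapeD(2,3)[OF V]] line_subspace[OF line shapeD(4,5)[OF V]]
  have two: "stage E1 K1 K1' = 2" if "K = E" "K' = E"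
  proof -
    have *: "f x \<in> K1" "f x \<in> K1'"
      using x(1) fK fK' that by auto
    have "\<not> triad E1 K1 K1' F1 a b" for a b
      using triadD(5)[OF _ W] * x(2) by blast
    then have "is_line E1"
      using shapeD(8)[OF W] by blast
    then have "K1 = E1" "K1' = E1"
      using line_subspace[OF _ shapeD(2,3)[OF W]] line_subspace[OF _ shapeD(4,5)[OF W]] * x(2)
      by auto
    then show ?thesis
      using * x(2) by (auto simp: stage_def)
  qed
  have pos: "stage E1 K1 K1' \<noteq> 0" if "K = E \<or> K' = E"
  proof -
    have "f x \<in> K1 \<or> f x \<in> K1'"
      using x(1) fK fK' that by auto
    then show ?thesis
      using x(2) by (auto simp: stage_def)
  qed
  consider "stage E K K' = 0" | "stage E K K' = 1" | "stage E K K' = 2"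
    using stage_le_2[of E K K'] by linarith
  then show ?thesis
  proof cases
    case 2
    then have "K = E \<or> K' = E"
      using stage_eq_0_iff[of E K K'] KE by linarith
    then show ?thesis
      using pos 2 by simp
  next
    case 3
    then show ?thesis
      using two stage_eq_2D[OF 3] by simp
  qed simp
next
  assume "\<exists>a b. triad E K K' F a b"
  then obtain a b where t: "triad E K K' F a b"
    by blast
  have "f a \<in> K1" "f b \<in> K1'"
    using triad_mem(3,4)[OF t V] fK fK' by auto
  then have "stage E1 K1 K1' \<noteq> 0"
    using shape_hom_nonzero_on_triad[OF t] by (auto simp: stage_def)
  then show ?thesis
    using triad_stage[OF t V] by simp
qed

lemma triad_hom_bij:
  assumes V': "triad E K K' F a b" and W': "triad E1 K1 K1' F1 a1 b1"
    and nz: "f a \<noteq> 0" "f b \<noteq> 0"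
  shows "bij_betw f E E1"
proof -
  note E = shapeD(1)[OF V] and mem = triad_mem[OF V' V]
  have "f a \<in> span {a1}" "f b \<in> span {b1}"
    using mem(3,4) fK fK' triadD(3,4)[OF W' W] by auto
  then obtain l m where lm: "f a = l *s a1" "f b = m *s b1"
    by (auto simp: span_singleton)
  then have nz': "l \<noteq> 0" "m \<noteq> 0"
    using nz by auto
  have val: "f (c *s a + e *s b) = (c * l) *s a1 + (e * m) *s b1" for c e
    using mem(1,2) linear_mapD(2,3)[OF f E] by (simp add: subspace_scale[OF E] lm)
  have "inj_on f E"
  proof (rule inj_on_linear_map[OF f E])
    fix v
    assume v: "v \<in> E" "f v = 0"
    obtain c e where ce: "v = c *s a + e *s b"
      using triadD(6)[OF V' V v(1)] by blast
    then have "c * l = 0 \<and> e * m = 0"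
      using triad_independent[OF W' W, of "c * l" "e * m"] v(2) val by simp
    then show "v = 0"
      using ce nz' by simp
  qed
  moreover have "E1 \<subseteq> f ` E"
  proof
    fix w
    assume "w \<in> E1"
    then obtain c e where "w = c *s a1 + e *s b1"
      using triadD(6)[OF W' W] by blast
    then have "w = f ((c / l) *s a + (e / m) *s b)"
      using nz' by (simp add: val)
    then show "w \<in> f ` E"
      using mem(1,2) by (auto simp: subspace_add[OF E] subspace_scale[OF E])
  qed
  moreover have "f ` E \<subseteq> E1"
    using linear_mapD(1)[OF f E] by blast
  ultimately show ?thesis
    by (auto simp: bij_betw_def)
qed

text \<open>
  Within one stage, a map that is not bijective on \<open>E\<close> has an image line in \<open>K1\<close> or \<open>K1'\<close> that
  lies in each member of the filtration of \<open>E1\<close> whose counterpart in \<open>E\<close> is nonzero. Such a line is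
  contained in no proper member, so each of these members is \<open>E1\<close>. A member of weight 1 exists
  since two lines would admit only bijections, so that one of the configurations is a triad.
\<close>

lemma shape_hom_dichotomy:
  assumes stage: "stage E K K' = stage E1 K1 K1'"
  shows "bij_betw f E E1 \<or>
    (\<forall>i. F i \<noteq> {0} \<longrightarrow> F1 i = E1) \<and> (\<exists>i. weight E (F i) = 1 \<or> weight E1 (F1 i) = 1)"
  using shapeD(8)[OF V]
proof
  assume line: "is_line E"
  show ?thesis
    using shapeD(8)[OF W]
  proof
    assume "is_line E1"
    then show ?thesis
      using line_hom_bij[OF shapeD(1)[OF V] line _ f x] by blast
  next
    assume "\<exists>a b. triad E1 K1 K1' F1 a b"
    then obtain a b where t: "triad E1 K1 K1' F1 a b"
      by blast
    then have "K \<noteq> {0} \<or> K' \<noteq> {0}"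
      using stage triad_stage[OF t W] by (auto simp: stage_def)
    then have "K = E \<or> K' = E"
      using line_subspace[OF line shapeD(2,3)[OF V]] line_subspace[OF line shapeD(4,5)[OF V]]
      by blast
    then have p: "f x \<in> K1 \<or> f x \<in> K1'"
      using x(1) fK fK' by auto
    have "F1 i = E1" if "F i \<noteq> {0}" for i
    proof -
      have "F i = E"
        using line_subspace[OF line shapeD(6,7)[OF V]] that by blast
      then show ?thesis
        using shape_filt_full[OF W _ x(2) p] fF[of i] x(1) by blast
    qed
    moreover obtain i where "F1 i = span {a + b}"
      using triadD(8)[OF t W] by blast
    ultimately show ?thesis
      using triad_weight_1[OF t W] by blast
  qed
next
  assume "\<exists>a b. triad E K K' F a b"
  then obtain a b where t: "triad E K K' F a b"
    by blast
  note mem = triad_mem[OF t V] and nz = shape_hom_nonzero_on_triad[OF t]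
  have fa: "f a \<in> K1" "f b \<in> K1'"
    using mem(3,4) fK fK' by auto
  show ?thesis
  proof (cases "f a = 0 \<or> f b = 0")
    case True
    have "f (a + b) = f a + f b"
      using linear_mapD(2)[OF f shapeD(1)[OF V]] mem(1,2) by blast
    then have p: "f (a + b) \<noteq> 0" "f (a + b) \<in> K1 \<or> f (a + b) \<in> K1'"
      using True nz fa by auto
    have "F1 i = E1" if "F i \<noteq> {0}" for i
      using shape_filt_full[OF W _ p] triad_diagonal_mem[OF t V that] fF[of i] by blast
    moreover obtain i where "F i = span {a + b}"
      using triadD(8)[OF t V] by blast
    ultimately show ?thesis
      using triad_weight_1[OF t V] by blast
  next
    case False
    have "\<not> is_line E1"
    proof
      assume line: "is_line E1"
      have "K1 = E1" "K1' = E1"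
        using line_subspace[OF line shapeD(2,3)[OF W]] line_subspace[OF line shapeD(4,5)[OF W]]
          fa False by auto
      then have "stage E1 K1 K1' = 2"
        using fa False by (auto simp: stage_def)
      then show False
        using stage triad_stage[OF t V] by simp
    qed
    then obtain a1 b1 where "triad E1 K1 K1' F1 a1 b1"
      using shapeD(8)[OF W] by blast
    then show ?thesis
      using triad_hom_bij[OF t] False by blast
  qed
qed

lemma shape_hom_weight:
  assumes stage: "stage E K K' = stage E1 K1 K1'"
  shows "weight E (F i) \<le> weight E1 (F1 i)"
  using shape_hom_dichotomy[OF stage]
proof
  assume bij: "bij_betw f E E1"
  have inj: "inj_on f E" and surj: "f ` E = E1"
    using bij by (auto simp: bij_betw_def)
  have "F1 i = E1" if "F i = E"
    using that fF[of i] shapeD(7)[OF W, of i] surj by auto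
  moreover have "F1 i \<noteq> {0}" if nz: "F i \<noteq> {0}"
  proof -
    obtain v where v: "v \<in> F i" "v \<noteq> 0"
      using nz subspace_0[OF shapeD(6)[OF V, of i]] by blast
    then have "f v \<noteq> f 0"
      using inj_onD[OF inj] shapeD(7)[OF V, of i] subspace_0[OF shapeD(1)[OF V]] by blast
    then show ?thesis
      using v(1) fF[of i] linear_mapD(4)[OF f shapeD(1)[OF V]] by auto
  qed
  ultimately show ?thesis
    by (auto simp: weight_def)
next
  assume "(\<forall>i. F i \<noteq> {0} \<longrightarrow> F1 i = E1) \<and> (\<exists>i. weight E (F i) = 1 \<or> weight E1 (F1 i) = 1)"
  moreover have "E1 \<noteq> {0}"
    using x linear_mapD(1)[OF f shapeD(1)[OF V]] by blast
  ultimately show ?thesis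
    by (auto simp: weight_def)
qed

text \<open>
  Equal weights exclude the second alternative of the dichotomy. A bijection that preserves the
  weights then maps each member onto its counterpart, because in weight 1 both are lines.
\<close>

lemma shape_hom_iso:
  assumes stage: "stage E K K' = stage E1 K1 K1'"
    and weight: "\<And>i. weight E (F i) = weight E1 (F1 i)"
  shows "bij_betw f E E1 \<and> f ` K = K1 \<and> f ` K' = K1' \<and> (\<forall>i. f ` F i = F1 i)"
proof -
  note E = shapeD(1)[OF V]
  have E1: "E1 \<noteq> {0}"
    using x linear_mapD(1)[OF f E] by blast
  have "\<not> ((\<forall>i. F i \<noteq> {0} \<longrightarrow> F1 i = E1) \<and> (\<exists>i. weight E (F i) = 1 \<or> weight E1 (F1 i) = 1))"
  proof
    assume *: "(\<forall>i. F i \<noteq> {0} \<longrightarrow> F1 i = E1) \<and> (\<exists>i. weight E (F i) = 1 \<or> weight E1 (F1 i) = 1)"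
    then obtain i where i: "weight E (F i) = 1"
      using weight by auto
    then have "F i \<noteq> {0}"
      by (auto simp: weight_def)
    then have "weight E1 (F1 i) = 2"
      using * E1 by (simp add: weight_def)
    then show False
      using i weight by simp
  qed
  then have bij: "bij_betw f E E1"
    using shape_hom_dichotomy[OF stage] by blast
  then have inj: "inj_on f E" and surj: "f ` E = E1"
    by (auto simp: bij_betw_def)
  have f0: "f 0 = 0"
    by (rule linear_mapD(4)[OF f E])
  have to_line: "f ` C = D" if C: "subspace C" "C \<subseteq> E" "C \<noteq> {0}" "f ` C \<subseteq> D" "is_line D" for C D
  proof -
    obtain v where v: "v \<in> C" "v \<noteq> 0"
      using C(1,3) subspace_0 by blast
    then have "f v \<noteq> 0"
      using inj_onD[OF inj, of v 0] C(2) f0 subspace_0[OF E] by auto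
    then show ?thesis
      using line_subspace[OF C(5) shape_hom_image[OF C(1,2)] C(4)] v(1) by auto
  qed
  have "f ` F i = F1 i" for i
  proof -
    consider "F i = {0}" | "F i = E" | "weight E (F i) = 1"
      unfolding weight_def by (metis (full_types))
    then show ?thesis
    proof cases
      case 1
      then have "weight E1 (F1 i) = 0"
        using weight[of i] by (simp add: weight_def)
      then have "F1 i = {0}"
        by (auto simp: weight_def split: if_splits)
      then show ?thesis
        using 1 f0 by simp
    next
      case 2
      then show ?thesis
        using fF[of i] shapeD(7)[OF W, of i] surj by auto
    next
      case 3
      then have "F i \<noteq> {0}"
        by (auto simp: weight_def)
      then show ?thesis
        using to_line[OF shapeD(6,7)[OF V] _ fF] shape_weight_1[OF W, of i] 3 weight[of i] by simp
    qed
  qed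
  moreover have "f ` K = K1 \<and> f ` K' = K1'"
    using shapeD(8)[OF V]
  proof
    assume line: "is_line E"
    note KE = line_subspace[OF line shapeD(2,3)[OF V]] line_subspace[OF line shapeD(4,5)[OF V]]
    obtain y where y: "y \<noteq> 0" "E = span {y}"
      using line by (auto simp: is_line_def)
    have "E1 = span {f y}"
    proof -
      have "y \<in> E"
        using y(2) by (simp add: span_base)
      then have "f ` E = range (\<lambda>c. c *s f y)"
        using linear_mapD(3)[OF f E] y(2) by (auto simp: span_singleton image_image)
      then show ?thesis
        using surj by (simp add: span_singleton)
    qed
    then have "is_line E1"
      using E1 by (cases "f y = 0") (auto simp: is_line_span)
    note KE1 = line_subspace[OF this shapeD(2,3)[OF W]] line_subspace[OF this shapeD(4,5)[OF W]]
    have E0: "E \<noteq> {0}"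
      using x f0 by auto
    have full: "K = E \<Longrightarrow> K1 = E1" "K' = E \<Longrightarrow> K1' = E1"
      using fK fK' surj shapeD(3,5)[OF W] by auto
    have "K = E \<and> K' = E" if "K1 = E1" "K1' = E1"
      using that stage E1 by (intro stage_eq_2D) (simp add: stage_def)
    moreover have "K1 = {0} \<and> K1' = {0}" if "K = {0}" "K' = {0}"
      using that stage stage_eq_0_iff by metis
    ultimately have "K = {0} \<Longrightarrow> K1 = {0}" "K' = {0} \<Longrightarrow> K1' = {0}"
      using KE KE1 full E0 by metis+
    moreover have "f ` {0} = {0}"
      using f0 by simp
    ultimately show ?thesis
      using KE full surj by metis
  next
    assume "\<exists>a b. triad E K K' F a b"
    then obtain a b where t: "triad E K K' F a b"
      by blast
    have K: "K \<noteq> {0}" "K' \<noteq> {0}" "K \<noteq> E"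
      using triad_mem[OF t V] triadD(1,2)[OF t V] by auto
    have "\<not> is_line E1"
    proof
      assume "is_line E1"
      then have "f ` K = f ` E"
        using to_line[OF shapeD(2,3)[OF V] K(1)] surj shapeD(3)[OF V] by blast
      then have "K = E"
        using inj_on_image_eq_iff[OF inj shapeD(3)[OF V] subset_refl] by blast
      then show False
        using K(3) by blast
    qed
    then obtain a1 b1 where t1: "triad E1 K1 K1' F1 a1 b1"
      using shapeD(8)[OF W] by blast
    have "is_line K1" "is_line K1'"
      using triadD(1-4)[OF t1 W] by (simp_all add: is_line_span)
    then show ?thesis
      using to_line[OF shapeD(2,3)[OF V] K(1) fK] to_line[OF shapeD(4,5)[OF V] K(2) fK'] by blast
  qed
  ultimately show ?thesis
    using bij by blast
qed

end

end

section \<open>Representations of quivers of type \<open>D_\<infinity>\<close>\<close>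

text \<open>
  The image and the kernel of an idempotent endomorphism are complementary subrepresentations.
\<close>

lemma idempotent_endomorphism_trivial:
  assumes "wf_digraph Q" and vs: "vector_space s"
    and indec: "indecomposable Q s V" and e: "morphism Q s V V e"
    and idem: "\<And>i x. i \<in> verts Q \<Longrightarrow> x \<in> space V i \<Longrightarrow> e i (e i x) = e i x"
  shows "(\<forall>i\<in>verts Q. \<forall>x\<in>space V i. e i x = 0) \<or> (\<forall>i\<in>verts Q. \<forall>x\<in>space V i. e i x = x)"
proof -
  interpret wf_digraph Q by fact
  interpret ambient_space s
    unfolding ambient_space_def by fact
  define A where "A = V\<lparr>space := \<lambda>i. e i ` space V i\<rparr>"
  define B where "B = V\<lparr>space := \<lambda>i. {x \<in> space V i. e i x \<in> {0}}\<rparr>"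
  have A: "space A i = e i ` space V i" "amap A a = amap V a" for i a
    by (simp_all add: A_def)
  have B: "space B i = {x \<in> space V i. e i x \<in> {0}}" "amap B a = amap V a" for i a
    by (simp_all add: B_def)
  have V: "Defs.representation Q s V"
    using indec by (simp add: indecomposable_def)
  have sub: "subspace (space V i)" if "i \<in> verts Q" for i
    using V that by (simp add: Defs.representation_def)
  have map: "linear_map s (space V (tail Q a)) (space V (head Q a)) (amap V a)" if "a \<in> arcs Q" for a
    using V that by (simp add: Defs.representation_def)
  have lin: "linear_map s (space V i) (space V i) (e i)" if "i \<in> verts Q" for i
    using e that by (simp add: morphism_def)
  have comm: "e (head Q a) (amap V a x) = amap V a (e (tail Q a) x)"
    if "a \<in> arcs Q" "x \<in> space V (tail Q a)" for a x
    using e that by (simp add: morphism_def)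
  note eD = linear_mapD[OF lin sub]
  note mapD = linear_mapD[OF map sub[OF tail_in_verts]]
  have "Defs.representation Q s A"
    unfolding Defs.representation_def
  proof (intro conjI ballI)
    show "subspace (space A i)" if "i \<in> verts Q" for i
      using subspace_linear_image[OF lin[OF that] sub[OF that] sub[OF that]] by (simp add: A)
    show "linear_map s (space A (tail Q a)) (space A (head Q a)) (amap A a)" if "a \<in> arcs Q" for a
      unfolding linear_map_def A
      using that mapD[OF that that] eD(1) comm[OF that, symmetric] by auto
  qed
  moreover have "Defs.representation Q s B"
    unfolding Defs.representation_def
  proof (intro conjI ballI)
    show "subspace (space B i)" if "i \<in> verts Q" for i
      unfolding B by (rule subspace_preimage[OF lin[OF that] sub[OF that] subspace_single_0])
    show "linear_map s (space B (tail Q a)) (space B (head Q a)) (amap B a)" if "a \<in> arcs Q" for a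
      unfolding linear_map_def B
      using mapD[OF that that] comm[OF that] by auto
  qed
  moreover have "space V i = {x + y |x y. x \<in> space A i \<and> y \<in> space B i} \<and>
      space A i \<inter> space B i = {0}" if i: "i \<in> verts Q" for i
  proof
    note i' = i i
    show "space V i = {x + y |x y. x \<in> space A i \<and> y \<in> space B i}"
    proof
      show "space V i \<subseteq> {x + y |x y. x \<in> space A i \<and> y \<in> space B i}"
      proof
        fix x
        assume x: "x \<in> space V i"
        have "x - e i x \<in> space B i"
          using x eD(1,5)[OF i'] idem[OF i x] subspace_diff[OF sub[OF i]] by (simp add: B)
        moreover have "e i x \<in> space A i" "x = e i x + (x - e i x)"
          using x by (simp_all add: A)
        ultimately show "x \<in> {x + y |x y. x \<in> space A i \<and> y \<in> space B i}"
          by blast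
      qed
      show "{x + y |x y. x \<in> space A i \<and> y \<in> space B i} \<subseteq> space V i"
        using eD(1)[OF i'] subspace_add[OF sub[OF i]] by (auto simp: A B)
    qed
    have "e i 0 = 0" "0 \<in> space V i"
      using eD(4)[OF i'] subspace_0[OF sub[OF i]] by auto
    then show "space A i \<inter> space B i = {0}"
      using idem[OF i] by (auto simp: A B intro: rev_image_eqI)
  qed
  moreover have "space A i \<subseteq> space V i" "space B i \<subseteq> space V i" if "i \<in> verts Q" for i
    using eD(1)[OF that that] by (auto simp: A B)
  ultimately have "direct_sum_of Q s V A B"
    by (simp add: direct_sum_of_def subrepresentation_def A(2) B(2))
  then have "zero_rep Q A \<or> zero_rep Q B"
    using indec by (simp add: indecomposable_def)
  then show ?thesis
  proof
    assume "zero_rep Q A"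
    then have "\<forall>i\<in>verts Q. \<forall>x\<in>space V i. e i x = 0"
      by (auto simp: zero_rep_def A)
    then show ?thesis ..
  next
    assume Z: "zero_rep Q B"
    have "e i x = x" if i: "i \<in> verts Q" and x: "x \<in> space V i" for i x
    proof -
      have "x - e i x \<in> space B i"
        using x eD(1,5)[OF i i] idem[OF i x] subspace_diff[OF sub[OF i]] by (simp add: B)
      then have "x - e i x = 0"
        using Z i by (auto simp: zero_rep_def)
      then show ?thesis by simp
    qed
    then show ?thesis by blast
  qed
qed

fun parent :: "d_inf_vertex \<Rightarrow> d_inf_vertex" where
  "parent DU = DV 0"
| "parent DU' = DV 0"
| "parent (DV j) = DV (j - 1)"

text \<open>
  The vertex \<open>DV 0\<close> is regarded as the root of the tree. Three arms start there: the long one, and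
  the two short ones that end in \<open>DU\<close> and \<open>DU'\<close>. A short arm is prolonged by identity maps,
  so that all three are arms in the sense above.
\<close>

fun arm_vertex :: "d_inf_vertex \<Rightarrow> nat \<Rightarrow> d_inf_vertex" where
  "arm_vertex k 0 = DV 0"
| "arm_vertex DU (Suc j) = DU"
| "arm_vertex DU' (Suc j) = DU'"
| "arm_vertex (DV i) (Suc j) = DV (Suc j)"

lemma arm_vertex_DV [simp]: "arm_vertex (DV i) j = DV j"
  by (cases j) auto

text \<open>
  A choice of coordinates on the quiver: the edge between \<open>c\<close> and its parent is the arrow \<open>ar c\<close>,
  which points away from the root if \<open>out c\<close> holds, and \<open>N\<close> bounds the inward arrows of the long
  arm.
\<close>

locale rooted_d_inf_quiver = ambient_space scale
  for scale :: "'k::field \<Rightarrow> 'v::ab_group_add \<Rightarrow> 'v" (infixr \<open>*s\<close> 75) +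
  fixes Q :: "('a, 'b) pre_digraph" and vx :: "d_inf_vertex \<Rightarrow> 'a" and ar :: "d_inf_vertex \<Rightarrow> 'b"
    and out :: "d_inf_vertex \<Rightarrow> bool" and N :: nat
  assumes wf: "wf_digraph Q"
    and verts_eq: "verts Q = range vx" and inj_vx: "inj vx"
    and arcs_eq: "arcs Q = ar ` {c. c \<noteq> DV 0}" and inj_ar: "inj_on ar {c. c \<noteq> DV 0}"
    and outward: "c \<noteq> DV 0 \<Longrightarrow> out c \<Longrightarrow> tail Q (ar c) = vx (parent c) \<and> head Q (ar c) = vx c"
    and inward: "c \<noteq> DV 0 \<Longrightarrow> \<not> out c \<Longrightarrow> tail Q (ar c) = vx c \<and> head Q (ar c) = vx (parent c)"
    and ultimately_out: "N \<le> j \<Longrightarrow> out (DV (Suc j))"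
begin

abbreviation vsp :: "('a, 'b, 'v) rep \<Rightarrow> d_inf_vertex \<Rightarrow> 'v set" where
  "vsp V c \<equiv> space V (vx c)"

abbreviation vmap :: "('a, 'b, 'v) rep \<Rightarrow> d_inf_vertex \<Rightarrow> 'v \<Rightarrow> 'v" where
  "vmap V c \<equiv> amap V (ar c)"

definition arm_space :: "('a, 'b, 'v) rep \<Rightarrow> d_inf_vertex \<Rightarrow> nat \<Rightarrow> 'v set" where
  "arm_space V k j = vsp V (arm_vertex k j)"

definition arm_dir :: "d_inf_vertex \<Rightarrow> nat \<Rightarrow> bool" where
  "arm_dir k j = (case k of DV i \<Rightarrow> out (DV (Suc j)) | _ \<Rightarrow> out k \<or> 0 < j)"

definition arm_map :: "('a, 'b, 'v) rep \<Rightarrow> d_inf_vertex \<Rightarrow> nat \<Rightarrow> 'v \<Rightarrow> 'v" where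
  "arm_map V k j =
     (case k of DV i \<Rightarrow> vmap V (DV (Suc j)) | _ \<Rightarrow> if j = 0 then vmap V k else (\<lambda>v. v))"

lemma arm_space_simps [simp]:
  "arm_space V (DV i) j = vsp V (DV j)" "arm_space V k 0 = vsp V (DV 0)"
  "arm_space V DU (Suc j) = vsp V DU" "arm_space V DU' (Suc j) = vsp V DU'"
  by (simp_all add: arm_space_def)

lemma arm_dir_simps [simp]:
  "arm_dir (DV i) j = out (DV (Suc j))" "arm_dir DU 0 = out DU" "arm_dir DU' 0 = out DU'"
  "arm_dir DU (Suc j)" "arm_dir DU' (Suc j)"
  by (simp_all add: arm_dir_def)

lemma arm_map_simps [simp]:
  "arm_map V (DV i) j = vmap V (DV (Suc j))"
  "arm_map V DU 0 = vmap V DU" "arm_map V DU' 0 = vmap V DU'"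
  "arm_map V DU (Suc j) = (\<lambda>v. v)" "arm_map V DU' (Suc j) = (\<lambda>v. v)"
  by (simp_all add: arm_map_def)

lemma rep_subspace: "Defs.representation Q scale V \<Longrightarrow> subspace (vsp V c)"
  by (simp add: Defs.representation_def verts_eq)

lemma rep_map:
  assumes "Defs.representation Q scale V" "c \<noteq> DV 0"
  shows "out c \<Longrightarrow> linear_map scale (vsp V (parent c)) (vsp V c) (vmap V c)"
    "\<not> out c \<Longrightarrow> linear_map scale (vsp V c) (vsp V (parent c)) (vmap V c)"
proof -
  have "linear_map scale (space V (tail Q (ar c))) (space V (head Q (ar c))) (vmap V c)"
    using assms by (auto simp: Defs.representation_def arcs_eq)
  then show "out c \<Longrightarrow> linear_map scale (vsp V (parent c)) (vsp V c) (vmap V c)"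
    "\<not> out c \<Longrightarrow> linear_map scale (vsp V c) (vsp V (parent c)) (vmap V c)"
    using outward[OF assms(2)] inward[OF assms(2)] by auto
qed

lemma rep_arm:
  assumes V: "Defs.representation Q scale V"
  shows "arm (arm_space V k) (arm_dir k) (arm_map V k)"
  unfolding arm_def
proof (intro allI conjI)
  show "subspace (arm_space V k j)" for j
    using rep_subspace[OF V] by (simp add: arm_space_def)
  have id: "linear_map scale Y Y (\<lambda>v. v)" for Y
    by (rule linear_map_id) simp
  show "if arm_dir k j then linear_map scale (arm_space V k j) (arm_space V k (Suc j)) (arm_map V k j)
     else linear_map scale (arm_space V k (Suc j)) (arm_space V k j) (arm_map V k j)" for j
  proof (cases k)
    case DU
    then show ?thesis
      using rep_map[OF V, of DU] id by (cases j) auto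
  next
    case DU'
    then show ?thesis
      using rep_map[OF V, of DU'] id by (cases j) auto
  next
    case (DV i)
    then show ?thesis
      using rep_map[OF V, of "DV (Suc j)"] by auto
  qed
qed

lemma FLEI_ultimately_iso:
  assumes "FLEI Q scale V"
  shows "\<exists>M. ultimately_iso M (arm_space V k) (arm_dir k) (arm_map V k)"
proof (cases k)
  case (DV i)
  let ?bad = "{a \<in> arcs Q. \<not> bij_betw (amap V a) (space V (tail Q a)) (space V (head Q a))}"
  let ?I = "(\<lambda>j. ar (DV (Suc j))) -` ?bad"
  have "finite ?bad"
    using assms by (simp add: FLEI_def)
  moreover have "inj (\<lambda>j. ar (DV (Suc j)))"
    using inj_ar by (auto simp: inj_on_def)
  ultimately have "finite ?I"
    by (rule finite_vimageI)
  then have "\<exists>m. \<forall>j\<in>?I. j < m"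
    by (simp only: finite_nat_set_iff_bounded)
  then obtain m where m: "\<forall>j\<in>?I. j < m"
    by (rule exE)
  have "ultimately_iso (max m N) (arm_space V k) (arm_dir k) (arm_map V k)"
    unfolding ultimately_iso_def
  proof (intro allI impI)
    fix j
    assume j: "max m N \<le> j"
    then have out: "out (DV (Suc j))"
      by (simp add: ultimately_out)
    have "ar (DV (Suc j)) \<notin> ?bad"
      using bspec[OF m, of j] j by auto
    then have "bij_betw (vmap V (DV (Suc j))) (vsp V (DV j)) (vsp V (DV (Suc j)))"
      using outward[of "DV (Suc j)"] out arcs_eq by auto
    then show "arm_dir k j \<and> bij_betw (arm_map V k j) (arm_space V k j) (arm_space V k (Suc j))"
      using DV out by simp
  qed
  then show ?thesis ..
next
  case DU
  then have "ultimately_iso 1 (arm_space V k) (arm_dir k) (arm_map V k)"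
    by (auto simp: ultimately_iso_def Suc_le_eq gr0_conv_Suc bij_betw_def)
  then show ?thesis ..
next
  case DU'
  then have "ultimately_iso 1 (arm_space V k) (arm_dir k) (arm_map V k)"
    by (auto simp: ultimately_iso_def Suc_le_eq gr0_conv_Suc bij_betw_def)
  then show ?thesis ..
qed

lemma morphismD:
  assumes "morphism Q scale V W f"
  shows "linear_map scale (vsp V c) (vsp W c) (f (vx c))"
    "c \<noteq> DV 0 \<Longrightarrow> out c \<Longrightarrow> v \<in> vsp V (parent c) \<Longrightarrow>
      f (vx c) (vmap V c v) = vmap W c (f (vx (parent c)) v)"
    "c \<noteq> DV 0 \<Longrightarrow> \<not> out c \<Longrightarrow> v \<in> vsp V c \<Longrightarrow>
      f (vx (parent c)) (vmap V c v) = vmap W c (f (vx c) v)"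
proof -
  have *: "f (head Q (ar c)) (vmap V c v) = vmap W c (f (tail Q (ar c)) v)"
    if "c \<noteq> DV 0" "v \<in> space V (tail Q (ar c))"
    using assms that by (auto simp: morphism_def arcs_eq)
  show "linear_map scale (vsp V c) (vsp W c) (f (vx c))"
    using assms by (simp add: morphism_def verts_eq)
  show "f (vx c) (vmap V c v) = vmap W c (f (vx (parent c)) v)"
    if "c \<noteq> DV 0" "out c" "v \<in> vsp V (parent c)"
    using * outward[OF that(1,2)] that by simp
  show "f (vx (parent c)) (vmap V c v) = vmap W c (f (vx c) v)"
    if "c \<noteq> DV 0" "\<not> out c" "v \<in> vsp V c"
    using * inward[OF that(1,2)] that by simp
qed

lemma morphism_arm_hom:
  assumes "morphism Q scale V W f"
  shows "arm_hom (arm_space V k) (arm_space W k) (arm_dir k) (arm_map V k) (arm_map W k)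
    (\<lambda>j. f (vx (arm_vertex k j)))"
  unfolding arm_hom_def
proof (intro allI conjI)
  note f = morphismD[OF assms]
  show "linear_map scale (arm_space V k j) (arm_space W k j) (f (vx (arm_vertex k j)))" for j
    using f(1) by (simp add: arm_space_def)
  show "if arm_dir k j
     then \<forall>v\<in>arm_space V k j. f (vx (arm_vertex k (Suc j))) (arm_map V k j v) =
        arm_map W k j (f (vx (arm_vertex k j)) v)
     else \<forall>v\<in>arm_space V k (Suc j). f (vx (arm_vertex k j)) (arm_map V k j v) =
        arm_map W k j (f (vx (arm_vertex k (Suc j))) v)" for j
  proof (cases k)
    case DU
    then show ?thesis
      using f(2,3)[of DU] by (cases j) auto
  next
    case DU'
    then show ?thesis
      using f(2,3)[of DU'] by (cases j) auto
  next
    case (DV i)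
    then show ?thesis
      using f(2,3)[of "DV (Suc j)"] by auto
  qed
qed

lemma idempotent_trivial:
  assumes indec: "indecomposable Q scale V"
    and lin: "\<And>c. linear_map scale (vsp V c) (vsp V c) (e c)"
    and idem: "\<And>c v. v \<in> vsp V c \<Longrightarrow> e c (e c v) = e c v"
    and out: "\<And>c v. c \<noteq> DV 0 \<Longrightarrow> out c \<Longrightarrow> v \<in> vsp V (parent c) \<Longrightarrow>
      vmap V c (e (parent c) v) = e c (vmap V c v)"
    and into: "\<And>c v. c \<noteq> DV 0 \<Longrightarrow> \<not> out c \<Longrightarrow> v \<in> vsp V c \<Longrightarrow>
      vmap V c (e c v) = e (parent c) (vmap V c v)"
    and nonzero: "v0 \<in> vsp V c0" "e c0 v0 \<noteq> 0"
  shows "v \<in> vsp V c \<Longrightarrow> e c v = v"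
proof -
  let ?e = "\<lambda>i. e (inv vx i)"
  have inv: "inv vx (vx c) = c" for c
    using inj_vx by simp
  have "morphism Q scale V V ?e"
    unfolding morphism_def
  proof (intro conjI ballI)
    show "linear_map scale (space V i) (space V i) (?e i)" if "i \<in> verts Q" for i
      using that lin by (auto simp: verts_eq inv)
    fix a x
    assume a: "a \<in> arcs Q" and x: "x \<in> space V (tail Q a)"
    then obtain c where c: "c \<noteq> DV 0" "a = ar c"
      by (auto simp: arcs_eq)
    then show "?e (head Q a) (amap V a x) = amap V a (?e (tail Q a) x)"
      using outward[OF c(1)] inward[OF c(1)] out[OF c(1)] into[OF c(1)] x
      by (cases "out c") (auto simp: inv)
  qed
  then have "(\<forall>i\<in>verts Q. \<forall>x\<in>space V i. ?e i x = 0) \<or> (\<forall>i\<in>verts Q. \<forall>x\<in>space V i. ?e i x = x)"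
    using idem by (intro idempotent_endomorphism_trivial[OF wf vector_space_axioms indec])
      (auto simp: verts_eq inv)
  then show "v \<in> vsp V c \<Longrightarrow> e c v = v"
    using nonzero by (auto simp: verts_eq inv)
qed

end

section \<open>The indecomposables\<close>

context rooted_d_inf_quiver
begin

text \<open>
  The only member of the filtration of a short arm that can differ from zero and the whole space.
\<close>

definition branch :: "('a, 'b, 'v) rep \<Rightarrow> d_inf_vertex \<Rightarrow> 'v set" where
  "branch V k =
     (if out k then {v \<in> vsp V (DV 0). vmap V k v = 0} else vmap V k ` vsp V k)"

definition tail_space :: "('a, 'b, 'v) rep \<Rightarrow> nat \<Rightarrow> nat \<Rightarrow> 'v set" where
  "tail_space V a = (\<lambda>j. vsp V (DV (a + j)))"

definition tail_dir :: "nat \<Rightarrow> nat \<Rightarrow> bool" where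
  "tail_dir a = (\<lambda>j. out (DV (Suc (a + j))))"

definition tail_map :: "('a, 'b, 'v) rep \<Rightarrow> nat \<Rightarrow> nat \<Rightarrow> 'v \<Rightarrow> 'v" where
  "tail_map V a = (\<lambda>j. vmap V (DV (Suc (a + j))))"

definition tail_filt :: "('a, 'b, 'v) rep \<Rightarrow> nat \<Rightarrow> bool \<times> nat \<Rightarrow> 'v set" where
  "tail_filt V a = (\<lambda>(b, j). arm_filt b j (tail_space V a) (tail_dir a) (tail_map V a))"

definition root_branch :: "('a, 'b, 'v) rep \<Rightarrow> nat \<Rightarrow> d_inf_vertex \<Rightarrow> 'v set" where
  "root_branch V a k = (if a = 0 then branch V k else {0})"

lemma long_arm_eq_tail:
  "arm_space V (DV i) = tail_space V 0" "arm_dir (DV i) = tail_dir 0" "arm_map V (DV i) = tail_map V 0"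
  by (simp_all add: tail_space_def tail_dir_def tail_map_def fun_eq_iff)

lemma tail_arm:
  assumes "Defs.representation Q scale V"
  shows "arm (tail_space V a) (tail_dir a) (tail_map V a)"
  using arm_shift[OF rep_arm[OF assms, of "DV 0"], of a]
  by (simp add: tail_space_def tail_dir_def tail_map_def)

lemma tail_ultimately_iso:
  assumes "FLEI Q scale V"
  shows "\<exists>M. ultimately_iso M (tail_space V a) (tail_dir a) (tail_map V a)"
proof -
  obtain M where "ultimately_iso M (arm_space V (DV 0)) (arm_dir (DV 0)) (arm_map V (DV 0))"
    using FLEI_ultimately_iso[OF assms] by blast
  then have "ultimately_iso M (tail_space V a) (tail_dir a) (tail_map V a)"
    by (simp add: ultimately_iso_def tail_space_def tail_dir_def tail_map_def)
  then show ?thesis ..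
qed

lemma constant_arm_filt:
  "0 \<in> U \<Longrightarrow> arm_filt b j (\<lambda>i. U) (\<lambda>i. True) (\<lambda>i v. v) = (if b then U else {0})"
  by (induction j) auto

lemma short_arm_filt:
  assumes V: "Defs.representation Q scale V" and k: "k = DU \<or> k = DU'"
  shows "arm_filt b (Suc j) (arm_space V k) (arm_dir k) (arm_map V k) =
    (if b = out k then if b then vsp V (DV 0) else {0} else branch V k)"
proof -
  have 0: "0 \<in> vsp V k"
    using subspace_0[OF rep_subspace[OF V]] .
  have lin: "out k \<Longrightarrow> v \<in> vsp V (DV 0) \<Longrightarrow> vmap V k v \<in> vsp V k" for v
    using linear_mapD(1)[OF rep_map(1)[OF V, of k] rep_subspace[OF V]] k by auto
  have "vmap V k 0 = 0"
    using arm_map_0[OF rep_arm[OF V, of k], of 0] k by auto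
  then show ?thesis
    using k constant_arm_filt[OF 0, of b j] lin by (auto simp: Let_def branch_def)
qed

lemma branch_subspace:
  assumes V: "Defs.representation Q scale V" and k: "k = DU \<or> k = DU'"
  shows "subspace (branch V k)" "branch V k \<subseteq> vsp V (DV 0)"
proof -
  have "branch V k = arm_filt (\<not> out k) (Suc 0) (arm_space V k) (arm_dir k) (arm_map V k)"
    using short_arm_filt[OF V k, of "\<not> out k" 0] by simp
  then show "subspace (branch V k)" "branch V k \<subseteq> vsp V (DV 0)"
    using arm_filt_subspace[OF rep_arm[OF V, of k], of "\<not> out k" "Suc 0"] by simp_all
qed

lemma compatible_short:
  assumes V: "Defs.representation Q scale V" and k: "k = DU \<or> k = DU'"
    and "x \<in> vsp V (DV 0)" "functional \<phi>" "x \<in> branch V k \<or> (\<forall>v\<in>branch V k. \<phi> v = 0)"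
  shows "compatible (arm_space V k) (arm_dir k) (arm_map V k) x \<phi>"
  unfolding compatible_def
proof (intro conjI allI)
  show "x \<in> arm_filt b j (arm_space V k) (arm_dir k) (arm_map V k) \<or>
      (\<forall>v\<in>arm_filt b j (arm_space V k) (arm_dir k) (arm_map V k). \<phi> v = 0)" for b j
  proof (cases j)
    case 0
    then show ?thesis
      using assms(3) functionalD(3)[OF assms(4)] by simp
  next
    case (Suc j')
    then show ?thesis
      using assms(3,5) functionalD(3)[OF assms(4)] short_arm_filt[OF V k, of b j'] by simp
  qed
qed (use assms in simp_all)

text \<open>
  A projection onto at most two lines of the root space extends to an idempotent endomorphism as
  soon as it is a sum of strands along each of the three arms; the decomposition of the
  projection into strands may differ from arm to arm.
\<close>

lemma root_projection_is_identity:
  assumes indec: "indecomposable Q scale V" and flei: "FLEI Q scale V"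
    and cx: "\<And>k. compatible (arm_space V k) (arm_dir k) (arm_map V k) (x k) (\<phi> k)"
    and cy: "\<And>k. compatible (arm_space V k) (arm_dir k) (arm_map V k) (y k) (\<psi> k)"
    and orth: "\<And>k. \<phi> k (y k) = 0" "\<And>k. \<psi> k (x k) = 0"
    and norm: "\<And>k. \<phi> k (x k) = 1"
      "\<And>k. \<psi> k (y k) = 1 \<or> y k = 0 \<and> (\<forall>v\<in>vsp V (DV 0). \<psi> k v = 0)"
    and agree: "\<And>k v. v \<in> vsp V (DV 0) \<Longrightarrow>
      \<phi> k v *s x k + \<psi> k v *s y k = \<phi> (DV 0) v *s x (DV 0) + \<psi> (DV 0) v *s y (DV 0)"
  shows "regular_arm (arm_space V k) (arm_dir k) (arm_map V k)"
    and "v \<in> vsp V (DV 0) \<Longrightarrow> v = \<phi> (DV 0) v *s x (DV 0) + \<psi> (DV 0) v *s y (DV 0)"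
proof -
  have V: "Defs.representation Q scale V"
    using flei by (simp add: FLEI_def)
  let ?S = "\<lambda>k. strand (arm_space V k) (arm_dir k) (arm_map V k)"
  note arm = rep_arm[OF V]
  have "\<forall>k. \<exists>X \<Phi>. ?S k X \<Phi> \<and> X 0 = x k \<and> \<Phi> 0 = \<phi> k"
    using strand_exists[OF arm _ cx] FLEI_ultimately_iso[OF flei] by metis
  then obtain X \<Phi> where X: "\<And>k. ?S k (X k) (\<Phi> k)" "\<And>k. X k 0 = x k" "\<And>k. \<Phi> k 0 = \<phi> k"
    by metis
  have "\<forall>k. \<exists>Y \<Psi>. ?S k Y \<Psi> \<and> Y 0 = y k \<and> \<Psi> 0 = \<psi> k"
    using strand_exists[OF arm _ cy] FLEI_ultimately_iso[OF flei] by metis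
  then obtain Y \<Psi> where Y: "\<And>k. ?S k (Y k) (\<Psi> k)" "\<And>k. Y k 0 = y k" "\<And>k. \<Psi> k 0 = \<psi> k"
    by metis
  define op where "op k = strand_op (X k) (\<Phi> k) (Y k) (\<Psi> k)" for k
  have op_0: "op k 0 v = \<phi> k v *s x k + \<psi> k v *s y k" for k v
    by (simp add: op_def strand_op_def X Y)
  have root: "op k 0 v = op (DV 0) 0 v" if "v \<in> vsp V (DV 0)" for k v
    unfolding op_0 by (rule agree[OF that])
  have lin: "linear_map scale (arm_space V k j) (arm_space V k j) (op k j)" for k j
    unfolding op_def by (rule strand_op_linear[OF arm X(1) Y(1)])
  have idem: "op k j (op k j v) = op k j v" if "v \<in> arm_space V k j" for k j v
    unfolding op_def using that orth norm
    by (intro strand_op_idempotent[OF arm X(1) Y(1)]) (simp_all add: X(2,3) Y(2,3))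
  have out: "arm_map V k j (op k j v) = op k (Suc j) (arm_map V k j v)"
    if "arm_dir k j" "v \<in> arm_space V k j" for k j v
    unfolding op_def by (rule strand_op_commutes(1)[OF arm X(1) Y(1) that])
  have into: "arm_map V k j (op k (Suc j) v) = op k j (arm_map V k j v)"
    if "\<not> arm_dir k j" "v \<in> arm_space V k (Suc j)" for k j v
    unfolding op_def by (rule strand_op_commutes(2)[OF arm X(1) Y(1) that])
  define e where "e c = (case c of DV j \<Rightarrow> op (DV 0) j | _ \<Rightarrow> op c (Suc 0))" for c
  have e: "e (DV j) = op (DV 0) j" "e DU = op DU (Suc 0)" "e DU' = op DU' (Suc 0)" for j
    by (simp_all add: e_def)
  have id: "e c v = v" if "v \<in> vsp V c" for c v
    using that
  proof (rule idempotent_trivial[OF indec, rotated -1])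
    show "x (DV 0) \<in> vsp V (DV 0)"
      using cx[of "DV 0"] by (simp add: compatible_def)
    have "e (DV 0) (x (DV 0)) = x (DV 0)"
      by (simp add: e op_0 orth norm)
    then show "e (DV 0) (x (DV 0)) \<noteq> 0"
      using norm(1)[of "DV 0"] functionalD(3)[of "\<phi> (DV 0)"] cx[of "DV 0"]
      by (auto simp: compatible_def)
  next
    show "linear_map scale (vsp V c) (vsp V c) (e c)" for c
      using lin[of DU "Suc 0"] lin[of DU' "Suc 0"] lin[of "DV 0"] by (cases c) (simp_all add: e)
    show "e c (e c v) = e c v" if "v \<in> vsp V c" for c v
      using that idem[of _ DU "Suc 0"] idem[of _ DU' "Suc 0"] idem[of _ "DV 0"]
      by (cases c) (simp_all add: e)
  next
    fix c v
    assume c: "c \<noteq> DV 0" "out c" and v: "v \<in> vsp V (parent c)"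
    show "vmap V c (e (parent c) v) = e c (vmap V c v)"
    proof (cases c)
      case (DV i)
      then obtain j where "c = DV (Suc j)"
        using c(1) by (cases i) auto
      then show ?thesis
        using out[of "DV 0" j v] c(2) v by (simp add: e)
    next
      case DU
      then show ?thesis
        using c v out[of DU 0 v] root[of v DU] by (simp add: e)
    next
      case DU'
      then show ?thesis
        using c v out[of DU' 0 v] root[of v DU'] by (simp add: e)
    qed
  next
    fix c v
    assume c: "c \<noteq> DV 0" "\<not> out c" and v: "v \<in> vsp V c"
    have mem: "vmap V c v \<in> vsp V (parent c)"
      using linear_mapD(1)[OF rep_map(2)[OF V c] rep_subspace[OF V] v] .
    show "vmap V c (e c v) = e (parent c) (vmap V c v)"
    proof (cases c)
      case (DV i)
      then obtain j where "c = DV (Suc j)"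
        using c(1) by (cases i) auto
      then show ?thesis
        using into[of "DV 0" j v] c(2) v by (simp add: e)
    next
      case DU
      then show ?thesis
        using c v into[of DU 0 v] root[of "vmap V DU v" DU] mem by (simp add: e)
    next
      case DU'
      then show ?thesis
        using c v into[of DU' 0 v] root[of "vmap V DU' v" DU'] mem by (simp add: e)
    qed
  qed
  show "v \<in> vsp V (DV 0) \<Longrightarrow> v = \<phi> (DV 0) v *s x (DV 0) + \<psi> (DV 0) v *s y (DV 0)"
    using id[of v "DV 0"] by (simp add: e op_0)
  have reg: "regular_arm (arm_space V k) (arm_dir k) (arm_map V k)"
    if "\<And>j v. v \<in> arm_space V k j \<Longrightarrow> op k j v = v" for k
    using that by (intro regular_arm_if_strand_op_id[OF arm X(1) Y(1)]) (simp add: op_def)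
  have short: "op k (Suc j) v = v" if k: "k = DU \<or> k = DU'" and v: "v \<in> vsp V k" for k j v
  proof (induction j)
    case 0
    then show ?case
      using k id[OF v] by (auto simp: e)
  next
    case (Suc j)
    then show ?case
      using k v out[of k "Suc j" v] by auto
  qed
  have root_id: "op k 0 v = v" if "v \<in> vsp V (DV 0)" for k v
    using root[OF that] id[OF that] by (simp add: e)
  show "regular_arm (arm_space V k) (arm_dir k) (arm_map V k)"
  proof (cases k)
    case DU
    have "op DU j v = v" if "v \<in> arm_space V DU j" for j v
      using that short[of DU] root_id by (cases j) auto
    then show ?thesis
      unfolding DU by (rule reg)
  next
    case DU'
    have "op DU' j v = v" if "v \<in> arm_space V DU' j" for j v
      using that short[of DU'] root_id by (cases j) auto
    then show ?thesis
      unfolding DU' by (rule reg)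
  next
    case (DV i)
    have "op (DV 0) j v = v" if "v \<in> arm_space V (DV 0) j" for j v
      using that id[of v "DV j"] by (simp add: e)
    then have "regular_arm (arm_space V (DV 0)) (arm_dir (DV 0)) (arm_map V (DV 0))"
      by (rule reg)
    then show ?thesis
      unfolding DV long_arm_eq_tail .
  qed
qed

text \<open>
  \<open>DV a\<close> is the vertex closest to \<open>DV 0\<close> on which \<open>V\<close> lives. For \<open>a > 0\<close> the short arms carry nothing,
  and the configuration at \<open>DV a\<close> is a line with \<open>K = K' = {0}\<close>.
\<close>

definition rooted :: "('a, 'b, 'v) rep \<Rightarrow> nat \<Rightarrow> bool" where
  "rooted V a \<longleftrightarrow>
     vsp V (DV a) \<noteq> {0} \<and> (\<forall>j<a. vsp V (DV j) = {0}) \<and>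
     (0 < a \<longrightarrow> vsp V DU = {0} \<and> vsp V DU' = {0}) \<and>
     (a = 0 \<longrightarrow> (\<forall>k. regular_arm (arm_space V k) (arm_dir k) (arm_map V k))) \<and>
     regular_arm (tail_space V a) (tail_dir a) (tail_map V a) \<and>
     shape (vsp V (DV a)) (root_branch V a DU) (root_branch V a DU') (tail_filt V a)"

definition leaf :: "('a, 'b, 'v) rep \<Rightarrow> d_inf_vertex \<Rightarrow> bool" where
  "leaf V k \<longleftrightarrow> (k = DU \<or> k = DU') \<and> is_line (vsp V k) \<and> (\<forall>c. c \<noteq> k \<longrightarrow> vsp V c = {0})"

lemma tail_filt_subspace:
  "Defs.representation Q scale V \<Longrightarrow>
    subspace (tail_filt V a i) \<and> tail_filt V a i \<subseteq> vsp V (DV a)"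
  using arm_filt_subspace[OF tail_arm, of V "fst i" "snd i" a]
  by (cases i) (simp add: tail_filt_def tail_space_def)

lemma range_tail_filt:
  "range (tail_filt V a) =
    {arm_filt b j (tail_space V a) (tail_dir a) (tail_map V a) |b j. True}"
  by (auto simp: tail_filt_def image_def split_def)

lemma finite_range_tail_filt:
  assumes "FLEI Q scale V"
  shows "finite (range (tail_filt V a))"
proof -
  obtain M where "ultimately_iso M (tail_space V a) (tail_dir a) (tail_map V a)"
    using tail_ultimately_iso[OF assms] by blast
  moreover have "Defs.representation Q scale V"
    using assms by (simp add: FLEI_def)
  ultimately show ?thesis
    unfolding range_tail_filt by (intro finite_arm_filt[OF tail_arm])
qed

lemma tail_filt_chain:
  assumes "Defs.representation Q scale V" "B \<in> range (tail_filt V a)" "C \<in> range (tail_filt V a)"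
  shows "B \<subseteq> C \<or> C \<subseteq> B"
  using assms(2,3) arm_filt_chain[OF tail_arm[OF assms(1)]] by (force simp: tail_filt_def)

lemma tail_filt_0: "tail_filt V a (b, 0) = (if b then vsp V (DV a) else {0})"
  by (simp add: tail_filt_def tail_space_def)

lemma compatible_tail:
  assumes "x \<in> vsp V (DV a)" "functional \<phi>"
    "\<And>i. x \<in> tail_filt V a i \<or> (\<forall>v\<in>tail_filt V a i. \<phi> v = 0)"
  shows "compatible (tail_space V a) (tail_dir a) (tail_map V a) x \<phi>"
  using assms(1,2) assms(3)[of "(b, j)" for b j]
  by (auto simp: compatible_def tail_filt_def tail_space_def)

text \<open>
  Both alternatives for the configuration at the root yield a projection of \<open>E\<close> that extends to \<open>V\<close>.
  It is the identity, so \<open>E\<close> is the line or the plane in question.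
\<close>

lemma rooted_at_root:
  assumes indec: "indecomposable Q scale V" and flei: "FLEI Q scale V"
    and nz: "vsp V (DV 0) \<noteq> {0}"
  shows "rooted V 0"
proof -
  have V: "Defs.representation Q scale V"
    using flei by (simp add: FLEI_def)
  let ?E = "vsp V (DV 0)" and ?K = "branch V DU" and ?K' = "branch V DU'"
  let ?F = "tail_filt V 0"
  note E = rep_subspace[OF V, of "DV 0"]
  have K: "subspace ?K" "?K \<subseteq> ?E" and K': "subspace ?K'" "?K' \<subseteq> ?E"
    using branch_subspace[OF V] by auto
  have F: "subspace (?F i)" "?F i \<subseteq> ?E" for i
    using tail_filt_subspace[OF V] by auto
  have ends: "{0} \<in> range ?F" "?E \<in> range ?F"
    using tail_filt_0[of V 0 False] tail_filt_0[of V 0 True] by (metis rangeI)+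
  have compatI: "compatible (arm_space V k) (arm_dir k) (arm_map V k) x \<phi>"
    if "x \<in> ?E" "functional \<phi>"
      "k = DU \<or> k = DU' \<Longrightarrow> x \<in> branch V k \<or> (\<forall>v\<in>branch V k. \<phi> v = 0)"
      "\<And>l i. k = DV l \<Longrightarrow> x \<in> ?F i \<or> (\<forall>v\<in>?F i. \<phi> v = 0)" for k x \<phi>
  proof (cases k)
    case (DV l)
    then show ?thesis
      using compatible_tail[OF that(1,2) that(4)] by (simp only: long_arm_eq_tail)
  qed (use that compatible_short[OF V] in auto)
  have split: "(\<exists>x \<phi>. x \<in> ?E \<and> functional \<phi> \<and> \<phi> x = 1 \<and>
        (\<forall>C\<in>insert ?K (insert ?K' (range ?F)). x \<in> C \<or> (\<forall>v\<in>C. \<phi> v = 0))) \<or>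
    (\<exists>a b \<alpha> \<beta>. a \<in> ?K \<and> b \<in> ?K' \<and> functional \<alpha> \<and> functional \<beta> \<and> \<alpha> a = 1 \<and> \<beta> b = 1 \<and>
        (\<forall>v\<in>?K'. \<alpha> v = 0) \<and> (\<forall>v\<in>?K. \<beta> v = 0) \<and> (\<forall>C\<in>range ?F. C \<noteq> {0} \<longrightarrow> a + b \<in> C) \<and>
        (\<forall>C\<in>range ?F. a \<in> C \<or> (\<forall>v\<in>C. \<alpha> v = \<beta> v)) \<and> (\<exists>C\<in>range ?F. a \<notin> C \<and> a + b \<in> C))"
    (is "?line \<or> ?plane")
  proof (rule line_or_plane_splits[OF E nz K K' finite_range_tail_filt[OF flei] _ _ ends])
    show "B \<subseteq> C \<or> C \<subseteq> B" if "B \<in> range ?F" "C \<in> range ?F" for B C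
      using tail_filt_chain[OF V that] .
    show "subspace C \<and> C \<subseteq> ?E" if "C \<in> range ?F" for C
      using that F by blast
  qed
  from split have "(\<forall>k. regular_arm (arm_space V k) (arm_dir k) (arm_map V k)) \<and>
    (is_line ?E \<or> (\<exists>a b. triad ?E ?K ?K' ?F a b))"
  proof
    assume ?line
    then obtain x \<phi> where line: "x \<in> ?E" "functional \<phi>" "\<phi> x = 1"
      "\<forall>C\<in>insert ?K (insert ?K' (range ?F)). x \<in> C \<or> (\<forall>v\<in>C. \<phi> v = 0)"
      by (elim exE conjE) (rule that)
    have c: "compatible (arm_space V k) (arm_dir k) (arm_map V k) x \<phi>" for k
      using line by (intro compatI) auto
    note id = root_projection_is_identity[OF indec flei,
        of "\<lambda>k. x" "\<lambda>k. \<phi>" "\<lambda>k. 0" "\<lambda>k v. 0", OF c compatible_0[OF rep_arm[OF V]]]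
    have "v = \<phi> v *s x" if "v \<in> ?E" for v
      using id(2)[OF _ _ _ _ _ that] line(2,3) functionalD(3)[OF line(2)] by simp
    moreover have "x \<noteq> 0"
      using line(3) functionalD(3)[OF line(2)] by auto
    ultimately have "is_line ?E"
      by (intro is_lineI[OF E line(1)])
    then show ?thesis
      using id(1) line(2,3) functionalD(3)[OF line(2)] by simp
  next
    assume ?plane
    then obtain a b \<alpha> \<beta> where plane: "a \<in> ?K" "b \<in> ?K'" "functional \<alpha>" "functional \<beta>" "\<alpha> a = 1" "\<beta> b = 1"
      "\<forall>v\<in>?K'. \<alpha> v = 0" "\<forall>v\<in>?K. \<beta> v = 0" "\<forall>C\<in>range ?F. C \<noteq> {0} \<longrightarrow> a + b \<in> C"
      "\<forall>C\<in>range ?F. a \<in> C \<or> (\<forall>v\<in>C. \<alpha> v = \<beta> v)" "\<exists>C\<in>range ?F. a \<notin> C \<and> a + b \<in> C"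
      by (elim exE conjE) (rule that)
    have ab: "a \<in> ?E" "b \<in> ?E"
      using plane(1,2) K(2) K'(2) by auto
    have val: "\<alpha> b = 0" "\<beta> a = 0"
      using plane(1,2,7,8) by auto
    note fa = functionalD[OF plane(3)] and fb = functionalD[OF plane(4)]
    \<comment> \<open>On the short arms the projection \<open>\<alpha> v *s a + \<beta> v *s b\<close> is split as it stands; on the long arm
      it is written as \<open>\<beta> v *s (a + b) + (\<alpha> v - \<beta> v) *s a\<close>, since \<open>a + b\<close> lies in all nonzero members
      of the filtration and \<open>\<alpha> - \<beta>\<close> vanishes on the members that avoid \<open>a\<close>.\<close>
    let ?long = "\<lambda>k. \<exists>l. k = DV l"
    let ?x = "\<lambda>k. if ?long k then a + b else a" and ?\<phi> = "\<lambda>k. if ?long k then \<beta> else \<alpha>"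
    let ?y = "\<lambda>k. if ?long k then a else b"
      and ?\<psi> = "\<lambda>k. if ?long k then (\<lambda>v. \<alpha> v - \<beta> v) else \<beta>"
    have kill_\<beta>: "\<beta> v = 0" if "v \<in> ?F i" "a + b \<notin> ?F i" for v i
    proof -
      have "?F i = {0}"
        using plane(9) that(2) by blast
      then show ?thesis
        using that(1) fb(3) by simp
    qed
    have kill_diff: "\<alpha> v - \<beta> v = 0" if "v \<in> ?F i" "a \<notin> ?F i" for v i
    proof -
      have "\<alpha> v = \<beta> v"
        using plane(10) that by blast
      then show ?thesis
        by simp
    qed
    have cx: "compatible (arm_space V k) (arm_dir k) (arm_map V k) (?x k) (?\<phi> k)" for k
    proof (cases "?long k")
      case True
      have "compatible (arm_space V k) (arm_dir k) (arm_map V k) (a + b) \<beta>"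
      proof (rule compatI)
        show "a + b \<in> ?E"
          using ab E by (simp add: subspace_add)
        show "a + b \<in> ?F i \<or> (\<forall>v\<in>?F i. \<beta> v = 0)" for i
          using kill_\<beta> by blast
      qed (use True plane(4) in auto)
      then show ?thesis
        using True by simp
    next
      case False
      have "compatible (arm_space V k) (arm_dir k) (arm_map V k) a \<alpha>"
        by (rule compatI) (use False ab plane(1,3,7) in auto)
      then show ?thesis
        using False by simp
    qed
    have cy: "compatible (arm_space V k) (arm_dir k) (arm_map V k) (?y k) (?\<psi> k)" for k
    proof (cases "?long k")
      case True
      have "compatible (arm_space V k) (arm_dir k) (arm_map V k) a (\<lambda>v. \<alpha> v - \<beta> v)"
      proof (rule compatI)
        show "a \<in> ?F i \<or> (\<forall>v\<in>?F i. \<alpha> v - \<beta> v = 0)" for i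
          using kill_diff by blast
      qed (use True ab functional_diff[OF plane(3,4)] in auto)
      then show ?thesis
        using True by simp
    next
      case False
      have "compatible (arm_space V k) (arm_dir k) (arm_map V k) b \<beta>"
        by (rule compatI) (use False ab plane(2,4,8) in auto)
      then show ?thesis
        using False by simp
    qed
    have orth: "?\<phi> k (?y k) = 0" "?\<psi> k (?x k) = 0" and norm: "?\<phi> k (?x k) = 1" "?\<psi> k (?y k) = 1" for k
      using val plane(5,6) by (auto simp: fa fb)
    have agree: "?\<phi> k v *s ?x k + ?\<psi> k v *s ?y k =
        ?\<phi> (DV 0) v *s ?x (DV 0) + ?\<psi> (DV 0) v *s ?y (DV 0)" for k v
      by (simp add: scale_right_distrib scale_left_diff_distrib)
    note id = root_projection_is_identity[OF indec flei cx cy orth norm(1) disjI1[OF norm(2)] agree]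
    have decomp: "v = \<alpha> v *s a + \<beta> v *s b" if "v \<in> ?E" for v
    proof -
      have "v = \<beta> v *s (a + b) + (\<alpha> v - \<beta> v) *s a"
        using id(2)[OF that] by simp
      also have "\<dots> = \<alpha> v *s a + \<beta> v *s b"
        by (simp add: scale_right_distrib scale_left_diff_distrib)
      finally show ?thesis .
    qed
    have spanI: "C = span {w}" if "subspace C" "w \<in> C" "\<And>v. v \<in> C \<Longrightarrow> \<exists>c. v = c *s w" for C w
      using that span_minimal[of "{w}" C] by (auto simp: span_singleton)
    have "?K = span {a}"
    proof (rule spanI[OF K(1) plane(1)])
      fix v
      assume v: "v \<in> ?K"
      have "v = \<alpha> v *s a + \<beta> v *s b"
        using decomp v K(2) by blast
      then show "\<exists>c. v = c *s a"
        using plane(8) v by auto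
    qed
    moreover have "?K' = span {b}"
    proof (rule spanI[OF K'(1) plane(2)])
      fix v
      assume v: "v \<in> ?K'"
      have "v = \<alpha> v *s a + \<beta> v *s b"
        using decomp v K'(2) by blast
      then show "\<exists>c. v = c *s b"
        using plane(7) v by auto
    qed
    moreover have "?K \<inter> ?K' = {0}"
    proof -
      have "v = 0" if "v \<in> ?K" "v \<in> ?K'" for v
      proof -
        have "v = \<alpha> v *s a + \<beta> v *s b"
          using decomp that(1) K(2) by blast
        then show ?thesis
          using plane(7,8) that by simp
      qed
      then show ?thesis
        using subspace_0[OF K(1)] subspace_0[OF K'(1)] by blast
    qed
    moreover have diag: "?F i = span {a + b}" if "a \<notin> ?F i" "a + b \<in> ?F i" for i
    proof (rule spanI[OF F(1) that(2)])
      fix v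
      assume v: "v \<in> ?F i"
      have "\<alpha> v = \<beta> v"
        using plane(10) that(1) v by blast
      moreover have "v = \<alpha> v *s a + \<beta> v *s b"
        using decomp v F(2) by blast
      ultimately have "v = \<beta> v *s (a + b)"
        by (simp add: scale_right_distrib)
      then show "\<exists>c. v = c *s (a + b)" ..
    qed
    have "?F i = {0} \<or> ?F i = ?E \<or> ?F i = span {a + b}" for i
    proof (cases "?F i = {0}")
      case False
      then have mem: "a + b \<in> ?F i"
        using plane(9) by blast
      show ?thesis
      proof (cases "a \<in> ?F i")
        case True
        then have "b \<in> ?F i"
          using subspace_diff[OF F(1) mem] by fastforce
        have "v \<in> ?F i" if "v \<in> ?E" for v
          using decomp[OF that] subspace_add[OF F(1) subspace_scale[OF F(1) True]
              subspace_scale[OF F(1) \<open>b \<in> ?F i\<close>]] by metis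
        then show ?thesis
          using F(2) by blast
      qed (use diag mem in blast)
    qed blast
    moreover have "\<exists>i. ?F i = span {a + b}"
      using plane(11) diag by blast
    moreover have "a \<noteq> 0" "b \<noteq> 0"
      using plane(5,6) fa(3) fb(3) by auto
    ultimately have "triad ?E ?K ?K' ?F a b"
      using decomp unfolding triad_def by blast
    then show ?thesis
      using id(1) by blast
  qed
  moreover from this have "regular_arm (tail_space V 0) (tail_dir 0) (tail_map V 0)"
    by (metis long_arm_eq_tail)
  ultimately show ?thesis
    using nz E K K' F by (simp add: rooted_def shape_def root_branch_def)
qed

end

context rooted_d_inf_quiver
begin

lemma line_shape:
  assumes V: "Defs.representation Q scale V" and "is_line (vsp V (DV a))" "0 < a"
  shows "shape (vsp V (DV a)) (root_branch V a DU) (root_branch V a DU') (tail_filt V a)"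
  using assms(2,3) rep_subspace[OF V] tail_filt_subspace[OF V] subspace_0[OF rep_subspace[OF V]]
  by (simp add: shape_def root_branch_def)

text \<open>
  At the first vertex \<open>DV a\<close> where \<open>V\<close> does not vanish only the filtration of the remaining arm has to
  be respected, so any vector spans a line that splits off. The strand that starts there is an
  endomorphism of all of \<open>V\<close> when it is extended by zero, because \<open>V\<close> vanishes just before \<open>DV a\<close>.
\<close>

lemma rooted_on_tail:
  assumes indec: "indecomposable Q scale V" and flei: "FLEI Q scale V"
    and root: "vsp V (DV 0) = {0}" and nz: "vsp V (DV j0) \<noteq> {0}"
  shows "\<exists>a. rooted V a"
proof -
  have V: "Defs.representation Q scale V"
    using flei by (simp add: FLEI_def)
  define a where "a = (LEAST j. vsp V (DV j) \<noteq> {0})"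
  have a: "vsp V (DV a) \<noteq> {0}"
    unfolding a_def by (rule LeastI[of _ j0]) (rule nz)
  have below: "vsp V (DV j) = {0}" if "j < a" for j
    using not_less_Least[of j "\<lambda>j. vsp V (DV j) \<noteq> {0}"] that unfolding a_def by blast
  have a0: "0 < a"
    using a root by (cases a) auto
  let ?A = "tail_space V a" and ?d = "tail_dir a" and ?g = "tail_map V a"
  note arm = tail_arm[OF V, of a]
  obtain x where x: "x \<in> vsp V (DV a)" "x \<noteq> 0"
    using a subspace_0[OF rep_subspace[OF V]] by blast
  have "finite {C \<in> range (tail_filt V a). x \<notin> C}"
    using finite_range_tail_filt[OF flei] by simp
  moreover have "x \<notin> tail_filt V a (False, 0)"
    using x(2) by (simp add: tail_filt_0)
  then have "{C \<in> range (tail_filt V a). x \<notin> C} \<noteq> {}"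
    by blast
  ultimately have "\<exists>B\<in>{C \<in> range (tail_filt V a). x \<notin> C}.
      \<forall>C\<in>{C \<in> range (tail_filt V a). x \<notin> C}. C \<subseteq> B"
    by (rule finite_chain_has_max) (use tail_filt_chain[OF V, of _ a] in simp)
  then obtain i0 where i0: "x \<notin> tail_filt V a i0"
    and max: "\<And>i. x \<notin> tail_filt V a i \<Longrightarrow> tail_filt V a i \<subseteq> tail_filt V a i0"
    by auto
  obtain \<phi> where \<phi>: "functional \<phi>" "\<phi> x = 1" "\<And>v. v \<in> tail_filt V a i0 \<Longrightarrow> \<phi> v = 0"
    using separating_functional[OF _ i0] tail_filt_subspace[OF V] by blast
  have "x \<in> tail_filt V a i \<or> (\<forall>v\<in>tail_filt V a i. \<phi> v = 0)" for i
    using max \<phi>(3) by blast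
  then have c: "compatible ?A ?d ?g x \<phi>"
    by (rule compatible_tail[OF x(1) \<phi>(1)])
  obtain M where "ultimately_iso M ?A ?d ?g"
    using tail_ultimately_iso[OF flei] by blast
  then obtain X \<Phi> where X: "strand ?A ?d ?g X \<Phi>" "X 0 = x" "\<Phi> 0 = \<phi>"
    using strand_exists[OF arm _ c] by blast
  note Z = strand_zero[OF arm]
  define op where "op = strand_op X \<Phi> (\<lambda>j. 0) (\<lambda>j v. 0)"
  have lin: "linear_map scale (?A j) (?A j) (op j)" for j
    unfolding op_def by (rule strand_op_linear[OF arm X(1) Z])
  have idem: "op j (op j v) = op j v" if "v \<in> ?A j" for j v
    unfolding op_def using that \<phi>(2) functionalD(3)[OF \<phi>(1)]
    by (intro strand_op_idempotent[OF arm X(1) Z]) (simp_all add: X(2,3))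
  have out: "?g j (op j v) = op (Suc j) (?g j v)" if "?d j" "v \<in> ?A j" for j v
    unfolding op_def by (rule strand_op_commutes(1)[OF arm X(1) Z that])
  have into: "?g j (op (Suc j) v) = op j (?g j v)" if "\<not> ?d j" "v \<in> ?A (Suc j)" for j v
    unfolding op_def by (rule strand_op_commutes(2)[OF arm X(1) Z that])
  define e where "e c = (case c of DV j \<Rightarrow> if j < a then (\<lambda>v. 0) else op (j - a) | _ \<Rightarrow> (\<lambda>v. 0))" for c
  have e_tail: "e (DV (a + j)) = op j" for j
    by (simp add: e_def)
  have e_zero: "e c v = 0" if "\<And>j. c \<noteq> DV (a + j)" for c v
  proof (cases c)
    case (DV i)
    then have "i < a"
      using that[of "i - a"] by (cases "i < a") auto
    then show ?thesis
      using DV by (simp add: e_def)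
  qed (simp_all add: e_def)
  have tailD: "?A j = vsp V (DV (a + j))" "?d j = out (DV (Suc (a + j)))"
    "?g j = vmap V (DV (Suc (a + j)))" for j
    by (simp_all add: tail_space_def tail_dir_def tail_map_def)
  have vmap0: "vmap V c 0 = 0" if "c \<noteq> DV 0" for c
    using linear_mapD(4)[OF rep_map(1)[OF V that] rep_subspace[OF V]]
      linear_mapD(4)[OF rep_map(2)[OF V that] rep_subspace[OF V]] by blast
  have e0: "e c 0 = 0" for c
  proof (cases "\<exists>j. c = DV (a + j)")
    case True
    then obtain j where "c = DV (a + j)"
      by blast
    then show ?thesis
      using linear_mapD(4)[OF lin[of j] arm_subspace[OF arm]] by (simp add: e_tail)
  qed (use e_zero in blast)
  have id: "e c v = v" if "v \<in> vsp V c" for c v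
    using that
  proof (rule idempotent_trivial[OF indec, rotated -1])
    show "x \<in> vsp V (DV a)"
      by (rule x)
    show "e (DV a) x \<noteq> 0"
      using e_tail[of 0] x(2) by (simp add: op_def strand_op_def X \<phi>(2))
  next
    fix c
    show "linear_map scale (vsp V c) (vsp V c) (e c)"
    proof (cases "\<exists>j. c = DV (a + j)")
      case True
      then obtain j where "c = DV (a + j)"
        by blast
      then show ?thesis
        using lin[of j] by (simp add: e_tail tailD)
    next
      case False
      then have "e c = (\<lambda>v. 0)"
        using e_zero by blast
      then show ?thesis
        using subspace_0[OF rep_subspace[OF V]] by (auto simp: linear_map_def)
    qed
    show "e c (e c v) = e c v" if "v \<in> vsp V c" for v
    proof (cases "\<exists>j. c = DV (a + j)")
      case True
      then obtain j where "c = DV (a + j)"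
        by blast
      then show ?thesis
        using idem[of v j] that by (simp add: e_tail tailD)
    qed (use e_zero in metis)
  next
    fix c v
    assume c: "c \<noteq> DV 0" "out c" and v: "v \<in> vsp V (parent c)"
    show "vmap V c (e (parent c) v) = e c (vmap V c v)"
    proof (cases "\<exists>j. c = DV (Suc (a + j))")
      case True
      then obtain j where "c = DV (Suc (a + j))"
        by blast
      then show ?thesis
        using out[of j v] c(2) v e_tail[of "Suc j"] e_tail[of j] by (simp add: tailD)
    next
      case False
      have "\<exists>j<a. parent c = DV j"
      proof (cases c)
        case (DV i)
        then have "i < Suc a"
          using False by (metis le_Suc_ex not_less_eq not_less add_Suc)
        then show ?thesis
          using DV c(1) by (cases i) auto
      qed (use a0 in auto)
      then have "v = 0"
        using v below by auto
      then show ?thesis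
        using vmap0[OF c(1)] e0 by simp
    qed
  next
    fix c v
    assume c: "c \<noteq> DV 0" "\<not> out c" and v: "v \<in> vsp V c"
    show "vmap V c (e c v) = e (parent c) (vmap V c v)"
    proof (cases "\<exists>j. c = DV (Suc (a + j))")
      case True
      then obtain j where "c = DV (Suc (a + j))"
        by blast
      then show ?thesis
        using into[of j v] c(2) v e_tail[of "Suc j"] e_tail[of j] by (simp add: tailD)
    next
      case False
      have "\<exists>j<a. parent c = DV j"
      proof (cases c)
        case (DV i)
        then have "i < Suc a"
          using False by (metis le_Suc_ex not_less_eq not_less add_Suc)
        then show ?thesis
          using DV c(1) by (cases i) auto
      qed (use a0 in auto)
      then have zero: "vsp V (parent c) = {0}"
        using below by auto
      have into0: "vmap V c w \<in> {0}" if "w \<in> vsp V c" for w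
        using linear_mapD(1)[OF rep_map(2)[OF V c] rep_subspace[OF V] that] unfolding zero .
      have "e c v \<in> vsp V c"
      proof (cases "\<exists>j. c = DV (a + j)")
        case True
        then obtain j where "c = DV (a + j)"
          by blast
        then show ?thesis
          using linear_mapD(1)[OF lin[of j] arm_subspace[OF arm]] v by (simp add: e_tail tailD)
      next
        case False
        then have "e c v = 0"
          using e_zero by blast
        then show ?thesis
          using subspace_0[OF rep_subspace[OF V]] by simp
      qed
      then show ?thesis
        using into0[OF v] into0[of "e c v"] e0 by simp
    qed
  qed
  have zero: "vsp V c = {0}" if "\<And>j. c \<noteq> DV (a + j)" for c
    using id e_zero[OF that] subspace_0[OF rep_subspace[OF V]] by fastforce
  have op_id: "op j v = v" if "v \<in> ?A j" for j v
    using id[of v "DV (a + j)"] that by (simp add: e_tail tailD)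
  have "v = \<phi> v *s x" if "v \<in> vsp V (DV a)" for v
    using op_id[of v 0] that by (simp add: tailD op_def strand_op_def X)
  then have line: "is_line (vsp V (DV a))"
    by (rule is_lineI[OF rep_subspace[OF V] x])
  have "regular_arm ?A ?d ?g"
    using op_id by (intro regular_arm_if_strand_op_id[OF arm X(1) Z]) (simp add: op_def)
  then have "rooted V a"
    using a a0 below zero line_shape[OF V line a0] by (simp add: rooted_def)
  then show ?thesis ..
qed

lemma leaf_if_tail_zero:
  assumes indec: "indecomposable Q scale V" and zero: "\<And>j. vsp V (DV j) = {0}"
  shows "\<exists>k. leaf V k"
proof -
  have V: "Defs.representation Q scale V" and "\<not> zero_rep Q V"
    using indec by (simp_all add: indecomposable_def)
  then obtain k where k: "vsp V k \<noteq> {0}"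
    by (auto simp: zero_rep_def verts_eq)
  then have k': "k = DU \<or> k = DU'"
    using zero by (cases k) auto
  obtain x where x: "x \<in> vsp V k" "x \<noteq> 0"
    using k subspace_0[OF rep_subspace[OF V]] by blast
  obtain \<phi> where \<phi>: "functional \<phi>" "\<phi> x = 1"
    using separating_functional[OF subspace_single_0, of x] x(2) by blast
  note f = functionalD[OF \<phi>(1)]
  define e where "e c v = (if c = k then \<phi> v *s x else 0)" for c v
  have parent: "vsp V (parent c) = {0}" for c
    using zero by (cases c) auto
  have vmap0: "vmap V c 0 = 0" if "c \<noteq> DV 0" for c
    using linear_mapD(4)[OF rep_map(1)[OF V that] rep_subspace[OF V]]
      linear_mapD(4)[OF rep_map(2)[OF V that] rep_subspace[OF V]] by blast
  have lin: "linear_map scale (vsp V c) (vsp V c) (e c)" for c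
    using x(1) subspace_0[OF rep_subspace[OF V]] subspace_scale[OF rep_subspace[OF V]]
    by (auto simp: linear_map_def e_def f scale_left_distrib)
  have id: "e c v = v" if "v \<in> vsp V c" for c v
    using that
  proof (rule idempotent_trivial[OF indec, rotated -1])
    show "x \<in> vsp V k" "e k x \<noteq> 0"
      using x by (simp_all add: e_def \<phi>(2))
    show "linear_map scale (vsp V c) (vsp V c) (e c)" for c
      by (rule lin)
    show "e c (e c v) = e c v" for c v
      by (simp add: e_def f \<phi>(2))
  next
    fix c v
    assume c: "c \<noteq> DV 0" and v: "v \<in> vsp V (parent c)"
    then have "v = 0"
      using parent by auto
    then show "vmap V c (e (parent c) v) = e c (vmap V c v)"
      using vmap0[OF c] by (auto simp: e_def f)
  next
    fix c v
    assume c: "c \<noteq> DV 0" "\<not> out c" and v: "v \<in> vsp V c"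
    have "vmap V c w \<in> {0}" if "w \<in> vsp V c" for w
      using linear_mapD(1)[OF rep_map(2)[OF V c] rep_subspace[OF V] that] unfolding parent .
    then show "vmap V c (e c v) = e (parent c) (vmap V c v)"
      using v linear_mapD(1)[OF lin rep_subspace[OF V] v] by (simp add: e_def f)
  qed
  have "vsp V c = {0}" if "c \<noteq> k" for c
    using id[of _ c] that subspace_0[OF rep_subspace[OF V]] by (fastforce simp: e_def)
  moreover have "is_line (vsp V k)"
  proof (rule is_lineI[OF rep_subspace[OF V] x])
    show "v = \<phi> v *s x" if "v \<in> vsp V k" for v
      using id[OF that] by (simp add: e_def)
  qed
  ultimately show ?thesis
    using k' by (auto simp: leaf_def)
qed

lemma rooted_or_leaf:
  assumes "indecomposable Q scale V" "FLEI Q scale V"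
  shows "(\<exists>a. rooted V a) \<or> (\<exists>k. leaf V k)"
  using rooted_at_root[OF assms] rooted_on_tail[OF assms] leaf_if_tail_zero[OF assms(1)] by blast

end

section \<open>The rank along a chain of morphisms\<close>

text \<open>
  The point is that one \<open>n\<close> works for all \<open>j\<close>. Beyond the place where \<open>F\<close> attains its maximum on
  the region \<open>n \<ge> n0\<close>, \<open>j \<ge> J\<close>, monotonicity in both directions keeps it at the maximum, and only
  finitely many columns remain.
\<close>

lemma bounded_monotone_stabilises:
  fixes F :: "nat \<Rightarrow> nat \<Rightarrow> nat"
  assumes mono1: "\<And>n j. n0 \<le> n \<Longrightarrow> F n j \<le> F (Suc n) j"
    and mono2: "\<And>n j. n0 \<le> n \<Longrightarrow> J \<le> j \<Longrightarrow> F n j \<le> F n (Suc j)"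
    and bound: "\<And>n j. F n j \<le> B"
  shows "\<forall>\<^sub>F n in sequentially. \<forall>j. F (Suc n) j = F n j"
proof -
  have le1: "F m j \<le> F n j" if "n0 \<le> m" "m \<le> n" for m n j
    using that(2,1) by (induction rule: dec_induct) (use mono1 in \<open>auto intro: order_trans\<close>)
  have le2: "F n i \<le> F n j" if "n0 \<le> n" "J \<le> i" "i \<le> j" for n i j
    using that(3,1,2) by (induction rule: dec_induct) (use mono2 in \<open>auto intro: order_trans\<close>)
  have column: "\<forall>\<^sub>F n in sequentially. F (Suc n) j = F n j" for j
  proof -
    obtain m where m: "n0 \<le> m" "\<And>n. n0 \<le> n \<Longrightarrow> F n j \<le> F m j"
      using ex_has_greatest_nat[of "\<lambda>n. n0 \<le> n" n0 "\<lambda>n. F n j" "Suc B"] bound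
      by (auto simp: less_Suc_eq_le)
    have "F (Suc n) j = F n j" if "m \<le> n" for n
      using m(2)[of "Suc n"] m(2)[of n] le1[OF m(1), of n j] le1[OF m(1), of "Suc n" j] that m(1)
      by auto
    then show ?thesis
      unfolding eventually_sequentially by blast
  qed
  obtain m where m: "n0 \<le> fst m" "J \<le> snd m"
    "\<And>p. n0 \<le> fst p \<and> J \<le> snd p \<Longrightarrow> F (fst p) (snd p) \<le> F (fst m) (snd m)"
    using ex_has_greatest_nat[of "\<lambda>p. n0 \<le> fst p \<and> J \<le> snd p" "(n0, J)"
        "\<lambda>p. F (fst p) (snd p)" "Suc B"] bound
    by (auto simp: less_Suc_eq_le)
  have const: "F n j = F (fst m) (snd m)" if "fst m \<le> n" "snd m \<le> j" for n j
    using m(3)[of "(n, j)"] m(1,2) le1[OF m(1) that(1), of "snd m"]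
      le2[of n "snd m" j] that by auto
  have "\<forall>\<^sub>F n in sequentially. \<forall>j\<in>{..<snd m}. F (Suc n) j = F n j"
    by (intro eventually_ball_finite ballI column) simp
  moreover have "\<forall>\<^sub>F n in sequentially. fst m \<le> n"
    by (rule eventually_ge_at_top)
  ultimately show ?thesis
  proof eventually_elim
    case (elim n)
    show ?case
    proof
      show "F (Suc n) j = F n j" for j
        using elim const[of n j] const[of "Suc n" j] by (cases "j < snd m") auto
    qed
  qed
qed

context rooted_d_inf_quiver
begin

lemma isomorphismI:
  "morphism Q scale V W f \<Longrightarrow> (\<And>c. bij_betw (f (vx c)) (vsp V c) (vsp W c)) \<Longrightarrow>
    isomorphism Q scale V W f"
  by (auto simp: isomorphism_def verts_eq)

lemma nontrivial_nonzero:
  assumes "nontrivial_morphism Q scale V W f"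
  obtains c v where "v \<in> vsp V c" "f (vx c) v \<noteq> 0"
  using assms by (auto simp: nontrivial_morphism_def zero_morphism_def verts_eq)

lemma morphism_0: "Defs.representation Q scale V \<Longrightarrow> morphism Q scale V W f \<Longrightarrow> f (vx c) 0 = 0"
  using linear_mapD(4)[OF morphismD(1) rep_subspace] .

lemma morphism_mem:
  "Defs.representation Q scale V \<Longrightarrow> morphism Q scale V W f \<Longrightarrow> v \<in> vsp V c \<Longrightarrow>
    f (vx c) v \<in> vsp W c"
  using linear_mapD(1)[OF morphismD(1) rep_subspace] .

lemma bij_betw_zero:
  "Defs.representation Q scale V \<Longrightarrow> morphism Q scale V W f \<Longrightarrow> vsp V c = {0} \<Longrightarrow>
    vsp W c = {0} \<Longrightarrow> bij_betw (f (vx c)) (vsp V c) (vsp W c)"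
  using morphism_0 by (simp add: bij_betw_def)

lemma tail_hom:
  assumes "morphism Q scale V W f"
  shows "arm_hom (tail_space V a) (tail_space W a) (tail_dir a) (tail_map V a) (tail_map W a)
    (\<lambda>j. f (vx (DV (a + j))))"
  using arm_hom_shift[OF morphism_arm_hom[OF assms, of "DV 0"], of a]
  by (simp add: tail_space_def tail_dir_def tail_map_def)

lemma hom_tail_filt:
  assumes "Defs.representation Q scale V" "Defs.representation Q scale W" "morphism Q scale V W f"
  shows "f (vx (DV a)) ` tail_filt V a i \<subseteq> tail_filt W a i"
  using arm_hom_filt[OF tail_arm[OF assms(1)] tail_arm[OF assms(2)] tail_hom[OF assms(3)],
      where b = "fst i" and j = "snd i"]
  by (simp add: tail_filt_def split_def)

lemma hom_branch:
  assumes "Defs.representation Q scale V" "Defs.representation Q scale W" "morphism Q scale V W f"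
    and k: "k = DU \<or> k = DU'"
  shows "f (vx (DV 0)) ` branch V k \<subseteq> branch W k"
  using arm_hom_filt[OF rep_arm[OF assms(1), of k] rep_arm[OF assms(2)] morphism_arm_hom[OF assms(3)],
      where b = "\<not> out k" and j = "Suc 0"]
    short_arm_filt[OF assms(1) k, of "\<not> out k" 0] short_arm_filt[OF assms(2) k, of "\<not> out k" 0]
  by simp

lemma rootedD:
  assumes "rooted V a"
  shows "vsp V (DV a) \<noteq> {0}" "j < a \<Longrightarrow> vsp V (DV j) = {0}"
    "0 < a \<Longrightarrow> k = DU \<or> k = DU' \<Longrightarrow> vsp V k = {0}"
    "a = 0 \<Longrightarrow> regular_arm (arm_space V k) (arm_dir k) (arm_map V k)"
    "regular_arm (tail_space V a) (tail_dir a) (tail_map V a)"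
    "shape (vsp V (DV a)) (root_branch V a DU) (root_branch V a DU') (tail_filt V a)"
  using assms by (auto simp: rooted_def)

lemma rooted_tail_edge:
  assumes "rooted V a" "a \<le> j"
  shows "out (DV (Suc j)) \<Longrightarrow> v \<in> vsp V (DV (Suc j)) \<Longrightarrow> \<exists>u\<in>vsp V (DV j). v = vmap V (DV (Suc j)) u"
    "\<not> out (DV (Suc j)) \<Longrightarrow> v \<in> vsp V (DV (Suc j)) \<Longrightarrow> vmap V (DV (Suc j)) v = 0 \<Longrightarrow> v = 0"
  using regular_armD[OF rootedD(5)[OF assms(1)], of "j - a" v] assms(2)
  by (simp_all add: tail_space_def tail_dir_def tail_map_def)

lemma rooted_short_edge:
  assumes "rooted V 0" "k = DU \<or> k = DU'"
  shows "out k \<Longrightarrow> v \<in> vsp V k \<Longrightarrow> \<exists>u\<in>vsp V (DV 0). v = vmap V k u"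
    "\<not> out k \<Longrightarrow> v \<in> vsp V k \<Longrightarrow> vmap V k v = 0 \<Longrightarrow> v = 0"
  using regular_armD[OF rootedD(4)[OF assms(1) refl, of k], of 0 v] assms(2) by auto

lemma rooted_regular_tail:
  assumes "rooted V a" "a \<le> m"
  shows "regular_arm (tail_space V m) (tail_dir m) (tail_map V m)"
  unfolding regular_arm_def
proof
  fix j
  have shift: "tail_space V a (m - a + j) = tail_space V m j"
    "tail_space V a (Suc (m - a + j)) = tail_space V m (Suc j)"
    "tail_dir a (m - a + j) = tail_dir m j" "tail_map V a (m - a + j) = tail_map V m j"
    using assms(2) by (simp_all add: tail_space_def tail_dir_def tail_map_def)
  show "if tail_dir m j then tail_map V m j ` tail_space V m j = tail_space V m (Suc j)
    else \<forall>v\<in>tail_space V m (Suc j). tail_map V m j v = 0 \<longrightarrow> v = 0"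
    using spec[OF rootedD(5)[OF assms(1), unfolded regular_arm_def], of "m - a + j"]
    unfolding shift .
qed

context
  fixes V W :: "('a, 'b, 'v) rep" and f :: "'a \<Rightarrow> 'v \<Rightarrow> 'v"
  assumes V: "Defs.representation Q scale V" and W: "Defs.representation Q scale W"
    and f: "morphism Q scale V W f"
begin

text \<open>
  Before the larger root one of the two representations vanishes; beyond it, regularity
  propagates vanishing.
\<close>

lemma rooted_hom_nonzero:
  assumes Va: "rooted V a" and Wb: "rooted W b" and nz: "v \<in> vsp V c" "f (vx c) v \<noteq> 0"
  shows "\<exists>v\<in>vsp V (DV (max a b)). f (vx (DV (max a b))) v \<noteq> 0"
proof (rule ccontr)
  let ?m = "max a b"
  assume "\<not> ?thesis"
  then have zero: "f (vx (DV ?m)) v = 0" if "v \<in> vsp V (DV ?m)" for v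
    using that by blast
  have trivial: "f (vx c) v = 0" if "v \<in> vsp V c" "vsp V c = {0} \<or> vsp W c = {0}" for c v
    using that(2)
  proof
    assume "vsp V c = {0}"
    then show ?thesis
      using that(1) morphism_0[OF V f] by simp
  next
    assume "vsp W c = {0}"
    then show ?thesis
      using morphism_mem[OF V f that(1)] by simp
  qed
  have tail: "f (vx (DV j)) v = 0" if v: "v \<in> vsp V (DV j)" for j v
  proof (cases "?m \<le> j")
    case True
    then show ?thesis
      using regular_arm_hom_vanishes[OF tail_arm[OF V] tail_arm[OF W] tail_hom[OF f]
          rooted_regular_tail[OF Va] rooted_regular_tail[OF Wb], of ?m v "j - ?m"] v zero
      by (simp add: tail_space_def)
  next
    case False
    then have "j < a \<or> j < b"
      by auto
    then show ?thesis
      using trivial[OF v] rootedD(2)[OF Va] rootedD(2)[OF Wb] by blast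
  qed
  have short: "f (vx k) v = 0" if k: "k = DU \<or> k = DU'" and v: "v \<in> vsp V k" for k v
  proof (cases "a = 0 \<and> b = 0")
    case True
    then have reg: "regular_arm (arm_space V k) (arm_dir k) (arm_map V k)"
      "regular_arm (arm_space W k) (arm_dir k) (arm_map W k)"
      using rootedD(4)[OF Va] rootedD(4)[OF Wb] by auto
    have "f (vx (arm_vertex k (Suc 0))) v = 0"
    proof (rule regular_arm_hom_vanishes[OF rep_arm[OF V] rep_arm[OF W] morphism_arm_hom[OF f] reg])
      show "f (vx (arm_vertex k 0)) w = 0" if "w \<in> arm_space V k 0" for w
        using tail[of w 0] that by simp
      show "v \<in> arm_space V k (Suc 0)"
        using k v by auto
    qed
    then show ?thesis
      using k by auto
  next
    case False
    then show ?thesis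
      using trivial[OF v] rootedD(3)[OF Va _ k] rootedD(3)[OF Wb _ k] by blast
  qed
  show False
    using nz tail short by (cases c) auto
qed

text \<open>
  If the two roots differ, then the edge just before the larger one has a determined direction,
  since the spaces of one of the two representations vanish on its other side.
\<close>

lemma rooted_hom_to_later:
  assumes Va: "rooted V a" and Wb: "rooted W b" and "a < b"
    and v: "v \<in> vsp V (DV b)" "f (vx (DV b)) v \<noteq> 0"
  shows "\<not> out (DV b)"
proof
  assume out: "out (DV b)"
  obtain j where j: "b = Suc j" "a \<le> j"
    using assms(3) by (cases b) auto
  obtain u where u: "u \<in> vsp V (DV j)" "v = vmap V (DV b) u"
    using rooted_tail_edge(1)[OF Va j(2)] out v(1) j by blast
  have "f (vx (DV b)) v = vmap W (DV b) (f (vx (DV j)) u)"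
    using morphismD(2)[OF f, of "DV b" u] out u j by simp
  also have "f (vx (DV j)) u = 0"
    using morphism_mem[OF V f u(1)] rootedD(2)[OF Wb, of j] j by simp
  also have "vmap W (DV b) 0 = 0"
    using linear_mapD(4)[OF rep_map(1)[OF W _ out] rep_subspace[OF W]] j by simp
  finally show False
    using v(2) by simp
qed

lemma rooted_hom_to_earlier:
  assumes Va: "rooted V a" and Wb: "rooted W b" and "b < a"
    and v: "v \<in> vsp V (DV a)" "f (vx (DV a)) v \<noteq> 0"
  shows "out (DV a)"
proof (rule ccontr)
  assume out: "\<not> out (DV a)"
  obtain j where j: "a = Suc j" "b \<le> j"
    using assms(3) by (cases a) auto
  have "vmap V (DV a) v \<in> vsp V (DV j)"
    using linear_mapD(1)[OF rep_map(2)[OF V _ out] rep_subspace[OF V] v(1)] j by simp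
  then have "vmap V (DV a) v = 0"
    using rootedD(2)[OF Va, of j] j by simp
  then have "vmap W (DV a) (f (vx (DV a)) v) = 0"
    using morphismD(3)[OF f, of "DV a" v] out v(1) j morphism_0[OF V f] by simp
  then show False
    using rooted_tail_edge(2)[OF Wb j(2)] out morphism_mem[OF V f v(1)] v(2) j by simp
qed

end

definition root_stage :: "('a, 'b, 'v) rep \<Rightarrow> nat \<Rightarrow> nat" where
  "root_stage V a = stage (vsp V (DV a)) (root_branch V a DU) (root_branch V a DU')"

text \<open>
  Along a chain of morphisms, the roots whose preceding edge points outwards come first, in descending order, then \<open>DV 0\<close>,
  refined by the stage, and then the finitely many remaining ones in ascending order.
\<close>

definition rank :: "('a, 'b, 'v) rep \<Rightarrow> nat \<Rightarrow> nat" where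
  "rank V a =
     (if a = 0 then N + 3 - root_stage V 0 else if out (DV a) then N + 3 + a else N - a)"

lemma root_branch_subset:
  assumes "Defs.representation Q scale V" "Defs.representation Q scale W" "morphism Q scale V W f"
    and "k = DU \<or> k = DU'"
  shows "f (vx (DV a)) ` root_branch V a k \<subseteq> root_branch W a k"
  using hom_branch[OF assms] morphism_0[OF assms(1,3)] by (auto simp: root_branch_def)

lemma rank_decreases:
  assumes V: "Defs.representation Q scale V" and W: "Defs.representation Q scale W"
    and f: "morphism Q scale V W f" and Va: "rooted V a" and Wb: "rooted W b"
    and nz: "v \<in> vsp V c" "f (vx c) v \<noteq> 0"
  shows "rank W b \<le> rank V a"
    and "rank W b = rank V a \<Longrightarrow> a = b \<and> root_stage V a = root_stage W b"
proof -
  obtain x where x: "x \<in> vsp V (DV (max a b))" "f (vx (DV (max a b))) x \<noteq> 0"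
    using rooted_hom_nonzero[OF V W f Va Wb nz] by blast
  have N: "a \<le> N" if "\<not> out (DV a)" "0 < a" for a
  proof -
    have "\<not> N \<le> a - 1"
      using ultimately_out[of "a - 1"] that by auto
    then show ?thesis
      by linarith
  qed
  have stage: "root_stage V a \<le> 2" for V and a
    by (simp add: root_stage_def stage_le_2)
  have "rank W b \<le> rank V a \<and> (rank W b = rank V a \<longrightarrow> a = b \<and> root_stage V a = root_stage W b)"
  proof (cases a b rule: linorder_cases)
    case less
    then have "\<not> out (DV b)"
      using rooted_hom_to_later[OF V W f Va Wb] x by simp
    then have "rank W b = N - b" "b \<le> N"
      using less N[of b] by (simp_all add: rank_def)
    then show ?thesis
      using less stage[of V 0] N[of a] by (auto simp: rank_def)
  next
    case greater
    then have "out (DV a)"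
      using rooted_hom_to_earlier[OF V W f Va Wb] x by simp
    then show ?thesis
      using greater by (auto simp: rank_def)
  next
    case equal
    have "root_stage V a \<le> root_stage W a"
      unfolding root_stage_def
      using x equal shape_hom_stage[OF rootedD(6)[OF Va] rootedD(6)[OF Wb[folded equal]] morphismD(1)[OF f]
          root_branch_subset[OF V W f] root_branch_subset[OF V W f] hom_tail_filt[OF V W f]]
      by simp
    moreover have "root_stage V a = 0" "root_stage W a = 0" if "0 < a"
      using that by (simp_all add: root_stage_def root_branch_def stage_def)
    ultimately show ?thesis
      using equal stage[of V a] stage[of W a] by (cases "a = 0") (auto simp: rank_def)
  qed
  then show "rank W b \<le> rank V a"
    and "rank W b = rank V a \<Longrightarrow> a = b \<and> root_stage V a = root_stage W b"
    by auto
qed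

definition root_weight :: "('a, 'b, 'v) rep \<Rightarrow> nat \<Rightarrow> bool \<times> nat \<Rightarrow> nat" where
  "root_weight V a i = weight (vsp V (DV a)) (tail_filt V a i)"

lemma root_weight_hom:
  assumes V: "Defs.representation Q scale V" and W: "Defs.representation Q scale W"
    and f: "morphism Q scale V W f" and Va: "rooted V a" and Wa: "rooted W a"
    and stage: "root_stage V a = root_stage W a"
    and nz: "v \<in> vsp V c" "f (vx c) v \<noteq> 0"
  shows "root_weight V a i \<le> root_weight W a i"
    and "(\<And>i. root_weight V a i = root_weight W a i) \<Longrightarrow> isomorphism Q scale V W f"
proof -
  obtain x where x: "x \<in> vsp V (DV a)" "f (vx (DV a)) x \<noteq> 0"
    using rooted_hom_nonzero[OF V W f Va Wa nz] by auto
  note hom = rootedD(6)[OF Va] rootedD(6)[OF Wa] morphismD(1)[OF f]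
    root_branch_subset[OF V W f disjI1[OF refl]] root_branch_subset[OF V W f disjI2[OF refl]]
    hom_tail_filt[OF V W f] x
  show "root_weight V a i \<le> root_weight W a i"
    unfolding root_weight_def by (rule shape_hom_weight[OF hom stage[unfolded root_stage_def]])
  assume weights: "\<And>i. root_weight V a i = root_weight W a i"
  have iso: "bij_betw (f (vx (DV a))) (vsp V (DV a)) (vsp W (DV a))"
    "f (vx (DV a)) ` root_branch V a DU = root_branch W a DU"
    "f (vx (DV a)) ` root_branch V a DU' = root_branch W a DU'"
    "\<And>i. f (vx (DV a)) ` tail_filt V a i = tail_filt W a i"
    using shape_hom_iso[OF hom stage[unfolded root_stage_def] weights[unfolded root_weight_def]]
    by blast+
  have from_root: "bij_betw (f (vx (DV (a + j)))) (tail_space V a j) (tail_space W a j)" for j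
  proof (rule regular_arm_hom_bij[OF tail_arm[OF V] tail_arm[OF W] tail_hom[OF f]
        rootedD(5)[OF Va] rootedD(5)[OF Wa]])
    show "bij_betw (f (vx (DV (a + 0)))) (tail_space V a 0) (tail_space W a 0)"
      using iso(1) by (simp add: tail_space_def)
    show "f (vx (DV (a + 0))) ` arm_filt b i (tail_space V a) (tail_dir a) (tail_map V a) =
        arm_filt b i (tail_space W a) (tail_dir a) (tail_map W a)" for b i
      using iso(4)[of "(b, i)"] by (simp add: tail_filt_def)
  qed
  have tail: "bij_betw (f (vx (DV j))) (vsp V (DV j)) (vsp W (DV j))" if "a \<le> j" for j
  proof -
    have "a + (j - a) = j"
      using that by simp
    then show ?thesis
      using from_root[of "j - a"]
      by (simp add: tail_space_def)
  qed
  have short: "bij_betw (f (vx k)) (vsp V k) (vsp W k)" if k: "k = DU \<or> k = DU'" for k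
  proof (cases "a = 0")
    case True
    have E: "f (vx (DV 0)) ` vsp V (DV 0) = vsp W (DV 0)"
      using iso(1) True by (simp add: bij_betw_def)
    have branch: "f (vx (DV 0)) ` branch V k = branch W k"
      using iso(2,3) k True by (auto simp: root_branch_def)
    have "bij_betw (f (vx (arm_vertex k (Suc 0)))) (arm_space V k (Suc 0)) (arm_space W k (Suc 0))"
    proof (rule regular_arm_hom_bij[OF rep_arm[OF V] rep_arm[OF W] morphism_arm_hom[OF f]
          rootedD(4)[OF Va True] rootedD(4)[OF Wa True]])
      show "bij_betw (f (vx (arm_vertex k 0))) (arm_space V k 0) (arm_space W k 0)"
        using iso(1) True by simp
      show "f (vx (arm_vertex k 0)) ` arm_filt b i (arm_space V k) (arm_dir k) (arm_map V k) =
          arm_filt b i (arm_space W k) (arm_dir k) (arm_map W k)" for b i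
        using E branch morphism_0[OF V f]
        by (cases i) (simp_all add: short_arm_filt[OF V k] short_arm_filt[OF W k]
            del: arm_filt.simps(2))
    qed
    then show ?thesis
      using k by auto
  next
    case False
    then show ?thesis
      using rootedD(3)[OF Va _ k] rootedD(3)[OF Wa _ k] by (intro bij_betw_zero[OF V f]) auto
  qed
  have "bij_betw (f (vx c)) (vsp V c) (vsp W c)" for c
  proof (cases c)
    case (DV j)
    then show ?thesis
      using tail[of j] bij_betw_zero[OF V f] rootedD(2)[OF Va, of j] rootedD(2)[OF Wa, of j]
      by (cases "a \<le> j") auto
  qed (use short in auto)
  then show "isomorphism Q scale V W f"
    by (rule isomorphismI[OF f])
qed

lemma leaf_hom_iso:
  assumes V: "Defs.representation Q scale V" and f: "morphism Q scale V W f"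
    and Vk: "leaf V k" and Wk: "leaf W k" and nz: "v \<in> vsp V k" "f (vx k) v \<noteq> 0"
  shows "isomorphism Q scale V W f"
proof (rule isomorphismI[OF f])
  show "bij_betw (f (vx c)) (vsp V c) (vsp W c)" for c
  proof (cases "c = k")
    case True
    then show ?thesis
      using line_hom_bij[OF rep_subspace[OF V] _ _ morphismD(1)[OF f] nz] Vk Wk
      by (simp add: leaf_def)
  next
    case False
    then show ?thesis
      using bij_betw_zero[OF V f] Vk Wk by (simp add: leaf_def)
  qed
qed

text \<open>
  The simple representation at a leaf is injective if the leaf is a source and projective if it
  is a sink. In the first case no nontrivial morphism leaves it, in the second case none arrives.
\<close>

lemma leaf_not_inside_chain:
  assumes U: "indecomposable Q scale U" "FLEI Q scale U"
    and V: "indecomposable Q scale V" "FLEI Q scale V"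
    and W: "indecomposable Q scale W" "FLEI Q scale W"
    and f: "nontrivial_morphism Q scale U V f" and g: "nontrivial_morphism Q scale V W g"
  shows "\<not> leaf V k"
proof
  assume leaf: "leaf V k"
  then have k: "k = DU \<or> k = DU'" and zero: "\<And>c. c \<noteq> k \<Longrightarrow> vsp V c = {0}"
    by (auto simp: leaf_def)
  have rep: "Defs.representation Q scale U" "Defs.representation Q scale V" "Defs.representation Q scale W"
    using U V W by (simp_all add: indecomposable_def)
  have f': "morphism Q scale U V f" "\<not> isomorphism Q scale U V f"
    and g': "morphism Q scale V W g" "\<not> isomorphism Q scale V W g"
    using f g by (simp_all add: nontrivial_morphism_def)
  have kp: "k \<noteq> DV 0" "parent k = DV 0"
    using k by auto
  have root: "vsp V (DV 0) = {0}"
    using zero[of "DV 0"] kp(1) by simp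
  show False
  proof (cases "out k")
    case True
    obtain c v where v: "v \<in> vsp U c" "f (vx c) v \<noteq> 0"
      using nontrivial_nonzero[OF f] .
    then have c: "c = k"
      using morphism_mem[OF rep(1) f'(1) v(1)] zero by auto
    have "v \<noteq> 0"
      using v morphism_0[OF rep(1) f'(1)] by auto
    have "\<not> leaf U l" for l
      using leaf_hom_iso[OF rep(1) f'(1) _ leaf] f'(2) v \<open>v \<noteq> 0\<close> unfolding c
      by (metis leaf_def singletonD)
    then obtain a where a: "rooted U a"
      using rooted_or_leaf[OF U] by blast
    then have "a = 0"
      using rootedD(3)[OF a _ k] v(1) \<open>v \<noteq> 0\<close> unfolding c by (cases "a = 0") auto
    then obtain u where u: "u \<in> vsp U (DV 0)" "v = vmap U k u"
      using rooted_short_edge(1)[of U k] a k True v(1) unfolding c by blast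
    have "f (vx k) v = vmap V k (f (vx (DV 0)) u)"
      using morphismD(2)[OF f'(1) kp(1) True, of u] u kp(2) by simp
    also have "f (vx (DV 0)) u = 0"
      using morphism_mem[OF rep(1) f'(1) u(1)] root by simp
    also have "vmap V k 0 = 0"
      by (rule linear_mapD(4)[OF rep_map(1)[OF rep(2) kp(1) True] rep_subspace[OF rep(2)]])
    finally show False
      using v(2) c by simp
  next
    case False
    obtain c v where v: "v \<in> vsp V c" "g (vx c) v \<noteq> 0"
      using nontrivial_nonzero[OF g] .
    have "v \<noteq> 0"
      using v(2) morphism_0[OF rep(2) g'(1)] by auto
    then have c: "c = k"
      using zero[of c] v(1) by auto
    have mem: "g (vx k) v \<in> vsp W k"
      using morphism_mem[OF rep(2) g'(1) v(1)] unfolding c .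
    have "\<not> leaf W l" for l
      using leaf_hom_iso[OF rep(2) g'(1) leaf] g'(2) v mem unfolding c
      by (metis leaf_def singletonD)
    then obtain a where a: "rooted W a"
      using rooted_or_leaf[OF W] by blast
    then have a0: "a = 0"
      using rootedD(3)[OF a _ k] mem v(2) unfolding c by (cases "a = 0") auto
    have "vmap V k v \<in> vsp V (DV 0)"
      using linear_mapD(1)[OF rep_map(2)[OF rep(2) kp(1) False] rep_subspace[OF rep(2)]] v(1)
      unfolding c kp(2) .
    then have "vmap V k v = 0"
      using root by simp
    then have "vmap W k (g (vx k) v) = 0"
      using morphismD(3)[OF g'(1) kp(1) False, of v] v(1) morphism_0[OF rep(2) g'(1)]
      unfolding c by simp
    then have "g (vx k) v = 0"
      using rooted_short_edge(2)[OF a[unfolded a0] k False mem] by blast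
    then show False
      using v(2) unfolding c by blast
  qed
qed

lemma root_weight_le_2: "root_weight V a i \<le> 2"
  by (simp add: root_weight_def weight_le_2)

text \<open>
  Beyond \<open>N\<close> the long arm points outwards, so that the members coming from full spaces are constant
  there, while those coming from zero spaces grow all along the arm.
\<close>

lemma root_weight_mono:
  assumes V: "Defs.representation Q scale V"
  shows "root_weight V a (False, j) \<le> root_weight V a (False, Suc j)"
    and "N \<le> j \<Longrightarrow> root_weight V a (True, j) \<le> root_weight V a (True, Suc j)"
proof -
  note arm = tail_arm[OF V, of a]
  show "root_weight V a (False, j) \<le> root_weight V a (False, Suc j)"
    unfolding root_weight_def
  proof (rule weight_mono)
    show "tail_filt V a (False, j) \<subseteq> tail_filt V a (False, Suc j)"
      unfolding tail_filt_def prod.case by (rule arm_filt_mono[OF arm])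
  qed (use tail_filt_subspace[OF V] in auto)
  have dir: "\<forall>j\<ge>N. tail_dir a j"
    by (simp add: tail_dir_def ultimately_out)
  have "tail_filt V a (True, i) = tail_filt V a (True, N)" if "N \<le> i" for i
    unfolding tail_filt_def prod.case by (rule arm_filt_True_const[OF arm dir that])
  from this[of j] this[of "Suc j"]
  show "root_weight V a (True, j) \<le> root_weight V a (True, Suc j)" if "N \<le> j"
    using that by (simp add: root_weight_def)
qed

lemma no_infinite_chain:
  assumes W: "\<And>n. FLEI Q scale (W n)" "\<And>n. indecomposable Q scale (W n)"
    and f: "\<And>n. nontrivial_morphism Q scale (W n) (W (Suc n)) (f n)"
  shows False
proof -
  have rep: "Defs.representation Q scale (W n)" for n
    using W(1) by (simp add: FLEI_def)
  have mor: "morphism Q scale (W n) (W (Suc n)) (f n)"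
    and not_iso: "\<not> isomorphism Q scale (W n) (W (Suc n)) (f n)" for n
    using f by (simp_all add: nontrivial_morphism_def)
  \<comment> \<open>\<open>W 0\<close> is dropped since it may be concentrated at a short end.\<close>
  have "\<exists>a. rooted (W (Suc n)) a" for n
    using rooted_or_leaf[OF W(2,1)] leaf_not_inside_chain[OF W(2,1) W(2,1) W(2,1) f f] by blast
  then obtain r where "\<And>n. rooted (W (Suc n)) (r n)"
    by metis
  define R where "R n = rank (W (Suc n)) (r n)" for n
  have r: "rooted (W (Suc n)) (r n)" for n
    by fact
  have dec: "R (Suc n) \<le> R n"
    and eq: "R (Suc n) = R n \<Longrightarrow>
      r n = r (Suc n) \<and> root_stage (W (Suc n)) (r n) = root_stage (W (Suc (Suc n))) (r (Suc n))" for n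
  proof -
    obtain c v where v: "v \<in> vsp (W (Suc n)) c" "f (Suc n) (vx c) v \<noteq> 0"
      using nontrivial_nonzero[OF f] .
    note rank = rank_decreases[OF rep rep mor r r v]
    show "R (Suc n) \<le> R n" "R (Suc n) = R n \<Longrightarrow>
      r n = r (Suc n) \<and> root_stage (W (Suc n)) (r n) = root_stage (W (Suc (Suc n))) (r (Suc n))"
      unfolding R_def using rank by auto
  qed
  obtain n0 where n0: "\<And>n. R n0 \<le> R n"
    using ex_has_least_nat[of "\<lambda>n. True" 0 R] by auto
  have least: "R n = R n0" if "n0 \<le> n" for n
    using that
  proof (induction rule: dec_induct)
    case (step m)
    then show ?case
      using dec[of m] n0[of "Suc m"] by simp
  qed simp
  have const: "R (Suc n) = R n" if "n0 \<le> n" for n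
    using least[of n] least[of "Suc n"] that by simp
  define a where "a = r n0"
  have ra: "r n = a" if "n0 \<le> n" for n
    using that
  proof (induction rule: dec_induct)
    case (step m)
    then show ?case
      using eq[OF const[of m]] by simp
  qed (simp add: a_def)
  have rooted: "rooted (W (Suc n)) a" if "n0 \<le> n" for n
    using r[of n] ra[OF that] by simp
  have stage: "root_stage (W (Suc n)) a = root_stage (W (Suc (Suc n))) a" if "n0 \<le> n" for n
    using eq[OF const[OF that]] ra[OF that] by auto
  have weight: "root_weight (W (Suc n)) a i \<le> root_weight (W (Suc (Suc n))) a i"
    and iso: "(\<And>i. root_weight (W (Suc n)) a i = root_weight (W (Suc (Suc n))) a i) \<Longrightarrow> False"
    if n: "n0 \<le> n" for n i
  proof -
    obtain c v where v: "v \<in> vsp (W (Suc n)) c" "f (Suc n) (vx c) v \<noteq> 0"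
      using nontrivial_nonzero[OF f] .
    note hom = root_weight_hom[OF rep rep mor rooted[OF n] rooted[OF le_SucI[OF n]] stage[OF n] v]
    show "root_weight (W (Suc n)) a i \<le> root_weight (W (Suc (Suc n))) a i"
      by (rule hom(1))
    show False if "\<And>i. root_weight (W (Suc n)) a i = root_weight (W (Suc (Suc n))) a i"
      using hom(2)[OF that] not_iso by blast
  qed
  have "\<forall>\<^sub>F n in sequentially. \<forall>j. root_weight (W (Suc (Suc n))) a (b, j) = root_weight (W (Suc n)) a (b, j)" for b
  proof (rule bounded_monotone_stabilises[of n0 _ N 2])
    show "root_weight (W (Suc n)) a (b, j) \<le> root_weight (W (Suc n)) a (b, Suc j)" if "N \<le> j" for n j
      using root_weight_mono[OF rep] that by (cases b) auto
  qed (use weight root_weight_le_2 in auto)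
  from this[of True] this[of False]
  have "\<forall>\<^sub>F n in sequentially. \<forall>i. root_weight (W (Suc (Suc n))) a i = root_weight (W (Suc n)) a i"
  proof eventually_elim
    case (elim n)
    then show ?case
      by (metis (full_types) surj_pair)
  qed
  then obtain m where m: "\<And>n. m \<le> n \<Longrightarrow> \<forall>i. root_weight (W (Suc (Suc n))) a i = root_weight (W (Suc n)) a i"
    unfolding eventually_sequentially by blast
  show False
  proof (rule iso[of "max m n0"])
    show "root_weight (W (Suc (max m n0))) a i = root_weight (W (Suc (Suc (max m n0)))) a i" for i
      using m[of "max m n0"] by (simp del: split_paired_All)
  qed simp
qed

end

section \<open>Coordinates on a quiver of type \<open>D_\<infinity>\<close>\<close>

lemma parent_edge_inj: "inj_on (\<lambda>c. {parent c, c}) {c. c \<noteq> DV 0}"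
proof (rule inj_onI)
  fix c c'
  assume *: "c \<in> {c. c \<noteq> DV 0}" "c' \<in> {c. c \<noteq> DV 0}" "{parent c, c} = {parent c', c'}"
  show "c = c'"
    using * by (cases c rule: parent.cases; cases c' rule: parent.cases) (auto simp: doubleton_eq_iff)
qed

lemma parent_edge_image: "(\<lambda>c. {parent c, c}) ` {c. c \<noteq> DV 0} = d_inf_edges"
proof
  show "(\<lambda>c. {parent c, c}) ` {c. c \<noteq> DV 0} \<subseteq> d_inf_edges"
  proof
    fix S
    assume "S \<in> (\<lambda>c. {parent c, c}) ` {c. c \<noteq> DV 0}"
    then obtain c where c: "c \<noteq> DV 0" "S = {parent c, c}"
      by blast
    show "S \<in> d_inf_edges"
    proof (cases c)
      case (DV i)
      then obtain j where "i = Suc j"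
        using c(1) by (cases i) auto
      then show ?thesis
        using DV c(2) by (auto simp: d_inf_edges_def)
    qed (use c(2) in \<open>auto simp: d_inf_edges_def\<close>)
  qed
  show "d_inf_edges \<subseteq> (\<lambda>c. {parent c, c}) ` {c. c \<noteq> DV 0}"
  proof
    fix S
    assume "S \<in> d_inf_edges"
    then consider "S = {parent DU, DU}" | "S = {parent DU', DU'}"
      | j where "S = {parent (DV (Suc j)), DV (Suc j)}"
      by (auto simp: d_inf_edges_def)
    then show "S \<in> (\<lambda>c. {parent c, c}) ` {c. c \<noteq> DV 0}"
      by cases (auto intro: image_eqI[of _ _ DU] image_eqI[of _ _ DU'] image_eqI[of _ _ "DV (Suc j)" for j])
  qed
qed

text \<open>
  The bound \<open>N\<close> comes from the journey that starts at the branching vertex and follows the long arm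
  to infinity: its inward arrows are finite in number.
\<close>

lemma rooted_d_inf_quiver_exists:
  fixes Q :: "('a, 'b) pre_digraph" and s :: "'k::field \<Rightarrow> 'v::ab_group_add \<Rightarrow> 'v"
  assumes vs: "vector_space s" and wf: "wf_digraph Q"
    and type: "type_D_inf Q" and outward: "eventually_outward Q"
  shows "\<exists>vx ar out N. rooted_d_inf_quiver s Q vx ar out N"
proof -
  interpret wf_digraph Q by fact
  obtain \<phi> :: "'a \<Rightarrow> d_inf_vertex" where \<phi>: "bij_betw \<phi> (verts Q) UNIV"
    and edges: "bij_betw (\<lambda>a. {\<phi> (tail Q a), \<phi> (head Q a)}) (arcs Q) d_inf_edges"
    using type by (auto simp: type_D_inf_def)
  define vx where "vx = inv_into (verts Q) \<phi>"
  have vx_bij: "bij_betw vx UNIV (verts Q)"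
    unfolding vx_def by (rule bij_betw_inv_into[OF \<phi>])
  have vx_\<phi>: "vx (\<phi> i) = i" if "i \<in> verts Q" for i
    unfolding vx_def using \<phi> that by (simp add: bij_betw_inv_into_left)
  have \<phi>_vx: "\<phi> (vx c) = c" for c
    unfolding vx_def using \<phi> by (simp add: bij_betw_inv_into_right)
  let ?edge = "\<lambda>a. {\<phi> (tail Q a), \<phi> (head Q a)}"
  define ar where "ar c = inv_into (arcs Q) ?edge {parent c, c}" for c
  have "bij_betw (\<lambda>c. {parent c, c}) {c. c \<noteq> DV 0} d_inf_edges"
    using parent_edge_inj parent_edge_image by (simp add: bij_betw_def)
  from bij_betw_trans[OF this bij_betw_inv_into[OF edges]]
  have ar_bij: "bij_betw ar {c. c \<noteq> DV 0} (arcs Q)"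
    by (simp add: comp_def ar_def[abs_def])
  have ends: "?edge (ar c) = {parent c, c}" if "c \<noteq> DV 0" for c
  proof -
    have "{parent c, c} \<in> d_inf_edges"
      using that parent_edge_image by blast
    then show ?thesis
      unfolding ar_def by (rule bij_betw_inv_into_right[OF edges])
  qed
  have arc: "ar c \<in> arcs Q" if "c \<noteq> DV 0" for c
    using ar_bij that by (auto simp: bij_betw_def)
  define out where "out c \<longleftrightarrow> head Q (ar c) = vx c" for c
  have directed: "tail Q (ar c) = vx (parent c) \<and> head Q (ar c) = vx c \<or>
      tail Q (ar c) = vx c \<and> head Q (ar c) = vx (parent c)" if "c \<noteq> DV 0" for c
    using ends[OF that] vx_\<phi>[OF tail_in_verts[OF arc[OF that]]] vx_\<phi>[OF head_in_verts[OF arc[OF that]]]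
    by (auto simp: doubleton_eq_iff)
  have parent_neq: "parent c \<noteq> c" if "c \<noteq> DV 0" for c
    using that by (cases c rule: parent.cases) auto
  have vx_inj: "inj vx"
    using vx_bij by (simp add: bij_betw_def)
  define p where "p j = vx (DV j)" for j
  define e where "e j = ar (DV (Suc j))" for j
  have "journey Q \<infinity> p e"
  proof -
    have "inj p"
      using vx_inj by (auto simp: p_def inj_on_def)
    moreover have "inj e"
      using ar_bij by (auto simp: e_def bij_betw_def inj_on_def)
    moreover have "p j \<in> verts Q" "e j \<in> arcs Q" for j
      using vx_bij arc by (auto simp: p_def e_def bij_betw_def)
    moreover have "tail Q (e j) = p j \<and> head Q (e j) = p (Suc j) \<or>
        tail Q (e j) = p (Suc j) \<and> head Q (e j) = p j" for j
      using directed[of "DV (Suc j)"] by (auto simp: p_def e_def)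
    ultimately show ?thesis
      by (simp add: journey_def)
  qed
  then have "finite (inward_arrows Q \<infinity> p e)"
    using outward by (simp add: eventually_outward_def)
  moreover have "e ` {j. \<not> out (DV (Suc j))} \<subseteq> inward_arrows Q \<infinity> p e"
  proof
    fix a
    assume "a \<in> e ` {j. \<not> out (DV (Suc j))}"
    then obtain j where j: "a = e j" "\<not> out (DV (Suc j))"
      by blast
    then have "tail Q (e j) = p (Suc j) \<and> head Q (e j) = p j"
      using directed[of "DV (Suc j)"] by (auto simp: p_def e_def out_def)
    then show "a \<in> inward_arrows Q \<infinity> p e"
      using j(1) by (auto simp: inward_arrows_def)
  qed
  moreover have "inj e"
    using ar_bij by (auto simp: e_def bij_betw_def inj_on_def)
  ultimately have "finite {j. \<not> out (DV (Suc j))}"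
    by (meson finite_subset finite_imageD inj_on_subset subset_UNIV)
  then obtain N where N: "\<forall>j\<in>{j. \<not> out (DV (Suc j))}. j < N"
    unfolding finite_nat_set_iff_bounded by (rule exE)
  have "rooted_d_inf_quiver s Q vx ar out N"
  proof (intro rooted_d_inf_quiver.intro ambient_space.intro rooted_d_inf_quiver_axioms.intro vs wf)
    show "verts Q = range vx" "inj vx" "arcs Q = ar ` {c. c \<noteq> DV 0}" "inj_on ar {c. c \<noteq> DV 0}"
      using vx_bij ar_bij by (auto simp: bij_betw_def)
    show "tail Q (ar c) = vx (parent c) \<and> head Q (ar c) = vx c" if "c \<noteq> DV 0" "out c" for c
      using directed[OF that(1)] that(2) parent_neq[OF that(1)] \<phi>_vx by (metis out_def)
    show "tail Q (ar c) = vx c \<and> head Q (ar c) = vx (parent c)" if "c \<noteq> DV 0" "\<not> out c" for c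
      using directed[OF that(1)] that(2) by (auto simp: out_def)
    show "out (DV (Suc j))" if "N \<le> j" for j
      using N that by (meson mem_Collect_eq not_less)
  qed
  then show ?thesis by blast
qed

theorem proposition5p2:
  fixes \<Omega> :: "('a, 'b) pre_digraph"
    and s :: "'k::field \<Rightarrow> 'v::ab_group_add \<Rightarrow> 'v"
  assumes "vector_space s"
    and "wf_digraph \<Omega>"
    and "type_D_inf \<Omega>"
    and "eventually_outward \<Omega>"
  shows "well_founded_indecomposables \<Omega> s"
proof -
  obtain vx ar out N where "rooted_d_inf_quiver s \<Omega> vx ar out N"
    using rooted_d_inf_quiver_exists[OF assms] by blast
  then interpret rooted_d_inf_quiver s \<Omega> vx ar out N .
  show ?thesis
    unfolding well_founded_indecomposables_def using no_infinite_chain by blast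
qed

end
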